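(* Let $d\geq 3$ and $p\in[1,d-1)$. There exists a $d$-dimensional smooth manifold $M$ with a Riemannian metric $g$ such that $g,g^{-1}\in L^\infty_{\mathrm{loc}}$ and $g\in W^{1,p}_{\mathrm{loc}}(M)$, such that the metric measure space $(M,\mathsf d_g,\mathrm{vol}_g)$ is not infinitesimally Hilbertian.
   Context: For a measurable Riemannian metric $g$ with $g,g^{-1}\in L^\infty_{\mathrm{loc}}$: ${\rm d}\mathrm{vol}_g=\sqrt{\det g}\,{\rm d}\mathcal L^d$ locally and $\mathsf d_g(x,y)=\sup\{w(x)-w(y): w \text{ Lipschitz}, |\nabla_g w|_g\le1\text{ a.e.}\}$. Metric speed $|\dot\gamma_t|=\lim_{h\to0}\mathsf d_g(\gamma_{t+h},\gamma_t)/|h|$. A test plan is a Borel probability measure $\boldsymbol\pi$ on $C([0,1],M)$ with $(e_t)_\#\boldsymbol\pi\le C\,\mathrm{vol}_g$ for all $t$ and $\int\int_0^1|\dot\gamma_t|^2dt\,d\boldsymbol\pi<\infty$. A measurable $G\ge0$ is a weak upper gradient of a measurable $f$ if $\int|f(\gamma_1)-f(\gamma_0)|d\boldsymbol\pi\le\int\int_0^1G(\gamma_t)|\dot\gamma_t|dt\,d\boldsymbol\pi<\infty$ for all test plans; $|Df|_w$ is the minimal one. The Cheeger energy is $\mathrm{Ch}(f)=\frac12\int|Df|_w^2\,d\mathrm{vol}_g$ if $f$ has a weak upper gradient in $L^2$, and $+\infty$ otherwise. The space is infinitesimally Hilbertian if $\mathrm{Ch}$ is a quadratic form (equivalently satisfies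 the parallelogram identity $\mathrm{Ch}(f+h)+\mathrm{Ch}(f-h)=2\mathrm{Ch}(f)+2\mathrm{Ch}(h)$). *)

theory Defs
  imports "HOL-Probability.Probability"
begin

definition riem_metric :: "(real^'d) set \<Rightarrow> (real^'d \<Rightarrow> real^'d^'d) \<Rightarrow> bool" where
  "riem_metric U g \<longleftrightarrow>
     (\<forall>i j. (\<lambda>x. g x $ i $ j) \<in> borel_measurable borel) \<and>
     (\<forall>x\<in>U. transpose (g x) = g x \<and> (\<forall>v. v \<noteq> 0 \<longrightarrow> 0 < v \<bullet> (g x *v v)))"

definition Linf_loc_metric :: "(real^'d) set \<Rightarrow> (real^'d \<Rightarrow> real^'d^'d) \<Rightarrow> bool" where
  "Linf_loc_metric U g \<longleftrightarrow>
     (\<forall>K. compact K \<and> K \<subseteq> U \<longrightarrow>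
        (\<exists>C. AE x in lebesgue_on K. \<forall>i j. \<bar>g x $ i $ j\<bar> \<le> C \<and> \<bar>matrix_inv (g x) $ i $ j\<bar> \<le> C))"

definition Lp_loc :: "real \<Rightarrow> (real^'d) set \<Rightarrow> (real^'d \<Rightarrow> real) \<Rightarrow> bool" where
  "Lp_loc p U f \<longleftrightarrow> f \<in> borel_measurable (lebesgue_on U) \<and>
     (\<forall>K. compact K \<and> K \<subseteq> U \<longrightarrow> integrable (lebesgue_on K) (\<lambda>x. \<bar>f x\<bar> powr p))"

definition partial :: "'d \<Rightarrow> (real^'d \<Rightarrow> real) \<Rightarrow> real^'d \<Rightarrow> real" where
  "partial k \<phi> x = frechet_derivative \<phi> (at x) (axis k 1)"

coinductive smooth_fun :: "(real^'d \<Rightarrow> real) \<Rightarrow> bool" where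
  "\<phi> differentiable_on UNIV \<Longrightarrow> (\<And>k. smooth_fun (partial k \<phi>)) \<Longrightarrow> smooth_fun \<phi>"

definition test_fun :: "(real^'d) set \<Rightarrow> (real^'d \<Rightarrow> real) \<Rightarrow> bool" where
  "test_fun U \<phi> \<longleftrightarrow> smooth_fun \<phi> \<and> compact (closure {x. \<phi> x \<noteq> 0}) \<and> closure {x. \<phi> x \<noteq> 0} \<subseteq> U"

definition W1p_loc :: "real \<Rightarrow> (real^'d) set \<Rightarrow> (real^'d \<Rightarrow> real) \<Rightarrow> bool" where
  "W1p_loc p U f \<longleftrightarrow> Lp_loc p U f \<and>
     (\<forall>k. \<exists>D. Lp_loc p U D \<and>
        (\<forall>\<phi>. test_fun U \<phi> \<longrightarrow>
           integral\<^sup>L (lebesgue_on U) (\<lambda>x. f x * partial k \<phi> x) = - integral\<^sup>L (lebesgue_on U) (\<lambda>x. D x * \<phi> x)))"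

definition W1p_loc_metric :: "real \<Rightarrow> (real^'d) set \<Rightarrow> (real^'d \<Rightarrow> real^'d^'d) \<Rightarrow> bool" where
  "W1p_loc_metric p U g \<longleftrightarrow> (\<forall>i j. W1p_loc p U (\<lambda>x. g x $ i $ j))"

definition vol_g :: "(real^'d) set \<Rightarrow> (real^'d \<Rightarrow> real^'d^'d) \<Rightarrow> (real^'d) measure" where
  "vol_g U g = density (lebesgue_on U) (\<lambda>x. ennreal (sqrt (det (g x))))"

definition adm_fun :: "(real^'d) set \<Rightarrow> (real^'d \<Rightarrow> real^'d^'d) \<Rightarrow> (real^'d \<Rightarrow> real) set" where
  "adm_fun U g = {w. (\<forall>x\<in>U. \<exists>r>0. \<exists>C. C-lipschitz_on (ball x r \<inter> U) w) \<and>
      (AE x in lebesgue_on U. \<exists>D. (w has_derivative (\<lambda>h. D \<bullet> h)) (at x) \<and>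
                                   (matrix_inv (g x) *v D) \<bullet> D \<le> 1)}"

definition dist_g :: "(real^'d) set \<Rightarrow> (real^'d \<Rightarrow> real^'d^'d) \<Rightarrow> real^'d \<Rightarrow> real^'d \<Rightarrow> ereal" where
  "dist_g U g x y = (SUP w\<in>adm_fun U g. ereal (w x - w y))"

text \<open>Curves C([0,1],U), represented as functions extensional on [0,1], with the
  Borel sigma-algebra of uniform convergence (= trace of the product sigma-algebra).\<close>
definition curves :: "(real^'d) set \<Rightarrow> (real \<Rightarrow> real^'d) set" where
  "curves U = {\<gamma>. \<gamma> \<in> extensional {0..1} \<and> continuous_on {0..1} \<gamma> \<and> \<gamma> ` {0..1} \<subseteq> U}"

definition curve_space :: "(real^'d) set \<Rightarrow> (real \<Rightarrow> real^'d) measure" where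
  "curve_space U = restrict_space (PiM {0..1} (\<lambda>_. borel)) (curves U)"

text \<open>Metric speed (for absolutely continuous curves the limit exists a.e. and equals this limsup).\<close>
definition mspeed :: "(real^'d) set \<Rightarrow> (real^'d \<Rightarrow> real^'d^'d) \<Rightarrow> (real \<Rightarrow> real^'d) \<Rightarrow> real \<Rightarrow> ereal" where
  "mspeed U g \<gamma> t = Limsup (at t within {0..1}) (\<lambda>s. dist_g U g (\<gamma> s) (\<gamma> t) / ereal \<bar>s - t\<bar>)"

definition ac_curve :: "(real^'d) set \<Rightarrow> (real^'d \<Rightarrow> real^'d^'d) \<Rightarrow> (real \<Rightarrow> real^'d) \<Rightarrow> bool" where
  "ac_curve U g \<gamma> \<longleftrightarrow> (\<exists>m. set_integrable lborel {0..1} m \<and>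
      (\<forall>s t. 0 \<le> s \<longrightarrow> s \<le> t \<longrightarrow> t \<le> 1 \<longrightarrow>
         dist_g U g (\<gamma> s) (\<gamma> t) \<le> ereal (LINT u:{s..t}|lborel. m u)))"

definition test_plan :: "(real^'d) set \<Rightarrow> (real^'d \<Rightarrow> real^'d^'d) \<Rightarrow> (real \<Rightarrow> real^'d) measure \<Rightarrow> bool" where
  "test_plan U g \<pi> \<longleftrightarrow> prob_space \<pi> \<and> sets \<pi> = sets (curve_space U) \<and>
     (\<exists>C. \<forall>t\<in>{0..1}. \<forall>A\<in>sets borel.
        emeasure (distr \<pi> borel (\<lambda>\<gamma>. \<gamma> t)) A \<le> ennreal C * emeasure (vol_g U g) (A \<inter> U)) \<and>
     (AE \<gamma> in \<pi>. ac_curve U g \<gamma>) \<and>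
     (\<integral>\<^sup>+\<gamma>. (\<integral>\<^sup>+t. (e2ennreal (mspeed U g \<gamma> t))\<^sup>2 * indicator {0..1} t \<partial>lborel) \<partial>\<pi>) < \<infinity>"

definition weak_upper_gradient ::
    "(real^'d) set \<Rightarrow> (real^'d \<Rightarrow> real^'d^'d) \<Rightarrow> (real^'d \<Rightarrow> real) \<Rightarrow> (real^'d \<Rightarrow> real) \<Rightarrow> bool" where
  "weak_upper_gradient U g f G \<longleftrightarrow> G \<in> borel_measurable borel \<and> (\<forall>x. 0 \<le> G x) \<and>
     (\<forall>\<pi>. test_plan U g \<pi> \<longrightarrow>
        (\<integral>\<^sup>+\<gamma>. ennreal \<bar>f (\<gamma> 1) - f (\<gamma> 0)\<bar> \<partial>\<pi>)
          \<le> (\<integral>\<^sup>+\<gamma>. (\<integral>\<^sup>+t. ennreal (G (\<gamma> t)) * e2ennreal (mspeed U g \<gamma> t) * indicator {0..1} t \<partial>lborel) \<partial>\<pi>) \<and>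
        (\<integral>\<^sup>+\<gamma>. (\<integral>\<^sup>+t. ennreal (G (\<gamma> t)) * e2ennreal (mspeed U g \<gamma> t) * indicator {0..1} t \<partial>lborel) \<partial>\<pi>) < \<infinity>)"

text \<open>Cheeger energy: (1/2) of the integral of the squared minimal weak upper gradient,
  i.e. (1/2) inf over weak upper gradients of the integral of G^2 (+infinity if none is in L^2).\<close>
definition cheeger :: "(real^'d) set \<Rightarrow> (real^'d \<Rightarrow> real^'d^'d) \<Rightarrow> (real^'d \<Rightarrow> real) \<Rightarrow> ennreal" where
  "cheeger U g f = (INF G\<in>{G. weak_upper_gradient U g f G}. \<integral>\<^sup>+x. (ennreal (G x))\<^sup>2 \<partial>vol_g U g) / 2"

definition inf_hilbertian :: "(real^'d) set \<Rightarrow> (real^'d \<Rightarrow> real^'d^'d) \<Rightarrow> bool" where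
  "inf_hilbertian U g \<longleftrightarrow>
     (\<forall>f h. f \<in> borel_measurable borel \<longrightarrow> h \<in> borel_measurable borel \<longrightarrow>
        cheeger U g (\<lambda>x. f x + h x) + cheeger U g (\<lambda>x. f x - h x) = 2 * cheeger U g f + 2 * cheeger U g h)"

end

theory Submission
  imports Defs
begin

text \<open>
  Fix three coordinate directions a, b, e and let the metric on the unit box be diagonal with entries
  1 / t, 1 / (1 - t), t (1 - t) in these directions and 1 in the others. The profile t takes values in
  [1/4, 3/4] and depends only on the coordinates other than a. It equals 3/4 on a dense family of thin
  tubes in direction a (the highways) and 1/4 off slightly larger tubes. A line is a single point of
  the d - 1 transversal coordinates, which has zero W^{1,p} capacity because p < d - 1; hence thin
  tubes cost little Sobolev energy.

  The covectors dx_a + dx_b and dx_a - dx_b have norm t + (1 - t) = 1 everywhere, so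
  Ch (x_a + x_b) and Ch (x_a - x_b) are at most 1/2. By continuity of admissible functions and density
  of the highways every segment in direction a has speed at most sqrt (4/3), although the metric
  allows this only on a small set; test plans moving in direction a then give Ch (x_a) \<ge> 3/8.
  The slabs containing the tubes fill at most half of the box, and test plans moving in direction b
  in the complement give Ch (x_b) \<ge> 3/16. This violates the parallelogram identity.
\<close>

text \<open>If the squared gradient were always the \<open>g\<close>-norm of the differential, x_a
  and x_b would contribute t + (1 - t) = 1 in sum and the parallelogram identity would hold for
  them. But an admissible function obeys its gradient bound only almost everywhere and is
  continuous: no single line constrains it, whereas a bound valid on lines that meet every ball
  around a point in positive measure passes to the line through that point. So the highways raise
  the squared gradient of x_a to at least 3/4 in the mean over the whole box, at no expense for x_b
  off the tubes. Doubled energies: 3/4 for x_a and 3/4 times 1/2 for x_b, in sum 9/8, against at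
  most 1 for the two diagonals. Obstacle in direction b: the centres are dense, so the region off
  the tubes has empty interior and the line argument cannot start from open sets. It is run at those
  points of the region around which the region has positive measure, which are almost all of them.
  Slabs in the coordinate e are removed instead of tubes because their complement is invariant in
  direction b. Determinant one makes the volume Lebesgue measure, so translating a set gives a plan
  with bounded marginals.\<close>

section \<open>Curves and weak upper gradients\<close>

text \<open>A Henstock-Kurzweil argument replaces differentiation of \<open>u\<close>. On a fine
  tagged partition an interval tagged outside \<open>N\<close> is governed by the local bound
  \<open>D\<close>, and one tagged in \<open>N\<close> by the integral of \<open>m\<close>; the
  latter are small in total. It serves twice: along curves with \<open>h\<close> a slope, and along
  coordinate lines with \<open>h\<close> constant.\<close>

lemma ac_growth_bound:
  fixes u m h :: "real \<Rightarrow> real"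
  assumes ab: "a \<le> b"
    and m: "m integrable_on {a..b}"
    and um: "\<And>s t. a \<le> s \<Longrightarrow> s \<le> t \<Longrightarrow> t \<le> b \<Longrightarrow> \<bar>u t - u s\<bar> \<le> integral {s..t} m"
    and h: "h integrable_on {a..b}"
    and N: "negligible N"
    and D: "\<And>t e. t \<in> {a..b} - N \<Longrightarrow> e > 0 \<Longrightarrow>
              \<exists>d>0. \<forall>s\<in>{a..b}. \<bar>s - t\<bar> < d \<longrightarrow> \<bar>u s - u t\<bar> \<le> (h t + e) * \<bar>s - t\<bar>"
  shows "\<bar>u b - u a\<bar> \<le> integral {a..b} h"
proof (rule field_le_epsilon)
  fix e :: real assume e: "e > 0"
  \<comment> \<open>\<open>m'\<close> vanishes on \<open>N\<close>, so for a tag in \<open>N\<close>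
    the Henstock error of \<open>m'\<close> is the absolute value of the integral of
    \<open>m\<close> over the interval; Henstock's lemma makes the sum of these errors less than
    \<open>e / 4\<close>.\<close>
  define m' where "m' = (\<lambda>t. if t \<in> N then 0 else m t)"
  define h' where "h' = (\<lambda>t. if t \<in> N then 0 else h t)"
  \<comment> \<open>The slack \<open>e0\<close> per unit length adds up to at most
    \<open>e / 4\<close>; the Riemann sum of \<open>h'\<close> and the Henstock errors of
    \<open>m'\<close> cost \<open>e / 4\<close> each.\<close>
  define e0 where "e0 = e / (4 * (b - a + 1))"
  have e0: "e0 > 0" "e0 * (b - a) \<le> e / 4"
    using e ab by (auto simp: e0_def field_simps)
  have m'_int: "m' integrable_on {a..b}"
    using integrable_spike[OF m N] unfolding m'_def by auto
  have m'_eq: "integral K m' = integral K m" for K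
    by (rule integral_spike[OF N]) (auto simp: m'_def)
  have h'_int: "h' integrable_on {a..b}"
    using integrable_spike[OF h N] unfolding h'_def by auto
  have h'_eq: "integral K h' = integral K h" for K
    by (rule integral_spike[OF N]) (auto simp: h'_def)
  obtain g1 where g1: "gauge g1"
    "\<And>p. p tagged_partial_division_of (cbox a b) \<Longrightarrow> g1 fine p \<Longrightarrow>
        sum (\<lambda>(x,k). norm (measure lborel k *\<^sub>R m' x - integral k m')) p < e / 4"
    using Henstock_lemma[of m' a b "e/4"] m'_int e by auto
  obtain g2 where g2: "gauge g2"
    "\<And>p. p tagged_division_of {a..b} \<Longrightarrow> g2 fine p \<Longrightarrow>
        norm (sum (\<lambda>(x,k). measure lborel k *\<^sub>R h' x) p - integral {a..b} h') < e / 4"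
    using integrable_integral[OF h'_int] e unfolding has_integral_real
    by (metis zero_less_divide_iff zero_less_numeral)
  define d where "d t = (if t \<in> {a..b} - N then
      SOME d. d > 0 \<and> (\<forall>s\<in>{a..b}. \<bar>s - t\<bar> < d \<longrightarrow> \<bar>u s - u t\<bar> \<le> (h t + e0) * \<bar>s - t\<bar>) else 1)" for t
  have d: "d t > 0 \<and> (\<forall>s\<in>{a..b}. \<bar>s - t\<bar> < d t \<longrightarrow> \<bar>u s - u t\<bar> \<le> (h t + e0) * \<bar>s - t\<bar>)"
    if "t \<in> {a..b} - N" for t
    using someI_ex[OF D[OF that e0(1), unfolded Bex_def]] that unfolding d_def by auto
  have d0: "d t > 0" for t
    using d[of t] by (cases "t \<in> {a..b} - N") (auto simp: d_def)
  have g3: "gauge (\<lambda>t. ball t (d t))" using d0 by (simp add: gauge_ball_dependent)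
  have "gauge (\<lambda>t. g1 t \<inter> g2 t \<inter> ball t (d t))"
    by (intro gauge_Int g1 g2 g3)
  then obtain p where p: "p tagged_division_of {a..b}" and fine: "(\<lambda>t. g1 t \<inter> g2 t \<inter> ball t (d t)) fine p"
    using fine_division_exists_real by blast
  have fin: "finite p" using p by blast
  have f1: "g1 fine p" and f2: "g2 fine p" and f3: "(\<lambda>t. ball t (d t)) fine p"
    using fine by (auto simp: fine_def)
  have pt: "\<bar>u (Sup K) - u (Inf K)\<bar> \<le>
      (measure lborel K *\<^sub>R h' t) + e0 * (Sup K - Inf K) + norm (measure lborel K *\<^sub>R m' t - integral K m')"
    if tK: "(t, K) \<in> p" for t K
  proof -
    have tin: "t \<in> K" and Kab: "K \<subseteq> {a..b}" using p tK by blast+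
    obtain c c' where K: "K = {c..c'}"
      using p tK by (metis box_real(2) tagged_division_ofD(4))
    have cc: "c \<le> t" "t \<le> c'" using tin K by auto
    have ac: "a \<le> c" "c' \<le> b" using Kab cc unfolding K by auto
    have S: "Sup K = c'" "Inf K = c" "measure lborel K = c' - c" using cc K by auto
    show ?thesis
    proof (cases "t \<in> N")
      case True
      have "\<bar>u c' - u c\<bar> \<le> integral K m'" using um[of c c'] ac cc unfolding m'_eq K by auto
      moreover have "0 \<le> e0 * (c' - c)" using cc e0 by simp
      ultimately show ?thesis using True by (simp add: S h'_def m'_def)
    next
      case False
      have tab: "t \<in> {a..b} - N" using False tin Kab by auto
      have "K \<subseteq> ball t (d t)" using f3 tK by (auto simp: fine_def)
      then have c1: "\<bar>c - t\<bar> < d t" and c2: "\<bar>c' - t\<bar> < d t"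
        using subsetD[of K "ball t (d t)" c] subsetD[of K "ball t (d t)" c'] cc unfolding K
        by (simp_all add: dist_real_def abs_minus_commute)
      have "\<bar>u c - u t\<bar> \<le> (h t + e0) * \<bar>c - t\<bar>" "\<bar>u c' - u t\<bar> \<le> (h t + e0) * \<bar>c' - t\<bar>"
        using d[OF tab] c1 c2 ac cc by (metis atLeastAtMost_iff order_trans)+
      then have "\<bar>u c' - u c\<bar> \<le> (h t + e0) * (c' - t) + (h t + e0) * (t - c)"
        using cc by auto
      also have "\<dots> = (c' - c) * h t + e0 * (c' - c)" by (simp add: algebra_simps)
      finally have "\<bar>u c' - u c\<bar> \<le> (c' - c) * h t + e0 * (c' - c)" .
      then show ?thesis using False by (simp add: S h'_def)
    qed
  qed
  have "u b - u a = (\<Sum>(t,K)\<in>p. u (Sup K) - u (Inf K))"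
    using additive_tagged_division_1[OF ab p, of u] by simp
  also have "\<bar>\<dots>\<bar> \<le> (\<Sum>(t,K)\<in>p. \<bar>u (Sup K) - u (Inf K)\<bar>)"
    by (rule order_trans[OF sum_abs]) (simp add: split_def)
  also have "\<dots> \<le> (\<Sum>(t,K)\<in>p. (measure lborel K *\<^sub>R h' t) + e0 * (Sup K - Inf K) + norm (measure lborel K *\<^sub>R m' t - integral K m'))"
    by (rule sum_mono) (use pt in auto)
  also have "\<dots> = (\<Sum>(t,K)\<in>p. measure lborel K *\<^sub>R h' t) + e0 * (\<Sum>(t,K)\<in>p. Sup K - Inf K)
       + (\<Sum>(t,K)\<in>p. norm (measure lborel K *\<^sub>R m' t - integral K m'))"
    by (simp add: split_def sum.distrib sum_distrib_left)
  also have "(\<Sum>(t,K)\<in>p. Sup K - Inf K) = b - a"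
    using additive_tagged_division_1[OF ab p, of "\<lambda>x. x"] by simp
  also have "(\<Sum>(t,K)\<in>p. measure lborel K *\<^sub>R h' t) \<le> integral {a..b} h + e / 4"
    using g2(2)[OF p f2] unfolding h'_eq real_scaleR_def real_norm_def by linarith
  also have "(\<Sum>(t,K)\<in>p. norm (measure lborel K *\<^sub>R m' t - integral K m')) \<le> e / 4"
    using g1(2)[of p] p f1 by (auto simp: tagged_division_of_def intro: less_imp_le)
  finally show "\<bar>u b - u a\<bar> \<le> integral {a..b} h + e" using e0 e by linarith
qed

text \<open>The speed of a curve is not known to be jointly measurable, and the integral of a non-measurable
  function is a lower integral; the next two facts are what survives without measurability of f.\<close>

lemma nn_integral_distr_le:
  assumes T: "T \<in> measurable M N"
  shows "(\<integral>\<^sup>+x. f x \<partial>distr M N T) \<le> (\<integral>\<^sup>+x. f (T x) \<partial>M)"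
  unfolding nn_integral_def[of "distr M N T"]
proof (safe intro!: SUP_least)
  fix g assume g: "simple_function (distr M N T) g" "g \<le> f"
  have "integral\<^sup>S (distr M N T) g = (\<integral>\<^sup>+x. g x \<partial>distr M N T)"
    by (rule nn_integral_eq_simple_integral[OF g(1), symmetric])
  also have "\<dots> = (\<integral>\<^sup>+x. g (T x) \<partial>M)"
    using T borel_measurable_simple_function[OF g(1)] by (rule nn_integral_distr)
  also have "\<dots> \<le> (\<integral>\<^sup>+x. f (T x) \<partial>M)"
    using g(2) by (intro nn_integral_mono) (auto simp: le_fun_def)
  finally show "integral\<^sup>S (distr M N T) g \<le> (\<integral>\<^sup>+x. f (T x) \<partial>M)" .
qed

lemma le_add_diff_ennreal: "a \<le> c + (a - c)" for a c :: ennreal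
  by (cases "c \<le> a") (auto simp: add_diff_inverse_ennreal intro: add_increasing2)

lemma nn_integral_add_le:
  fixes f c :: "'a \<Rightarrow> ennreal"
  assumes [measurable]: "c \<in> borel_measurable M" and fin: "\<And>x. c x \<noteq> \<infinity>"
  shows "(\<integral>\<^sup>+x. c x + f x \<partial>M) \<le> (\<integral>\<^sup>+x. c x \<partial>M) + (\<integral>\<^sup>+x. f x \<partial>M)"
  unfolding nn_integral_def[of M "\<lambda>x. c x + f x"]
proof (safe intro!: SUP_least)
  fix g assume g: "simple_function M g" "g \<le> (\<lambda>x. c x + f x)"
  have [measurable]: "g \<in> borel_measurable M"
    by (rule borel_measurable_simple_function[OF g(1)])
  have le: "g x \<le> c x + f x" for x using g(2) by (auto simp: le_fun_def)
  have "integral\<^sup>S M g = (\<integral>\<^sup>+x. g x \<partial>M)"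
    by (rule nn_integral_eq_simple_integral[OF g(1), symmetric])
  \<comment> \<open>The truncated difference \<open>g - c\<close> is measurable and lies below
    \<open>f\<close>, so the lower integral of \<open>f\<close> accounts for it although
    \<open>f\<close> itself may be non-measurable.\<close>
  also have "\<dots> \<le> (\<integral>\<^sup>+x. c x + (g x - c x) \<partial>M)"
    by (intro nn_integral_mono) (simp add: le_add_diff_ennreal)
  also have "\<dots> = (\<integral>\<^sup>+x. c x \<partial>M) + (\<integral>\<^sup>+x. g x - c x \<partial>M)"
    by (rule nn_integral_add) measurable
  also have "\<dots> \<le> (\<integral>\<^sup>+x. c x \<partial>M) + (\<integral>\<^sup>+x. f x \<partial>M)"
    by (intro add_left_mono nn_integral_mono) (use le fin in \<open>auto simp: ennreal_minus_le_iff\<close>)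
  finally show "integral\<^sup>S M g \<le> (\<integral>\<^sup>+x. c x \<partial>M) + (\<integral>\<^sup>+x. f x \<partial>M)" .
qed

text \<open>The upper limit of the difference quotients at \<open>t\<close>, written as a countable
  infimum of suprema so that it is visibly Borel. It is a measurable minorant of the metric
  speed.\<close>

definition slope :: "(real \<Rightarrow> real) \<Rightarrow> real \<Rightarrow> ennreal" where
  "slope u t = (INF n::nat. SUP s\<in>{0..1}.
     if 0 < \<bar>s - t\<bar> \<and> \<bar>s - t\<bar> < 1 / Suc n then ennreal (\<bar>u s - u t\<bar> / \<bar>s - t\<bar>) else 0)"

text \<open>For fixed \<open>s\<close> and \<open>n\<close> the strict superlevel sets are open,
  after clearing the denominator. The uncountable supremum over \<open>s\<close> only unites open
  sets, so no countable dense set of times enters.\<close>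

lemma borel_measurable_slope:
  assumes u: "continuous_on UNIV u"
  shows "slope u \<in> borel_measurable borel"
proof -
  have "(\<lambda>t. SUP s\<in>{0..1}.
     if 0 < \<bar>s - t\<bar> \<and> \<bar>s - t\<bar> < 1 / Suc n then ennreal (\<bar>u s - u t\<bar> / \<bar>s - t\<bar>) else 0) \<in> borel_measurable borel"
    for n :: nat
  proof (rule borel_measurableI_greater)
    fix a :: ennreal
    define A where "A s = {t. a < (if 0 < \<bar>s - t\<bar> \<and> \<bar>s - t\<bar> < 1 / Suc n then ennreal (\<bar>u s - u t\<bar> / \<bar>s - t\<bar>) else 0)}" for s
    have "open (A s)" for s
    proof (cases a)
      case (real r)
      have "A s = {t. 0 < \<bar>s - t\<bar>} \<inter> {t. \<bar>s - t\<bar> < 1 / Suc n} \<inter> {t. r * \<bar>s - t\<bar> < \<bar>u s - u t\<bar>}"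
        using real by (auto simp: A_def ennreal_less_iff field_simps split: if_splits)
      also have "open \<dots>"
        by (intro open_Int open_Collect_less continuous_intros continuous_on_subset[OF u]) auto
      finally show ?thesis .
    next
      case top
      then have "A s = {}" unfolding A_def by auto
      then show ?thesis by simp
    qed
    then have "open (\<Union>s\<in>{0..1}. A s)" by blast
    also have "(\<Union>s\<in>{0..1}. A s) = {t \<in> space borel. a < (SUP s\<in>{0..1}.
       if 0 < \<bar>s - t\<bar> \<and> \<bar>s - t\<bar> < 1 / Suc n then ennreal (\<bar>u s - u t\<bar> / \<bar>s - t\<bar>) else 0)}"
      unfolding A_def less_SUP_iff by (simp only: space_borel UNIV_I simp_thms) blast
    finally show "{t \<in> space borel. a < (SUP s\<in>{0..1}.
       if 0 < \<bar>s - t\<bar> \<and> \<bar>s - t\<bar> < 1 / Suc n then ennreal (\<bar>u s - u t\<bar> / \<bar>s - t\<bar>) else 0)} \<in> sets borel"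
      by (rule borel_open)
  qed
  then have "(\<lambda>t. slope u t) \<in> borel_measurable borel"
    unfolding slope_def by (intro borel_measurable_INF) auto
  then show ?thesis by simp
qed

text \<open>In the application \<open>u\<close> is a function that is 1-Lipschitz for
  \<open>dist_g\<close>, read along \<open>\<gamma>\<close>; its difference quotients are dominated
  by those that define \<open>mspeed\<close>.\<close>

lemma slope_le_mspeed:
  assumes t: "t \<in> {0..1}"
    and u: "\<And>s. s \<in> {0..1} \<Longrightarrow> ereal \<bar>u s - u t\<bar> \<le> dist_g U g (\<gamma> s) (\<gamma> t)"
  shows "slope u t \<le> e2ennreal (mspeed U g \<gamma> t)"
proof (rule dense_ge)
  fix z assume z: "e2ennreal (mspeed U g \<gamma> t) < z"
  show "slope u t \<le> z"
  proof (cases z)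
    case (real r)
    have "mspeed U g \<gamma> t < ereal r"
    proof (rule ccontr)
      assume "\<not> mspeed U g \<gamma> t < ereal r"
      then have "e2ennreal (ereal r) \<le> e2ennreal (mspeed U g \<gamma> t)"
        by (intro e2ennreal_mono) auto
      then show False using z real by (simp add: e2ennreal_ereal)
    qed
    then have "eventually (\<lambda>s. dist_g U g (\<gamma> s) (\<gamma> t) / ereal \<bar>s - t\<bar> < ereal r) (at t within {0..1})"
      unfolding mspeed_def by (rule Limsup_lessD)
    then obtain d where d: "d > 0" "\<And>s. s \<in> {0..1} \<Longrightarrow> s \<noteq> t \<Longrightarrow> \<bar>s - t\<bar> < d \<Longrightarrow>
        dist_g U g (\<gamma> s) (\<gamma> t) / ereal \<bar>s - t\<bar> < ereal r"
      unfolding eventually_at by (auto simp: dist_real_def)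
    obtain n :: nat where n: "1 / Suc n < d"
      using nat_approx_posE[OF d(1)] by blast
    have "slope u t \<le> (SUP s\<in>{0..1}.
     if 0 < \<bar>s - t\<bar> \<and> \<bar>s - t\<bar> < 1 / Suc n then ennreal (\<bar>u s - u t\<bar> / \<bar>s - t\<bar>) else 0)"
      unfolding slope_def by (rule INF_lower) simp
    also have "\<dots> \<le> z"
    proof (rule SUP_least)
      fix s :: real assume s: "s \<in> {0..1}"
      have "ennreal (\<bar>u s - u t\<bar> / \<bar>s - t\<bar>) \<le> z" if st: "0 < \<bar>s - t\<bar>" "\<bar>s - t\<bar> < 1 / Suc n"
      proof -
        have "ereal (\<bar>u s - u t\<bar> / \<bar>s - t\<bar>) = ereal \<bar>u s - u t\<bar> / ereal \<bar>s - t\<bar>"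
          using st by simp
        also have "\<dots> \<le> dist_g U g (\<gamma> s) (\<gamma> t) / ereal \<bar>s - t\<bar>"
          using u[OF s] st by (intro ereal_divide_right_mono) auto
        also have "\<dots> < ereal r" using d(2)[OF s] st n by auto
        finally show ?thesis using real by (simp add: ennreal_leI)
      qed
      then show "(if 0 < \<bar>s - t\<bar> \<and> \<bar>s - t\<bar> < 1 / Suc n then ennreal (\<bar>u s - u t\<bar> / \<bar>s - t\<bar>) else 0) \<le> z"
        by auto
    qed
    finally show ?thesis .
  qed simp
qed

text \<open>Puts a finite slope into the form of hypothesis \<open>D\<close> of
  \<open>ac_growth_bound\<close>.\<close>

lemma slope_bound:
  assumes fin: "slope u t < \<infinity>" and e: "e > 0"
  shows "\<exists>d>0. \<forall>s\<in>{0..1}. \<bar>s - t\<bar> < d \<longrightarrow> \<bar>u s - u t\<bar> \<le> (enn2real (slope u t) + e) * \<bar>s - t\<bar>"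
proof -
  let ?h = "enn2real (slope u t)"
  have "slope u t = ennreal ?h" using fin by simp
  also have "\<dots> < ennreal (?h + e)" using e by (intro ennreal_lessI) (auto intro: add_nonneg_pos)
  finally obtain n :: nat where n: "(SUP s\<in>{0..1}. if 0 < \<bar>s - t\<bar> \<and> \<bar>s - t\<bar> < 1 / Suc n
      then ennreal (\<bar>u s - u t\<bar> / \<bar>s - t\<bar>) else 0) < ennreal (?h + e)"
    unfolding slope_def by (auto simp: INF_less_iff)
  show ?thesis
  proof (intro exI[of _ "1 / Suc n"] conjI ballI impI)
    fix s :: real assume s: "s \<in> {0..1}" "\<bar>s - t\<bar> < 1 / Suc n"
    show "\<bar>u s - u t\<bar> \<le> (?h + e) * \<bar>s - t\<bar>"
    proof (cases "s = t")
      case False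
      let ?q = "\<lambda>s. if 0 < \<bar>s - t\<bar> \<and> \<bar>s - t\<bar> < 1 / Suc n then ennreal (\<bar>u s - u t\<bar> / \<bar>s - t\<bar>) else 0"
      have "ennreal (\<bar>u s - u t\<bar> / \<bar>s - t\<bar>) = ?q s" using s False by simp
      also have "\<dots> \<le> (SUP s\<in>{0..1}. ?q s)" using s(1) by (rule SUP_upper)
      also have "\<dots> \<le> ennreal (?h + e)" using n by (rule less_imp_le)
      finally have "\<bar>u s - u t\<bar> / \<bar>s - t\<bar> \<le> ?h + e" using e
        by (subst (asm) ennreal_le_iff) (auto intro: add_nonneg_nonneg)
      then show ?thesis using False by (simp add: field_simps)
    qed simp
  qed simp
qed

text \<open>The slope of \<open>f\<close> along \<open>\<gamma>\<close> is measurable and below the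
  metric speed. If its integral is finite, \<open>ac_growth_bound\<close> applies, with absolute
  continuity of \<open>\<gamma>\<close> supplying the integrable \<open>m\<close>; if it is infinite
  there is nothing to show.\<close>

lemma ac_curve_variation:
  fixes \<gamma> :: "real \<Rightarrow> real^'d"
  assumes ac: "ac_curve U g \<gamma>" and \<gamma>: "\<gamma> \<in> curves U"
    and f: "continuous_on U f"
    and fd: "\<And>x y. x \<in> U \<Longrightarrow> y \<in> U \<Longrightarrow> ereal \<bar>f x - f y\<bar> \<le> dist_g U g x y"
  shows "ennreal \<bar>f (\<gamma> 1) - f (\<gamma> 0)\<bar> \<le> (\<integral>\<^sup>+t. e2ennreal (mspeed U g \<gamma> t) * indicator {0..1} t \<partial>lborel)"
proof -
  \<comment> \<open>Clamping the time makes \<open>u\<close> continuous on the whole line, as the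
    measurability of \<open>slope\<close> asks.\<close>
  define u where "u t = f (\<gamma> (max 0 (min 1 t)))" for t
  have \<gamma>U: "\<gamma> t \<in> U" if "t \<in> {0..1}" for t using \<gamma> that by (auto simp: curves_def)
  have u_eq: "u t = f (\<gamma> t)" if "t \<in> {0..1}" for t using that by (simp add: u_def)
  have cont: "continuous_on UNIV u"
    unfolding u_def
  proof (rule continuous_on_compose2[OF f])
    show "continuous_on UNIV (\<lambda>t. \<gamma> (max 0 (min 1 t)))"
      by (rule continuous_on_compose2[of "{0..1}" \<gamma>]) (use \<gamma> in \<open>auto simp: curves_def intro!: continuous_intros\<close>)
  qed (auto intro!: \<gamma>U)
  note [measurable] = borel_measurable_slope[OF cont]
  let ?I = "\<integral>\<^sup>+t. slope u t * indicator {0..1} t \<partial>lborel"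
  have I_le: "?I \<le> (\<integral>\<^sup>+t. e2ennreal (mspeed U g \<gamma> t) * indicator {0..1} t \<partial>lborel)"
  proof (rule nn_integral_mono)
    fix t :: real
    show "slope u t * indicator {0..1} t \<le> e2ennreal (mspeed U g \<gamma> t) * indicator {0..1} t"
      using slope_le_mspeed[of t u U g \<gamma>] fd \<gamma>U u_eq by (auto split: split_indicator)
  qed
  have "ennreal \<bar>u 1 - u 0\<bar> \<le> ?I"
  proof (cases "?I = \<infinity>")
    case False
    define h where "h t = enn2real (slope u t)" for t
    \<comment> \<open>\<open>enn2real\<close> sends infinity to 0, so on [0,1] \<open>h\<close>
      falls below the slope exactly on \<open>N\<close>; the finite integral makes \<open>N\<close>
      a null set.\<close>
    define N where "N = {t \<in> {0..1}. slope u t = \<infinity>}"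
    have "AE t in lborel. slope u t * indicator {0..1} t \<noteq> \<infinity>"
      using False by (intro nn_integral_PInf_AE) auto
    then have "AE t in lborel. t \<notin> N"
      by eventually_elim (auto simp: N_def)
    then have negN: "negligible N"
    proof -
      have "N \<in> sets lborel" unfolding N_def by measurable
      then have "N \<in> null_sets lborel"
        using \<open>AE t in lborel. t \<notin> N\<close> by (simp add: AE_iff_null_sets)
      then show ?thesis unfolding negligible_iff_null_sets by (rule null_sets_completionI)
    qed
    obtain m where m: "set_integrable lborel {0..1} m" and
      md: "\<And>s t. 0 \<le> s \<Longrightarrow> s \<le> t \<Longrightarrow> t \<le> 1 \<Longrightarrow>
         dist_g U g (\<gamma> s) (\<gamma> t) \<le> ereal (LINT u:{s..t}|lborel. m u)"
      using ac unfolding ac_curve_def by blast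
    have h_nn: "(\<integral>\<^sup>+t. ennreal (indicator {0..1} t * h t) \<partial>lborel) = ?I"
    proof (rule nn_integral_cong_AE)
      show "AE t in lborel. ennreal (indicator {0..1} t * h t) = slope u t * indicator {0..1} t"
        using \<open>AE t in lborel. t \<notin> N\<close>
        by eventually_elim (auto simp: N_def h_def less_top split: split_indicator)
    qed
    have h_int: "set_integrable lborel {0..1} h"
      unfolding set_integrable_def
    proof (rule integrableI_nonneg)
      show "(\<integral>\<^sup>+t. ennreal (indicator {0..1} t *\<^sub>R h t) \<partial>lborel) < \<infinity>"
        using h_nn False by (simp add: less_top)
    qed (auto simp: h_def)
    have "\<bar>u 1 - u 0\<bar> \<le> integral {0..1} h"
    proof (rule ac_growth_bound[where m = m and N = N])
      show "m integrable_on {0..1}" using set_borel_integral_eq_integral(1)[OF m] .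
      show "h integrable_on {0..1}" using set_borel_integral_eq_integral(1)[OF h_int] .
      fix s t :: real assume st: "0 \<le> s" "s \<le> t" "t \<le> 1"
      have "set_integrable lborel {s..t} m"
        by (rule set_integrable_subset[OF m]) (use st in auto)
      then have "(LINT u:{s..t}|lborel. m u) = integral {s..t} m"
        by (rule set_borel_integral_eq_integral(2))
      moreover have "ereal \<bar>f (\<gamma> s) - f (\<gamma> t)\<bar> \<le> ereal (LINT u:{s..t}|lborel. m u)"
        using st by (intro order_trans[OF fd md] \<gamma>U) auto
      ultimately show "\<bar>u t - u s\<bar> \<le> integral {s..t} m"
        using st by (simp add: u_eq abs_minus_commute)
    next
      fix t e :: real assume t: "t \<in> {0..1} - N" and e: "e > 0"
      then have "slope u t < \<infinity>" by (auto simp: N_def less_top)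
      from slope_bound[OF this e]
      show "\<exists>d>0. \<forall>s\<in>{0..1}. \<bar>s - t\<bar> < d \<longrightarrow> \<bar>u s - u t\<bar> \<le> (h t + e) * \<bar>s - t\<bar>"
        unfolding h_def .
    qed (use negN in auto)
    also have "integral {0..1} h = (LINT t:{0..1}|lborel. h t)"
      using set_borel_integral_eq_integral(2)[OF h_int] by simp
    finally have "ennreal \<bar>u 1 - u 0\<bar> \<le> ennreal (LINT t:{0..1}|lborel. h t)"
      by (rule ennreal_leI)
    also have "\<dots> = (\<integral>\<^sup>+t. ennreal (indicator {0..1} t * h t) \<partial>lborel)"
      using h_int unfolding set_integrable_def set_lebesgue_integral_def
      by (subst nn_integral_eq_integral) (auto simp: h_def)
    finally show ?thesis using h_nn by simp
  qed simp
  also note I_le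
  finally show ?thesis by (simp add: u_eq)
qed

text \<open>The variation estimate holds for almost every curve of a plan and is then integrated.
  Finiteness of the right-hand side comes from the finite energy of the plan, through subadditivity
  with one measurable summand.\<close>

lemma weak_upper_gradient_one:
  fixes f :: "real^'d \<Rightarrow> real"
  assumes f: "continuous_on U f"
    and fd: "\<And>x y. x \<in> U \<Longrightarrow> y \<in> U \<Longrightarrow> ereal \<bar>f x - f y\<bar> \<le> dist_g U g x y"
  shows "weak_upper_gradient U g f (\<lambda>_. 1)"
  unfolding weak_upper_gradient_def
proof (intro conjI allI impI)
  fix \<pi> assume tp: "test_plan U g \<pi>"
  interpret prob_space \<pi> using tp by (simp add: test_plan_def)
  have "space \<pi> = space (curve_space U)"
    using tp by (intro sets_eq_imp_space_eq) (simp add: test_plan_def)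
  then have sp: "space \<pi> \<subseteq> curves U"
    by (auto simp: curve_space_def space_restrict_space)
  have "AE \<gamma> in \<pi>. ac_curve U g \<gamma>" using tp by (simp add: test_plan_def)
  with AE_space have "AE \<gamma> in \<pi>. ennreal \<bar>f (\<gamma> 1) - f (\<gamma> 0)\<bar> \<le>
     (\<integral>\<^sup>+t. ennreal 1 * e2ennreal (mspeed U g \<gamma> t) * indicator {0..1} t \<partial>lborel)"
  proof eventually_elim
    case (elim \<gamma>)
    then show ?case using ac_curve_variation[OF elim(2) _ f fd] sp by auto
  qed
  then show "(\<integral>\<^sup>+\<gamma>. ennreal \<bar>f (\<gamma> 1) - f (\<gamma> 0)\<bar> \<partial>\<pi>) \<le>
     (\<integral>\<^sup>+\<gamma>. (\<integral>\<^sup>+t. ennreal 1 * e2ennreal (mspeed U g \<gamma> t) * indicator {0..1} t \<partial>lborel) \<partial>\<pi>)"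
    by (rule nn_integral_mono_AE)
  \<comment> \<open>Since both [0,1] and the plan have mass one, this bounds the integral of the
    speed by one plus the energy.\<close>
  have sq: "x \<le> 1 + x\<^sup>2" for x :: ennreal
  proof (cases "x \<le> 1")
    case False
    then have "x * 1 \<le> x * x" by (intro mult_left_mono) auto
    then show ?thesis by (simp add: power2_eq_square add_increasing)
  qed (simp add: add_increasing2)
  let ?E = "\<lambda>\<gamma>. \<integral>\<^sup>+t. (e2ennreal (mspeed U g \<gamma> t))\<^sup>2 * indicator {0..1} t \<partial>lborel"
  have "(\<integral>\<^sup>+t. ennreal 1 * e2ennreal (mspeed U g \<gamma> t) * indicator {0..1} t \<partial>lborel) \<le> 1 + ?E \<gamma>" for \<gamma>
  proof -
    have "(\<integral>\<^sup>+t. ennreal 1 * e2ennreal (mspeed U g \<gamma> t) * indicator {0..1} t \<partial>lborel) \<le>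
      (\<integral>\<^sup>+t. indicator {0..1} t + (e2ennreal (mspeed U g \<gamma> t))\<^sup>2 * indicator {0..1} t \<partial>lborel)"
      by (intro nn_integral_mono) (auto split: split_indicator intro: sq)
    also have "\<dots> \<le> (\<integral>\<^sup>+t. indicator {0..1::real} t \<partial>lborel) + ?E \<gamma>"
      by (rule nn_integral_add_le) (auto split: split_indicator)
    finally show ?thesis by simp
  qed
  then have "(\<integral>\<^sup>+\<gamma>. (\<integral>\<^sup>+t. ennreal 1 * e2ennreal (mspeed U g \<gamma> t) * indicator {0..1} t \<partial>lborel) \<partial>\<pi>)
     \<le> (\<integral>\<^sup>+\<gamma>. 1 + ?E \<gamma> \<partial>\<pi>)" by (intro nn_integral_mono)
  also have "\<dots> \<le> (\<integral>\<^sup>+\<gamma>. 1 \<partial>\<pi>) + (\<integral>\<^sup>+\<gamma>. ?E \<gamma> \<partial>\<pi>)" by (rule nn_integral_add_le) (auto split: split_indicator)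
  also have "\<dots> < \<infinity>" using tp by (simp add: test_plan_def emeasure_space_1)
  finally show "(\<integral>\<^sup>+\<gamma>. (\<integral>\<^sup>+t. ennreal 1 * e2ennreal (mspeed U g \<gamma> t) * indicator {0..1} t \<partial>lborel) \<partial>\<pi>) < \<infinity>" .
qed auto

lemma cheeger_le_volume:
  fixes f :: "real^'d \<Rightarrow> real"
  assumes "continuous_on U f"
    and "\<And>x y. x \<in> U \<Longrightarrow> y \<in> U \<Longrightarrow> ereal \<bar>f x - f y\<bar> \<le> dist_g U g x y"
  shows "cheeger U g f \<le> emeasure (vol_g U g) (space (vol_g U g)) / 2"
proof -
  have "(INF G\<in>{G. weak_upper_gradient U g f G}. \<integral>\<^sup>+x. (ennreal (G x))\<^sup>2 \<partial>vol_g U g)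
      \<le> (\<integral>\<^sup>+x. (ennreal 1)\<^sup>2 \<partial>vol_g U g)"
    using weak_upper_gradient_one[OF assms] by (intro INF_lower2[of "\<lambda>_. 1"]) auto
  then show ?thesis unfolding cheeger_def by (intro divide_right_mono_ennreal) simp
qed

section \<open>Distances along coordinate lines\<close>

text \<open>For each fixed \<open>s\<close> a translation preserves null sets; Fubini then exchanges
  the two almost-everywhere quantifiers. This selects good lines without splitting the space into
  coordinates.\<close>

lemma AE_lborel_translate_lines:
  fixes e :: "'a::euclidean_space"
  assumes "AE y in lborel. P y"
  shows "AE x in lborel. AE s in lborel. P (x + s *\<^sub>R e)"
proof -
  obtain N where N: "N \<in> null_sets lborel" "{y. \<not> P y} \<subseteq> N"
    using assms by (auto simp: eventually_ae_filter)
  have [measurable]: "N \<in> sets borel" using N by auto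
  have "AE x in lborel. x + s *\<^sub>R e \<notin> N" for s
  proof -
    have "N \<in> null_sets (distr lborel borel ((+) (s *\<^sub>R e)))"
      using N(1) by (simp add: lborel_distr_plus)
    then have "AE y in distr lborel borel ((+) (s *\<^sub>R e)). y \<notin> N" by (rule AE_not_in)
    then have "AE x in lborel. s *\<^sub>R e + x \<notin> N" by (subst (asm) AE_distr_iff) auto
    then show ?thesis by (simp add: add.commute)
  qed
  then have A: "AE s in lborel. AE x in lborel. x + s *\<^sub>R e \<notin> N" by simp
  have "(AE x in lborel. AE s in lborel. x + s *\<^sub>R e \<notin> N) \<longleftrightarrow> (AE s in lborel. AE x in lborel. x + s *\<^sub>R e \<notin> N)"
    by (rule lborel_pair.AE_commute) measurable
  with A have "AE x in lborel. AE s in lborel. x + s *\<^sub>R e \<notin> N" by simp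
  then show ?thesis
    by eventually_elim (use N(2) in \<open>auto elim!: eventually_mono\<close>)
qed

lemma adm_fun_continuous_on:
  assumes "w \<in> adm_fun U g" and U: "open U"
  shows "continuous_on U w"
proof (rule continuous_at_imp_continuous_on, rule ballI)
  fix x assume x: "x \<in> U"
  then obtain r C where r: "r > 0" "C-lipschitz_on (ball x r \<inter> U) w"
    using assms unfolding adm_fun_def by blast
  have "continuous_on (ball x r \<inter> U) w" using r(2) by (rule lipschitz_on_continuous_on)
  then show "isCont w x"
    using x r U by (simp add: continuous_on_eq_continuous_at open_Int)
qed

text \<open>Along the segment \<open>w\<close> is Lipschitz by compactness, hence absolutely
  continuous, and its derivative is the component \<open>D $ i\<close>, which the norm constraint
  bounds by \<open>c\<close> at almost every time.\<close>

lemma adm_fun_line_growth: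
  fixes z :: "real^'d" and i :: 'd
  defines "e \<equiv> axis i (1::real)"
  assumes w: "w \<in> adm_fun U g" and ab: "a \<le> b"
    and seg: "\<And>t. t \<in> {a..b} \<Longrightarrow> z + t *\<^sub>R e \<in> U"
    and ae: "AE t in lborel. t \<in> {a..b} \<longrightarrow> (\<exists>D. (w has_derivative (\<lambda>h. D \<bullet> h)) (at (z + t *\<^sub>R e)) \<and>
                (matrix_inv (g (z + t *\<^sub>R e)) *v D) \<bullet> D \<le> 1)"
    and bd: "\<And>t D. t \<in> {a..b} \<Longrightarrow> (matrix_inv (g (z + t *\<^sub>R e)) *v D) \<bullet> D \<le> 1 \<Longrightarrow> \<bar>D $ i\<bar> \<le> c"
  shows "\<bar>w (z + b *\<^sub>R e) - w (z + a *\<^sub>R e)\<bar> \<le> c * (b - a)"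
proof -
  define u where "u t = w (z + t *\<^sub>R e)" for t
  have ne: "norm e = 1" by (simp add: e_def)
  have de: "dist (z + s *\<^sub>R e) (z + t *\<^sub>R e) = \<bar>s - t\<bar>" for s t
    using ne by (simp add: dist_norm flip: scaleR_left_diff_distrib)
  \<comment> \<open>The one-point parameter set {0} makes \<open>u\<close> a time-independent field,
    so that the passage from local to global Lipschitz on a compact set can be quoted.\<close>
  have loc: "local_lipschitz {0::real} {a..b} (\<lambda>_. u)"
  proof (rule local_lipschitzI)
    fix t' t :: real assume t: "t \<in> {a..b}"
    obtain r C where r: "r > 0" and C: "C-lipschitz_on (ball (z + t *\<^sub>R e) r \<inter> U) w"
      using w seg[OF t] unfolding adm_fun_def by blast
    have "C-lipschitz_on (cball t (r/2) \<inter> {a..b}) u"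
    proof (rule lipschitz_onI)
      fix s s' assume s: "s \<in> cball t (r/2) \<inter> {a..b}" "s' \<in> cball t (r/2) \<inter> {a..b}"
      then have "z + s *\<^sub>R e \<in> ball (z + t *\<^sub>R e) r \<inter> U" "z + s' *\<^sub>R e \<in> ball (z + t *\<^sub>R e) r \<inter> U"
        using seg r ne by (auto simp: de dist_real_def abs_minus_commute)
      from lipschitz_onD[OF C this] show "dist (u s) (u s') \<le> C * dist s s'"
        unfolding u_def de dist_real_def .
    qed (rule lipschitz_on_nonneg[OF C])
    then show "\<exists>d>0. \<exists>L. \<forall>t'\<in>cball t' d \<inter> {0}. L-lipschitz_on (cball t d \<inter> {a..b}) u"
      using r by (intro exI[of _ "r/2"]) auto
  qed
  obtain L where L: "L-lipschitz_on {a..b} u"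
    by (rule local_lipschitz_compact_implies_lipschitz[OF loc]) auto
  obtain N where N: "N \<in> null_sets lborel" and
    ND: "{t. \<not> (t \<in> {a..b} \<longrightarrow> (\<exists>D. (w has_derivative (\<lambda>h. D \<bullet> h)) (at (z + t *\<^sub>R e)) \<and>
                (matrix_inv (g (z + t *\<^sub>R e)) *v D) \<bullet> D \<le> 1))} \<subseteq> N"
    using ae by (auto simp: eventually_ae_filter)
  have "\<bar>u b - u a\<bar> \<le> integral {a..b} (\<lambda>_. c)"
  proof (rule ac_growth_bound[OF ab, where m = "\<lambda>_. L" and N = N])
    show "negligible N" using N unfolding negligible_iff_null_sets by (rule null_sets_completionI)
    fix s t assume st: "a \<le> s" "s \<le> t" "t \<le> b"
    show "\<bar>u t - u s\<bar> \<le> integral {s..t} (\<lambda>_. L)"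
      using lipschitz_onD[OF L, of t s] st by (simp add: dist_real_def mult.commute)
  next
    fix t \<epsilon> :: real assume t: "t \<in> {a..b} - N" and \<epsilon>: "\<epsilon> > 0"
    then obtain D where D: "(w has_derivative (\<lambda>h. D \<bullet> h)) (at (z + t *\<^sub>R e))"
      and D1: "(matrix_inv (g (z + t *\<^sub>R e)) *v D) \<bullet> D \<le> 1"
      using ND by blast
    have "(u has_derivative (\<lambda>h. D \<bullet> (h *\<^sub>R e))) (at t)"
      unfolding u_def
      by (rule has_derivative_compose[of "\<lambda>t. z + t *\<^sub>R e" "\<lambda>h. h *\<^sub>R e" t UNIV w "\<lambda>h. D \<bullet> h"])
        (auto intro!: derivative_eq_intros D)
    moreover have "D \<bullet> e = D $ i" by (simp add: e_def inner_axis)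
    ultimately have "(u has_derivative (\<lambda>h. h * D $ i)) (at t)" by simp
    then obtain d where d: "d > 0"
      "\<And>s. norm (s - t) < d \<Longrightarrow> norm (u s - u t - (s - t) * D $ i) \<le> \<epsilon> * norm (s - t)"
      using \<epsilon> unfolding has_derivative_at_alt by blast
    have "\<bar>u s - u t\<bar> \<le> (c + \<epsilon>) * \<bar>s - t\<bar>" if "\<bar>s - t\<bar> < d" for s
    proof -
      have "\<bar>u s - u t\<bar> \<le> \<bar>u s - u t - (s - t) * D $ i\<bar> + \<bar>s - t\<bar> * \<bar>D $ i\<bar>"
        by (simp flip: abs_mult)
      also have "\<bar>s - t\<bar> * \<bar>D $ i\<bar> \<le> \<bar>s - t\<bar> * c"
        using bd[OF _ D1] t by (intro mult_left_mono) auto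
      also have "\<bar>u s - u t - (s - t) * D $ i\<bar> \<le> \<epsilon> * \<bar>s - t\<bar>" using d(2)[of s] that by simp
      finally show ?thesis by (simp add: algebra_simps)
    qed
    then show "\<exists>d>0. \<forall>s\<in>{a..b}. \<bar>s - t\<bar> < d \<longrightarrow> \<bar>u s - u t\<bar> \<le> (c + \<epsilon>) * \<bar>s - t\<bar>"
      using d(1) by blast
  qed auto
  then show ?thesis using ab by (simp add: u_def mult.commute)
qed

text \<open>The line through \<open>x\<close> itself may be bad for an admissible \<open>w\<close>,
  or run where the metric is slow. If \<open>w\<close> broke the bound there, continuity would carry
  the violation to all nearby parallel segments. A positive measure of these lies in the invariant
  set \<open>H\<close>, and almost all of them are good for \<open>w\<close>, which is a
  contradiction. Thus \<open>x\<close> has to be approximated by \<open>H\<close> in measure, not to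
  lie in it.\<close>

lemma dist_g_line_le:
  fixes x :: "real^'d" and i :: 'd
  defines "e \<equiv> axis i (1::real)"
  assumes U: "open U" "convex U" and H: "H \<in> sets borel"
    and inv: "\<And>x s. x \<in> H \<Longrightarrow> x + s *\<^sub>R e \<in> H"
    and bd: "\<And>x D. x \<in> H \<Longrightarrow> x \<in> U \<Longrightarrow> (matrix_inv (g x) *v D) \<bullet> D \<le> 1 \<Longrightarrow> \<bar>D $ i\<bar> \<le> c"
    and pos: "\<And>r. r > 0 \<Longrightarrow> emeasure lborel (ball x r \<inter> H) > 0"
    and xa: "x + a *\<^sub>R e \<in> U" and xb: "x + b *\<^sub>R e \<in> U"
  shows "dist_g U g (x + a *\<^sub>R e) (x + b *\<^sub>R e) \<le> ereal (c * \<bar>b - a\<bar>)"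
proof -
  have *: "\<bar>w (x + b *\<^sub>R e) - w (x + a *\<^sub>R e)\<bar> \<le> c * (b - a)"
    if w: "w \<in> adm_fun U g" and ab: "a \<le> b" and xa: "x + a *\<^sub>R e \<in> U" and xb: "x + b *\<^sub>R e \<in> U"
    for w a b
  proof (rule ccontr)
    assume neg: "\<not> ?thesis"
    have cont: "continuous_on U w" by (rule adm_fun_continuous_on[OF w U(1)])
    have "isCont (\<lambda>z. \<bar>w (z + b *\<^sub>R e) - w (z + a *\<^sub>R e)\<bar>) x"
      using cont xa xb U(1)
      by (intro continuous_intros isCont_o2[where g = w and f = "\<lambda>z. z + _"])
         (auto simp: continuous_on_eq_continuous_at)
    from order_tendstoD(1)[OF tendsto_at_iff_tendsto_nhds[THEN iffD1, OF this[unfolded isCont_def]], of "c * (b - a)"]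
    have "eventually (\<lambda>z. c * (b - a) < \<bar>w (z + b *\<^sub>R e) - w (z + a *\<^sub>R e)\<bar>) (nhds x)"
      using neg by auto
    moreover have "eventually (\<lambda>z. z + a *\<^sub>R e \<in> U) (nhds x)" "eventually (\<lambda>z. z + b *\<^sub>R e \<in> U) (nhds x)"
      using xa xb U(1)
      by (auto intro!: topological_tendstoD tendsto_eq_intros filterlim_ident)
    ultimately have "eventually (\<lambda>z. c * (b - a) < \<bar>w (z + b *\<^sub>R e) - w (z + a *\<^sub>R e)\<bar> \<and>
        z + a *\<^sub>R e \<in> U \<and> z + b *\<^sub>R e \<in> U) (nhds x)"
      by eventually_elim auto
    then obtain r where r: "r > 0" and rz: "\<And>z. z \<in> ball x r \<Longrightarrow>
        c * (b - a) < \<bar>w (z + b *\<^sub>R e) - w (z + a *\<^sub>R e)\<bar> \<and> z + a *\<^sub>R e \<in> U \<and> z + b *\<^sub>R e \<in> U"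
      unfolding eventually_nhds_metric by (auto simp: dist_commute)
    let ?P = "\<lambda>y. y \<in> U \<longrightarrow> (\<exists>D. (w has_derivative (\<lambda>h. D \<bullet> h)) (at y) \<and> (matrix_inv (g y) *v D) \<bullet> D \<le> 1)"
    have "AE y in lebesgue. ?P y"
      using w U(1) unfolding adm_fun_def by (simp add: AE_restrict_space_iff)
    then have "AE y in lborel. ?P y" by (simp add: AE_completion_iff)
    from AE_lborel_translate_lines[OF this, of e]
    obtain Z where Z: "Z \<in> null_sets lborel" "{z. \<not> (AE s in lborel. ?P (z + s *\<^sub>R e))} \<subseteq> Z"
      by (auto simp: eventually_ae_filter)
    \<comment> \<open>The null set \<open>Z\<close> of starting points of bad lines depends on
      \<open>w\<close>; positive measure of \<open>H\<close> near \<open>x\<close> is what lets one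
      choose a good line for every \<open>w\<close>.\<close>
    have "\<not> ball x r \<inter> H \<subseteq> Z"
    proof
      assume "ball x r \<inter> H \<subseteq> Z"
      then have "emeasure lborel (ball x r \<inter> H) \<le> emeasure lborel Z"
        using Z by (intro emeasure_mono) auto
      with Z(1) pos[OF r] show False by auto
    qed
    then obtain z where z: "z \<in> ball x r" "z \<in> H" "z \<notin> Z" by blast
    then have good: "AE s in lborel. ?P (z + s *\<^sub>R e)" using Z(2) by blast
    have seg: "z + t *\<^sub>R e \<in> U" if t: "t \<in> {a..b}" for t
    proof -
      have "closed_segment (z + a *\<^sub>R e) (z + b *\<^sub>R e) \<subseteq> U"
        using rz[OF z(1)] U(2) by (intro closed_segment_subset) auto
      moreover have "z + t *\<^sub>R e \<in> closed_segment (z + a *\<^sub>R e) (z + b *\<^sub>R e)"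
      proof (cases "a = b")
        case False
        with t have ab': "a < b" by auto
        define \<theta> where "\<theta> = (t - a) / (b - a)"
        have "\<theta> * (b - a) = t - a" using ab' by (simp add: \<theta>_def)
        then have "t = (1 - \<theta>) * a + \<theta> * b" by (simp add: algebra_simps)
        then have "z + t *\<^sub>R e = z + ((1 - \<theta>) * a + \<theta> * b) *\<^sub>R e" by (rule arg_cong)
        then have "z + t *\<^sub>R e = (1 - \<theta>) *\<^sub>R (z + a *\<^sub>R e) + \<theta> *\<^sub>R (z + b *\<^sub>R e)"
          by (simp add: algebra_simps)
        moreover have "0 \<le> \<theta>" "\<theta> \<le> 1" using t ab' by (auto simp: \<theta>_def)
        ultimately show ?thesis by (auto simp: in_segment)
      qed (use t in auto)
      ultimately show ?thesis by blast
    qed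
    have "\<bar>w (z + b *\<^sub>R e) - w (z + a *\<^sub>R e)\<bar> \<le> c * (b - a)"
      unfolding e_def
    proof (rule adm_fun_line_growth[OF w ab], fold e_def)
      show "z + t *\<^sub>R e \<in> U" if "t \<in> {a..b}" for t using seg that .
      show "AE t in lborel. t \<in> {a..b} \<longrightarrow> (\<exists>D. (w has_derivative (\<lambda>h. D \<bullet> h)) (at (z + t *\<^sub>R e)) \<and>
                (matrix_inv (g (z + t *\<^sub>R e)) *v D) \<bullet> D \<le> 1)"
        using good by eventually_elim (use seg in blast)
      show "\<bar>D $ i\<bar> \<le> c" if "t \<in> {a..b}" "(matrix_inv (g (z + t *\<^sub>R e)) *v D) \<bullet> D \<le> 1" for t D
        using bd[OF inv[OF z(2)] seg[OF that(1)] that(2)] .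
    qed
    with rz[OF z(1)] show False by auto
  qed
  show ?thesis
    unfolding dist_g_def
  proof (rule SUP_least)
    fix w assume w: "w \<in> adm_fun U g"
    have "w (x + a *\<^sub>R e) - w (x + b *\<^sub>R e) \<le> c * \<bar>b - a\<bar>"
      using *[OF w _ xa xb] *[OF w _ xb xa] by (cases "a \<le> b") auto
    then show "ereal (w (x + a *\<^sub>R e) - w (x + b *\<^sub>R e)) \<le> ereal (c * \<bar>b - a\<bar>)" by simp
  qed
qed

section \<open>Test plans by translation\<close>

lemma segment_point_in_convex:
  fixes x v :: "'a::real_vector"
  assumes "convex U" "x \<in> U" "x + v \<in> U" "t \<in> {0..1}"
  shows "x + t *\<^sub>R v \<in> U"
proof -
  have "x + t *\<^sub>R v = (1 - t) *\<^sub>R x + t *\<^sub>R (x + v)" by (simp add: algebra_simps)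
  also have "\<dots> \<in> U" using assms by (intro convexD) auto
  finally show ?thesis .
qed

text \<open>Restricted to [0,1] because \<open>curves\<close> consists of extensional
  functions.\<close>

definition segment_curve :: "'a::real_vector \<Rightarrow> 'a \<Rightarrow> real \<Rightarrow> 'a" where
  "segment_curve v x = restrict (\<lambda>t. x + t *\<^sub>R v) {0..1}"

lemma segment_curve_in_curves:
  assumes "convex U" "x \<in> U" "x + v \<in> U"
  shows "segment_curve v x \<in> curves U"
proof -
  have "x + t *\<^sub>R v \<in> U" if "t \<in> {0..1}" for t
    by (rule segment_point_in_convex[OF assms that])
  moreover have "continuous_on {0..1} (segment_curve v x)"
    unfolding segment_curve_def
    by (subst continuous_on_cong[OF refl, of _ _ "\<lambda>t. x + t *\<^sub>R v"]) (auto intro!: continuous_intros)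
  ultimately show ?thesis by (auto simp: curves_def segment_curve_def)
qed

lemma space_curve_space: "space (curve_space U) = curves U"
  by (auto simp: curve_space_def space_restrict_space curves_def space_PiM PiE_def)

lemma measurable_eval_curve_space:
  assumes "t \<in> {0..1}" shows "(\<lambda>\<gamma>. \<gamma> t) \<in> borel_measurable (curve_space U)"
  unfolding curve_space_def
  by (intro measurable_restrict_space1 measurable_component_singleton assms)

lemma mspeed_le:
  assumes t: "t \<in> {0..1}" and d: "\<And>s. s \<in> {0..1} \<Longrightarrow> dist_g U g (\<gamma> s) (\<gamma> t) \<le> ereal (k * \<bar>s - t\<bar>)"
  shows "e2ennreal (mspeed U g \<gamma> t) \<le> ennreal k"
proof -
  have "mspeed U g \<gamma> t \<le> ereal k"
    unfolding mspeed_def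
  proof (rule Limsup_bounded, unfold eventually_at_filter, rule always_eventually, intro allI impI)
    fix s assume s: "s \<noteq> t" "s \<in> {0..1}"
    have "dist_g U g (\<gamma> s) (\<gamma> t) / ereal \<bar>s - t\<bar> \<le> ereal (k * \<bar>s - t\<bar>) / ereal \<bar>s - t\<bar>"
      using d[OF s(2)] s by (intro ereal_divide_right_mono) auto
    also have "\<dots> = ereal k" using s by simp
    finally show "dist_g U g (\<gamma> s) (\<gamma> t) / ereal \<bar>s - t\<bar> \<le> ereal k" .
  qed
  then show ?thesis by (metis e2ennreal_mono e2ennreal_ereal)
qed

lemma ac_curve_lipschitz:
  assumes "\<And>s t. s \<in> {0..1} \<Longrightarrow> t \<in> {0..1} \<Longrightarrow> dist_g U g (\<gamma> s) (\<gamma> t) \<le> ereal (k * \<bar>s - t\<bar>)"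
  shows "ac_curve U g \<gamma>"
  unfolding ac_curve_def
proof (intro exI[of _ "\<lambda>_. k"] conjI allI impI)
  show "set_integrable lborel {0..1::real} (\<lambda>_. k)"
    unfolding set_integrable_def by (simp add: integrable_mult_left_iff integrable_indicator_iff)
  fix s t :: real assume "0 \<le> s" "s \<le> t" "t \<le> 1"
  then show "dist_g U g (\<gamma> s) (\<gamma> t) \<le> ereal (LINT u:{s..t}|lborel. k)"
    using assms[of s t] by (simp add: set_lebesgue_integral_def mult.commute)
qed

text \<open>Points outside A carry no mass; sending them to the curve issued from x0 only keeps the map total.\<close>

definition translation_plan :: "(real^'d) set \<Rightarrow> (real^'d) set \<Rightarrow> real^'d \<Rightarrow> real^'d \<Rightarrow> (real \<Rightarrow> real^'d) measure" where
  "translation_plan U A x0 v =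
     distr (uniform_measure lborel A) (curve_space U) (\<lambda>x. segment_curve v (if x \<in> A then x else x0))"

context
  fixes U A :: "(real^'d) set" and x0 v :: "real^'d"
  assumes U: "open U" "convex U" and A: "A \<in> sets borel" "A \<subseteq> U" "\<And>x. x \<in> A \<Longrightarrow> x + v \<in> U"
    and x0: "x0 \<in> A" and fin: "emeasure lborel A < \<infinity>" and pos: "emeasure lborel A \<noteq> 0"
begin

section \<open>Measurability, support and marginals of translation plans\<close>

lemma segment_curve_measurable:
  "(\<lambda>x. segment_curve v (if x \<in> A then x else x0)) \<in> measurable (uniform_measure lborel A) (curve_space U)"
  unfolding curve_space_def
proof (rule measurable_restrict_space2)
  show "(\<lambda>x. segment_curve v (if x \<in> A then x else x0)) \<in> space (uniform_measure lborel A) \<rightarrow> curves U"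
    using A x0 by (auto intro!: segment_curve_in_curves U)
  have [measurable]: "A \<in> sets borel" by (rule A)
  show "(\<lambda>x. segment_curve v (if x \<in> A then x else x0)) \<in> measurable (uniform_measure lborel A) (PiM {0..1} (\<lambda>_. borel))"
    unfolding segment_curve_def by (rule measurable_restrict) measurable
qed

lemma sets_translation_plan: "sets (translation_plan U A x0 v) = sets (curve_space U)"
  by (simp add: translation_plan_def)

lemma prob_space_translation_plan: "prob_space (translation_plan U A x0 v)"
  unfolding translation_plan_def using pos fin
  by (intro prob_space.prob_space_distr prob_space_uniform_measure segment_curve_measurable) auto

text \<open>To transfer an almost-sure statement through the pushforward, the set of curves has to
  be measurable. So being a segment is first expressed by the countably many evaluations at rational
  times in \<open>Q\<close>; continuity of the curve then recovers all other times.\<close>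

lemma AE_translation_plan: "AE \<gamma> in translation_plan U A x0 v. \<exists>x\<in>A. \<gamma> = segment_curve v x"
proof -
  define Q where "Q \<gamma> \<longleftrightarrow> \<gamma> 0 \<in> A \<and> (\<forall>t\<in>\<rat> \<inter> {0..1}. \<gamma> t = \<gamma> 0 + t *\<^sub>R v)" for \<gamma> :: "real \<Rightarrow> real^'d"
  have cl: "closure ({0<..<1} \<inter> \<rat>) = {0..1::real}"
    by (subst closure_open_Int_superset) (simp_all add: Rats_closure_real)
  have Q_seg: "\<exists>x\<in>A. \<gamma> = segment_curve v x" if \<gamma>: "\<gamma> \<in> curves U" and Q: "Q \<gamma>" for \<gamma>
  proof (rule bexI)
    show "\<gamma> = segment_curve v (\<gamma> 0)"
    proof (rule ext)
      fix t
      show "\<gamma> t = segment_curve v (\<gamma> 0) t"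
      proof (cases "t \<in> {0..1}")
        case True
        define f where "f t = \<gamma> t - (\<gamma> 0 + t *\<^sub>R v)" for t
        have "continuous_on {0..1} \<gamma>" using \<gamma> by (simp add: curves_def)
        then have c: "continuous_on (closure ({0<..<1} \<inter> \<rat>)) f"
          unfolding cl f_def by (intro continuous_intros)
        have z: "f t = 0" if "t \<in> {0<..<1} \<inter> \<rat>" for t
        proof -
          have "\<gamma> t = \<gamma> 0 + t *\<^sub>R v" by (rule bspec[OF conjunct2[OF Q[unfolded Q_def]]]) (use that in auto)
          then show ?thesis unfolding f_def by (rule right_minus_eq[THEN iffD2])
        qed
        have "t \<in> closure ({0<..<1} \<inter> \<rat>)" using True by (simp only: cl)
        from continuous_constant_on_closure[OF c z this] have "f t = 0" .
        then have "\<gamma> t = \<gamma> 0 + t *\<^sub>R v" by (simp add: f_def)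
        then show ?thesis using True by (simp add: segment_curve_def)
      next
        case False
        have "\<gamma> \<in> extensional {0..1}" using \<gamma> by (simp add: curves_def)
        then have "\<gamma> t = undefined" using False by (rule extensional_arb)
        with False show ?thesis unfolding segment_curve_def restrict_def by (simp only: if_False)
      qed
    qed
    show "\<gamma> 0 \<in> A" using Q unfolding Q_def by (rule conjunct1)
  qed
  have [measurable]: "A \<in> sets borel" by (rule A)
  have cnt: "countable (\<rat> \<inter> {0..1::real})" by (rule countable_Int1[OF countable_rat])
  have ev: "(\<lambda>\<gamma>. \<gamma> t) \<in> borel_measurable (curve_space U)" if "t \<in> {0..1}" for t
    using that by (rule measurable_eval_curve_space)
  have "{\<gamma> \<in> space (curve_space U). Q \<gamma>} \<in> sets (curve_space U)"
  proof -
    have [measurable]: "(\<lambda>\<gamma>. \<gamma> 0) \<in> borel_measurable (curve_space U)" by (rule ev) simp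
    have 1: "{\<gamma> \<in> space (curve_space U). \<gamma> 0 \<in> A} \<in> sets (curve_space U)" by measurable
    have 2: "{\<gamma> \<in> space (curve_space U). \<forall>t\<in>\<rat> \<inter> {0..1}. \<gamma> t = \<gamma> 0 + t *\<^sub>R v} \<in> sets (curve_space U)"
    proof (rule sets.sets_Collect_countable_All'[OF _ cnt])
      fix t :: real assume "t \<in> \<rat> \<inter> {0..1}"
      then have [measurable]: "(\<lambda>\<gamma>. \<gamma> t) \<in> borel_measurable (curve_space U)" by (auto intro!: ev)
      show "{\<gamma> \<in> space (curve_space U). \<gamma> t = \<gamma> 0 + t *\<^sub>R v} \<in> sets (curve_space U)" by measurable
    qed
    show ?thesis unfolding Q_def using sets.sets_Collect_conj[OF 2 1] by simp
  qed
  moreover have "AE x in uniform_measure lborel A. Q (segment_curve v (if x \<in> A then x else x0))"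
    by (rule AE_uniform_measureI) (use A(1) in \<open>simp_all add: Q_def segment_curve_def\<close>)
  ultimately have "AE \<gamma> in translation_plan U A x0 v. Q \<gamma>"
    unfolding translation_plan_def by (subst AE_distr_iff[OF segment_curve_measurable])
  moreover have "AE \<gamma> in translation_plan U A x0 v. \<gamma> \<in> curves U"
    using AE_space[of "translation_plan U A x0 v"] by (simp add: translation_plan_def space_curve_space)
  ultimately show ?thesis
  proof eventually_elim
    case (elim \<gamma>)
    show ?case by (rule Q_seg[OF elim(2,1)])
  qed
qed

text \<open>At time \<open>t\<close> the law is the uniform distribution on \<open>A\<close>
  translated by \<open>t *\<^sub>R v\<close>. Convexity keeps it inside \<open>U\<close>, and
  translation invariance of Lebesgue measure bounds its density by the inverse of the measure of
  \<open>A\<close>.\<close>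

lemma marginal_translation_plan:
  assumes t: "t \<in> {0..1}" and B: "B \<in> sets borel"
  shows "emeasure (distr (translation_plan U A x0 v) borel (\<lambda>\<gamma>. \<gamma> t)) B \<le>
    ennreal (1 / measure lborel A) * emeasure lborel (B \<inter> U)"
proof -
  note [measurable] = A(1) B borel_open[OF U(1)]
  have mA: "emeasure lborel A = ennreal (measure lborel A)" "measure lborel A > 0"
    using fin pos by (auto simp: emeasure_eq_ennreal_measure less_top zero_less_measure_iff)
  have "distr (translation_plan U A x0 v) borel (\<lambda>\<gamma>. \<gamma> t) =
      distr (uniform_measure lborel A) borel (\<lambda>x. (if x \<in> A then x else x0) + t *\<^sub>R v)"
    unfolding translation_plan_def
    by (subst distr_distr[OF measurable_eval_curve_space[OF t] segment_curve_measurable])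
       (use t in \<open>simp add: comp_def segment_curve_def\<close>)
  then have "emeasure (distr (translation_plan U A x0 v) borel (\<lambda>\<gamma>. \<gamma> t)) B =
     emeasure (uniform_measure lborel A) {x. (if x \<in> A then x else x0) + t *\<^sub>R v \<in> B}"
    by (simp add: emeasure_distr vimage_def)
  also have "\<dots> = emeasure lborel (A \<inter> {x. (if x \<in> A then x else x0) + t *\<^sub>R v \<in> B}) / emeasure lborel A"
    by (rule emeasure_uniform_measure) measurable
  also have "A \<inter> {x. (if x \<in> A then x else x0) + t *\<^sub>R v \<in> B} \<subseteq> {x. t *\<^sub>R v + x \<in> B \<inter> U}"
  proof safe
    fix x assume x: "x \<in> A" "(if x \<in> A then x else x0) + t *\<^sub>R v \<in> B"
    then show "t *\<^sub>R v + x \<in> B" by (simp add: add.commute)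
    have "segment_curve v x \<in> curves U" using A x by (intro segment_curve_in_curves U) auto
    then show "t *\<^sub>R v + x \<in> U" using t by (auto simp: curves_def segment_curve_def add.commute image_subset_iff)
  qed
  then have "emeasure lborel (A \<inter> {x. (if x \<in> A then x else x0) + t *\<^sub>R v \<in> B}) / emeasure lborel A
      \<le> emeasure lborel {x. t *\<^sub>R v + x \<in> B \<inter> U} / emeasure lborel A"
    by (intro divide_right_mono_ennreal emeasure_mono) measurable
  also have "emeasure lborel {x. t *\<^sub>R v + x \<in> B \<inter> U} = emeasure (distr lborel borel ((+) (t *\<^sub>R v))) (B \<inter> U)"
    by (subst emeasure_distr) (auto simp: vimage_def)
  also have "\<dots> = emeasure lborel (B \<inter> U)" by (simp add: lborel_distr_plus)
  also have "emeasure lborel (B \<inter> U) / emeasure lborel A = ennreal (1 / measure lborel A) * emeasure lborel (B \<inter> U)"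
    using mA by (simp add: divide_ennreal_def inverse_ennreal field_simps)
  finally show ?thesis .
qed

text \<open>The distance bound makes every curve of the plan \<open>k\<close>-Lipschitz, which gives
  absolute continuity and bounds the energy by the square of \<open>k\<close>; \<open>vol\<close>
  turns the marginal bound into one against \<open>vol_g\<close>.\<close>

lemma test_plan_translation_plan:
  assumes vol: "\<And>B. B \<in> sets borel \<Longrightarrow> emeasure (vol_g U g) (B \<inter> U) = emeasure lborel (B \<inter> U)"
    and d: "\<And>x s t. x \<in> A \<Longrightarrow> s \<in> {0..1} \<Longrightarrow> t \<in> {0..1} \<Longrightarrow> dist_g U g (x + s *\<^sub>R v) (x + t *\<^sub>R v) \<le> ereal (k * \<bar>s - t\<bar>)"
  shows "test_plan U g (translation_plan U A x0 v)"
  unfolding test_plan_def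
proof (intro conjI)
  let ?\<pi> = "translation_plan U A x0 v"
  interpret prob_space ?\<pi> by (rule prob_space_translation_plan)
  show "prob_space ?\<pi>" by (rule prob_space_translation_plan)
  show "sets ?\<pi> = sets (curve_space U)" by (rule sets_translation_plan)
  show "\<exists>C. \<forall>t\<in>{0..1}. \<forall>B\<in>sets borel. emeasure (distr ?\<pi> borel (\<lambda>\<gamma>. \<gamma> t)) B \<le> ennreal C * emeasure (vol_g U g) (B \<inter> U)"
    using marginal_translation_plan by (intro exI[of _ "1 / measure lborel A"] ballI) (simp add: vol)
  have dc: "dist_g U g (segment_curve v x s) (segment_curve v x t) \<le> ereal (k * \<bar>s - t\<bar>)"
    if "x \<in> A" "s \<in> {0..1}" "t \<in> {0..1}" for x s t using d[OF that] that by (simp add: segment_curve_def)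
  show "AE \<gamma> in ?\<pi>. ac_curve U g \<gamma>"
    using AE_translation_plan by eventually_elim (auto intro!: ac_curve_lipschitz dc)
  have "AE \<gamma> in ?\<pi>. (\<integral>\<^sup>+t. (e2ennreal (mspeed U g \<gamma> t))\<^sup>2 * indicator {0..1} t \<partial>lborel) \<le> (ennreal k)\<^sup>2"
    using AE_translation_plan
  proof eventually_elim
    case (elim \<gamma>)
    then obtain x where x: "x \<in> A" "\<gamma> = segment_curve v x" by blast
    have "(\<integral>\<^sup>+t. (e2ennreal (mspeed U g \<gamma> t))\<^sup>2 * indicator {0..1} t \<partial>lborel)
        \<le> (\<integral>\<^sup>+t. (ennreal k)\<^sup>2 * indicator {0..1::real} t \<partial>lborel)"
      using mspeed_le[of _ U g \<gamma> k] dc[OF x(1)]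
      by (intro nn_integral_mono) (auto simp: x(2) split: split_indicator intro!: power_mono)
    then show ?case by (simp add: nn_integral_cmult_indicator)
  qed
  then have "(\<integral>\<^sup>+\<gamma>. (\<integral>\<^sup>+t. (e2ennreal (mspeed U g \<gamma> t))\<^sup>2 * indicator {0..1} t \<partial>lborel) \<partial>?\<pi>) \<le> (\<integral>\<^sup>+\<gamma>. (ennreal k)\<^sup>2 \<partial>?\<pi>)"
    by (rule nn_integral_mono_AE)
  also have "\<dots> < \<infinity>" by (simp add: emeasure_space_1 power2_eq_square ennreal_mult_less_top)
  finally show "(\<integral>\<^sup>+\<gamma>. (\<integral>\<^sup>+t. (e2ennreal (mspeed U g \<gamma> t))\<^sup>2 * indicator {0..1} t \<partial>lborel) \<partial>?\<pi>) < \<infinity>" .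
qed

end

text \<open>Test \<open>G\<close> on the plan that pushes the starting set by \<open>T\<close> in
  direction \<open>i\<close>: the coordinate gains \<open>T\<close>, the speed is at most
  \<open>c * T\<close>, so \<open>T\<close> cancels. After exchanging space and time, each time
  slice is a translate of the starting set inside \<open>S \<inter> U\<close> and costs at most the
  integral of \<open>G\<close> there.\<close>

lemma weak_upper_gradient_translation:
  fixes i :: "'d::finite" and U :: "(real^'d) set"
  defines "e \<equiv> axis i (1::real)"
  assumes U: "open U" "convex U" "emeasure lborel U < \<infinity>"
    and S: "S \<in> sets borel" "\<And>x s. x \<in> S \<Longrightarrow> x + s *\<^sub>R e \<in> S"
    and vol: "\<And>B. B \<in> sets borel \<Longrightarrow> emeasure (vol_g U g) (B \<inter> U) = emeasure lborel (B \<inter> U)"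
    and d: "\<And>x a b. x \<in> S \<Longrightarrow> x + a *\<^sub>R e \<in> U \<Longrightarrow> x + b *\<^sub>R e \<in> U \<Longrightarrow>
              dist_g U g (x + a *\<^sub>R e) (x + b *\<^sub>R e) \<le> ereal (c * \<bar>b - a\<bar>)"
    and c: "0 < c" and T: "0 < T"
    and G: "weak_upper_gradient U g (\<lambda>x. x $ i) G"
  shows "emeasure lborel {x \<in> S \<inter> U. x + T *\<^sub>R e \<in> U} \<le> ennreal c * (\<integral>\<^sup>+x. ennreal (G x) * indicator (S \<inter> U) x \<partial>lborel)"
proof -
  define A where "A = {x \<in> S \<inter> U. x + T *\<^sub>R e \<in> U}"
  define v where "v = T *\<^sub>R e"
  let ?I = "\<integral>\<^sup>+x. ennreal (G x) * indicator (S \<inter> U) x \<partial>lborel"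
  have [measurable]: "S \<in> sets borel" "U \<in> sets borel" using S U by auto
  have [measurable]: "G \<in> borel_measurable borel" and G0: "\<And>x. 0 \<le> G x"
    using G by (auto simp: weak_upper_gradient_def)
  have A [measurable]: "A \<in> sets borel" unfolding A_def by measurable
  have AU: "A \<subseteq> U" and Av: "\<And>x. x \<in> A \<Longrightarrow> x + v \<in> U" and AS: "A \<subseteq> S" by (auto simp: A_def v_def)
  have fin: "emeasure lborel A < \<infinity>"
    using U(3) AU by (intro le_less_trans[OF emeasure_mono[of A U]]) auto
  have path: "x + t *\<^sub>R v \<in> S \<inter> U" if "x \<in> A" "t \<in> {0..1}" for x t
    using that AS S(2)[of x "t * T"] segment_point_in_convex[OF U(2) _ Av that(2)] AU by (auto simp: v_def)
  have "emeasure lborel A \<le> ennreal c * ?I"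
  proof (cases "emeasure lborel A = 0")
    case False
    then have "A \<noteq> {}" by auto
    then obtain x0 where x0: "x0 \<in> A" by blast
    let ?\<pi> = "translation_plan U A x0 v"
    interpret prob_space ?\<pi>
      by (rule prob_space_translation_plan[OF U(1,2) A AU Av x0 fin False])
    have dd: "dist_g U g (x + s *\<^sub>R v) (x + t *\<^sub>R v) \<le> ereal (c * T * \<bar>s - t\<bar>)"
      if "x \<in> A" "s \<in> {0..1}" "t \<in> {0..1}" for x s t
    proof -
      have "\<bar>t * T - s * T\<bar> = T * \<bar>s - t\<bar>"
        using T by (simp add: abs_mult abs_minus_commute[of s] flip: left_diff_distrib)
      then show ?thesis
        using d[of x "s * T" "t * T"] path[OF that(1,2)] path[OF that(1,3)] AS that(1)
        by (auto simp: v_def mult.assoc)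
    qed
    have tp: "test_plan U g ?\<pi>"
      by (rule test_plan_translation_plan[OF U(1,2) A AU Av x0 fin False vol dd])
    have aepi: "AE \<gamma> in ?\<pi>. \<exists>x\<in>A. \<gamma> = segment_curve v x"
      by (rule AE_translation_plan[OF U(1,2) A AU Av x0 fin False])
    have sm: "(\<lambda>x. segment_curve v (if x \<in> A then x else x0)) \<in> measurable (uniform_measure lborel A) (curve_space U)"
      by (rule segment_curve_measurable[OF U(1,2) A AU Av x0 fin False])
    have fdif: "\<bar>segment_curve v x 1 $ i - segment_curve v x 0 $ i\<bar> = T" for x
      using T by (simp add: segment_curve_def v_def e_def)
    have "AE \<gamma> in ?\<pi>. ennreal \<bar>\<gamma> 1 $ i - \<gamma> 0 $ i\<bar> = ennreal T"
      using aepi by eventually_elim (auto simp: fdif)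
    then have "(\<integral>\<^sup>+\<gamma>. ennreal \<bar>\<gamma> 1 $ i - \<gamma> 0 $ i\<bar> \<partial>?\<pi>) = (\<integral>\<^sup>+\<gamma>. ennreal T \<partial>?\<pi>)"
      by (rule nn_integral_cong_AE)
    then have "ennreal T = (\<integral>\<^sup>+\<gamma>. ennreal \<bar>\<gamma> 1 $ i - \<gamma> 0 $ i\<bar> \<partial>?\<pi>)"
      by (simp add: emeasure_space_1)
    also have "\<dots> \<le> (\<integral>\<^sup>+\<gamma>. (\<integral>\<^sup>+t. ennreal (G (\<gamma> t)) * e2ennreal (mspeed U g \<gamma> t) * indicator {0..1} t \<partial>lborel) \<partial>?\<pi>)"
      using G tp by (auto simp: weak_upper_gradient_def)
    also have "\<dots> \<le> (\<integral>\<^sup>+\<gamma>. (\<integral>\<^sup>+t. ennreal (G (\<gamma> t)) * ennreal (c * T) * indicator {0..1} t \<partial>lborel) \<partial>?\<pi>)"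
    proof (rule nn_integral_mono_AE)
      show "AE \<gamma> in ?\<pi>. (\<integral>\<^sup>+t. ennreal (G (\<gamma> t)) * e2ennreal (mspeed U g \<gamma> t) * indicator {0..1} t \<partial>lborel)
        \<le> (\<integral>\<^sup>+t. ennreal (G (\<gamma> t)) * ennreal (c * T) * indicator {0..1} t \<partial>lborel)"
        using aepi
      proof eventually_elim
        case (elim \<gamma>)
        then obtain x where x: "x \<in> A" "\<gamma> = segment_curve v x" by blast
        have "e2ennreal (mspeed U g \<gamma> t) \<le> ennreal (c * T)" if t: "t \<in> {0..1}" for t
          by (rule mspeed_le[OF t]) (use dd[OF x(1)] t in \<open>simp add: x(2) segment_curve_def\<close>)
        then show ?case
          by (intro nn_integral_mono) (auto split: split_indicator intro: mult_left_mono)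
      qed
    qed
    \<comment> \<open>On the space of curves the inner integral is not known to be measurable in
      \<open>\<gamma>\<close>, so only this one-sided transfer is used; after substituting the
      segments the integrand is jointly Borel in position and time, and Fubini applies.\<close>
    also have "\<dots> \<le> (\<integral>\<^sup>+x. (\<integral>\<^sup>+t. ennreal (G (segment_curve v (if x \<in> A then x else x0) t)) * ennreal (c * T) * indicator {0..1} t \<partial>lborel)
        \<partial>uniform_measure lborel A)"
      unfolding translation_plan_def by (rule nn_integral_distr_le[OF sm])
    also have "\<dots> = (\<integral>\<^sup>+x. (\<integral>\<^sup>+t. ennreal (G ((if x \<in> A then x else x0) + t *\<^sub>R v)) * ennreal (c * T) * indicator {0..1} t \<partial>lborel)
        \<partial>uniform_measure lborel A)"
      by (intro nn_integral_cong) (auto simp: segment_curve_def split: split_indicator)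
    also have "\<dots> = (\<integral>\<^sup>+x. (\<integral>\<^sup>+t. ennreal (G ((if x \<in> A then x else x0) + t *\<^sub>R v)) * ennreal (c * T) * indicator {0..1} t \<partial>lborel)
        * indicator A x \<partial>lborel) / emeasure lborel A"
      by (rule nn_integral_uniform_measure) measurable
    also have "(\<integral>\<^sup>+x. (\<integral>\<^sup>+t. ennreal (G ((if x \<in> A then x else x0) + t *\<^sub>R v)) * ennreal (c * T) * indicator {0..1} t \<partial>lborel)
        * indicator A x \<partial>lborel)
      = (\<integral>\<^sup>+x. (\<integral>\<^sup>+t. ennreal (G (x + t *\<^sub>R v)) * ennreal (c * T) * indicator {0..1} t * indicator A x \<partial>lborel) \<partial>lborel)"
      by (intro nn_integral_cong) (auto split: split_indicator)
    also have "\<dots> = (\<integral>\<^sup>+t. (\<integral>\<^sup>+x. ennreal (G (x + t *\<^sub>R v)) * ennreal (c * T) * indicator {0..1} t * indicator A x \<partial>lborel) \<partial>lborel)"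
      by (rule lborel_pair.Fubini'[symmetric]) measurable
    also have "\<dots> \<le> (\<integral>\<^sup>+t. ennreal (c * T) * ?I * indicator {0..1::real} t \<partial>lborel)"
    proof (rule nn_integral_mono)
      fix t :: real
      have "(\<integral>\<^sup>+x. ennreal (G (x + t *\<^sub>R v)) * ennreal (c * T) * indicator {0..1} t * indicator A x \<partial>lborel)
         \<le> (\<integral>\<^sup>+x. ennreal (c * T) * indicator {0..1} t * (ennreal (G (t *\<^sub>R v + x)) * indicator (S \<inter> U) (t *\<^sub>R v + x)) \<partial>lborel)"
        using path by (intro nn_integral_mono) (auto split: split_indicator simp: add.commute mult.commute)
      also have "\<dots> = ennreal (c * T) * indicator {0..1} t * (\<integral>\<^sup>+x. ennreal (G (t *\<^sub>R v + x)) * indicator (S \<inter> U) (t *\<^sub>R v + x) \<partial>lborel)"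
        by (rule nn_integral_cmult) measurable
      also have "(\<integral>\<^sup>+x. ennreal (G (t *\<^sub>R v + x)) * indicator (S \<inter> U) (t *\<^sub>R v + x) \<partial>lborel)
         = (\<integral>\<^sup>+x. ennreal (G x) * indicator (S \<inter> U) x \<partial>distr lborel borel ((+) (t *\<^sub>R v)))"
        by (rule nn_integral_distr[symmetric]) measurable
      also have "\<dots> = ?I" by (simp add: lborel_distr_plus)
      finally show "(\<integral>\<^sup>+x. ennreal (G (x + t *\<^sub>R v)) * ennreal (c * T) * indicator {0..1} t * indicator A x \<partial>lborel)
          \<le> ennreal (c * T) * ?I * indicator {0..1} t" by (simp add: ac_simps)
    qed
    also have "(\<integral>\<^sup>+t. ennreal (c * T) * ?I * indicator {0..1::real} t \<partial>lborel) = ennreal (c * T) * ?I"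
      by (simp add: nn_integral_cmult_indicator)
    finally have "ennreal T \<le> ennreal (c * T) * ?I / emeasure lborel A"
      by (simp add: divide_right_mono_ennreal)
    then have "ennreal T * emeasure lborel A \<le> ennreal (c * T) * ?I / emeasure lborel A * emeasure lborel A"
      by (rule mult_right_mono) simp
    also have "\<dots> = ennreal (c * T) * ?I"
      using False fin by (simp add: ennreal_divide_times ennreal_times_divide mult_divide_eq_ennreal)
    also have "\<dots> = ennreal T * (ennreal c * ?I)"
      using c T by (simp add: ennreal_mult' ac_simps)
    finally have "ennreal T * emeasure lborel A \<le> ennreal T * (ennreal c * ?I)" .
    then show ?thesis using T by (simp add: ennreal_mult_le_mult_iff)
  qed simp
  then show ?thesis by (simp add: A_def)
qed

text \<open>Shift lengths tending to 0 exhaust \<open>S \<inter> U\<close>: by convexity a shorter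
  shift stays in \<open>U\<close> whenever a longer one does, and by openness every point admits
  some shift.\<close>

lemma weak_upper_gradient_integral_ge:
  fixes i :: "'d::finite" and U :: "(real^'d) set"
  defines "e \<equiv> axis i (1::real)"
  assumes U: "open U" "convex U" "emeasure lborel U < \<infinity>"
    and S: "S \<in> sets borel" "\<And>x s. x \<in> S \<Longrightarrow> x + s *\<^sub>R e \<in> S"
    and vol: "\<And>B. B \<in> sets borel \<Longrightarrow> emeasure (vol_g U g) (B \<inter> U) = emeasure lborel (B \<inter> U)"
    and d: "\<And>x a b. x \<in> S \<Longrightarrow> x + a *\<^sub>R e \<in> U \<Longrightarrow> x + b *\<^sub>R e \<in> U \<Longrightarrow>
              dist_g U g (x + a *\<^sub>R e) (x + b *\<^sub>R e) \<le> ereal (c * \<bar>b - a\<bar>)"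
    and c: "0 < c"
    and G: "weak_upper_gradient U g (\<lambda>x. x $ i) G"
  shows "emeasure lborel (S \<inter> U) \<le> ennreal c * (\<integral>\<^sup>+x. ennreal (G x) * indicator (S \<inter> U) x \<partial>lborel)"
proof -
  define A where "A n = {x \<in> S \<inter> U. x + (1 / Suc n) *\<^sub>R e \<in> U}" for n :: nat
  have [measurable]: "S \<in> sets borel" "U \<in> sets borel" using S U by auto
  have "incseq A"
  proof (rule incseq_SucI, rule subsetI)
    fix n x assume x: "x \<in> A n"
    have "(1 / Suc (Suc n)) = (real (Suc n) / Suc (Suc n)) * (1 / Suc n)" by simp
    then have "x + (1 / Suc (Suc n)) *\<^sub>R e = x + (real (Suc n) / Suc (Suc n)) *\<^sub>R ((1 / Suc n) *\<^sub>R e)"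
      by (metis scaleR_scaleR)
    also have "\<dots> \<in> U"
      by (rule segment_point_in_convex[OF U(2)]) (use x in \<open>simp_all add: A_def del: of_nat_Suc\<close>)
    finally show "x \<in> A (Suc n)" using x by (auto simp: A_def)
  qed
  then have "(SUP n. emeasure lborel (A n)) = emeasure lborel (\<Union>n. A n)"
    unfolding A_def by (intro SUP_emeasure_incseq) auto
  also have "(\<Union>n. A n) = S \<inter> U"
  proof (intro equalityI subsetI)
    fix x assume x: "x \<in> S \<inter> U"
    then obtain r where r: "r > 0" "ball x r \<subseteq> U" using U(1) openE by blast
    obtain n :: nat where "1 / Suc n < r" using nat_approx_posE[OF r(1)] by blast
    then have "x + (1 / Suc n) *\<^sub>R e \<in> ball x r" by (simp add: dist_norm e_def)
    then show "x \<in> (\<Union>n. A n)" using r x by (auto simp: A_def)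
  qed (auto simp: A_def)
  finally have "emeasure lborel (S \<inter> U) = (SUP n. emeasure lborel (A n))" ..
  also have "\<dots> \<le> ennreal c * (\<integral>\<^sup>+x. ennreal (G x) * indicator (S \<inter> U) x \<partial>lborel)"
    unfolding A_def e_def
    by (rule SUP_least, rule weak_upper_gradient_translation[OF U S[unfolded e_def] vol d[unfolded e_def] c _ G]) auto
  finally show ?thesis .
qed

text \<open>The bound on the integral of \<open>G\<close> is converted into one on the integral of
  its square. The pointwise inequality between 2G/c and the sum of the squares of G and 1/c stands
  in for Cauchy-Schwarz; it leaves the finite term \<open>?m / c\<^sup>2\<close> on both sides,
  where it cancels even in \<open>ennreal\<close>.\<close>

lemma cheeger_coordinate_ge:
  fixes i :: "'d::finite" and U :: "(real^'d) set"
  defines "e \<equiv> axis i (1::real)"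
  assumes U: "open U" "convex U" "emeasure lborel U < \<infinity>"
    and S: "S \<in> sets borel" "\<And>x s. x \<in> S \<Longrightarrow> x + s *\<^sub>R e \<in> S"
    and vol: "vol_g U g = lebesgue_on U"
    and d: "\<And>x a b. x \<in> S \<Longrightarrow> x + a *\<^sub>R e \<in> U \<Longrightarrow> x + b *\<^sub>R e \<in> U \<Longrightarrow>
              dist_g U g (x + a *\<^sub>R e) (x + b *\<^sub>R e) \<le> ereal (c * \<bar>b - a\<bar>)"
    and c: "0 < c"
  shows "ennreal (measure lborel (S \<inter> U) / c\<^sup>2 / 2) \<le> cheeger U g (\<lambda>x. x $ i)"
proof -
  have [measurable]: "S \<in> sets borel" "U \<in> sets borel" using S U by auto
  have vol': "emeasure (vol_g U g) (B \<inter> U) = emeasure lborel (B \<inter> U)" if "B \<in> sets borel" for B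
    using that by (simp add: vol emeasure_restrict_space)
  have fin: "emeasure lborel (S \<inter> U) < \<infinity>"
    using U(3) by (intro le_less_trans[OF emeasure_mono[of "S \<inter> U" U]]) auto
  let ?m = "measure lborel (S \<inter> U)"
  have m: "emeasure lborel (S \<inter> U) = ennreal ?m" using fin by (simp add: emeasure_eq_ennreal_measure less_top)
  have "ennreal (?m / c\<^sup>2) \<le> (\<integral>\<^sup>+x. (ennreal (G x))\<^sup>2 \<partial>vol_g U g)" if G: "weak_upper_gradient U g (\<lambda>x. x $ i) G" for G
  proof -
    have [measurable]: "G \<in> borel_measurable borel" and G0: "\<And>x. 0 \<le> G x"
      using G by (auto simp: weak_upper_gradient_def)
    let ?I = "\<integral>\<^sup>+x. ennreal (G x) * indicator (S \<inter> U) x \<partial>lborel"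
    let ?Q = "\<integral>\<^sup>+x. ennreal ((G x)\<^sup>2) * indicator (S \<inter> U) x \<partial>lborel"
    have "ennreal ?m \<le> ennreal c * ?I"
      using weak_upper_gradient_integral_ge[OF U S[unfolded e_def] vol' d[unfolded e_def] c G] m by simp
    then have "ennreal (2 / c\<^sup>2) * ennreal ?m \<le> ennreal (2 / c\<^sup>2) * (ennreal c * ?I)"
      by (rule mult_left_mono) simp
    also have "\<dots> = ennreal (2 / c) * ?I"
      using c by (simp add: mult.assoc[symmetric] power2_eq_square flip: ennreal_mult)
    also have "\<dots> = (\<integral>\<^sup>+x. ennreal (2 / c) * (ennreal (G x) * indicator (S \<inter> U) x) \<partial>lborel)"
      by (rule nn_integral_cmult[symmetric]) measurable
    also have "\<dots> \<le> (\<integral>\<^sup>+x. ennreal ((G x)\<^sup>2) * indicator (S \<inter> U) x + ennreal (1 / c\<^sup>2) * indicator (S \<inter> U) x \<partial>lborel)"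
    proof (rule nn_integral_mono)
      fix x
      have "0 \<le> (G x - 1 / c)\<^sup>2" by simp
      also have "\<dots> = (G x)\<^sup>2 + 1 / c\<^sup>2 - 2 / c * G x" by (simp add: power2_diff power_divide)
      finally have "2 / c * G x \<le> (G x)\<^sup>2 + 1 / c\<^sup>2" by simp
      then have "ennreal (2 / c * G x) \<le> ennreal ((G x)\<^sup>2 + 1 / c\<^sup>2)" by (rule ennreal_leI)
      then have "ennreal (2 / c) * ennreal (G x) \<le> ennreal ((G x)\<^sup>2) + ennreal (1 / c\<^sup>2)"
        using G0[of x] c by (subst ennreal_mult[symmetric]) simp_all
      then show "ennreal (2 / c) * (ennreal (G x) * indicator (S \<inter> U) x) \<le>
          ennreal ((G x)\<^sup>2) * indicator (S \<inter> U) x + ennreal (1 / c\<^sup>2) * indicator (S \<inter> U) x"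
        by (auto split: split_indicator)
    qed
    also have "\<dots> = ?Q + ennreal (1 / c\<^sup>2) * ennreal ?m"
      by (subst nn_integral_add) (auto simp: nn_integral_cmult_indicator m)
    finally have "ennreal (?m / c\<^sup>2) + ennreal (?m / c\<^sup>2) \<le> ennreal (?m / c\<^sup>2) + ?Q"
      by (simp add: add.commute field_simps flip: ennreal_mult ennreal_plus)
    then have "ennreal (?m / c\<^sup>2) \<le> ?Q" unfolding ennreal_add_left_cancel_le by simp
    also have "\<dots> \<le> (\<integral>\<^sup>+x. ennreal ((G x)\<^sup>2) * indicator U x \<partial>lborel)"
      by (intro nn_integral_mono) (auto split: split_indicator)
    also have "\<dots> = (\<integral>\<^sup>+x. ennreal ((G x)\<^sup>2) \<partial>vol_g U g)"
      by (simp add: vol nn_integral_restrict_space nn_integral_completion)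
    also have "\<dots> = (\<integral>\<^sup>+x. (ennreal (G x))\<^sup>2 \<partial>vol_g U g)" using G0 by (simp add: ennreal_power)
    finally show ?thesis .
  qed
  then have "ennreal (?m / c\<^sup>2) \<le> (INF G\<in>{G. weak_upper_gradient U g (\<lambda>x. x $ i) G}. \<integral>\<^sup>+x. (ennreal (G x))\<^sup>2 \<partial>vol_g U g)"
    by (intro INF_greatest) auto
  then have "ennreal (?m / c\<^sup>2) / 2 \<le> cheeger U g (\<lambda>x. x $ i)"
    unfolding cheeger_def by (rule divide_right_mono_ennreal)
  also have "ennreal (?m / c\<^sup>2) / 2 = ennreal (?m / c\<^sup>2 / 2)"
    using c by (simp add: divide_ennreal flip: ennreal_numeral)
  finally show ?thesis .
qed

section \<open>Weak derivatives from derivatives along lines\<close>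

abbreviation unit_box :: "(real^'d) set" where "unit_box \<equiv> box 0 1"

lemma mem_unit_box: "x \<in> unit_box \<longleftrightarrow> (\<forall>i. 0 < x $ i \<and> x $ i < 1)"
  by (simp add: mem_box_cart)

lemma emeasure_unit_box: "emeasure lborel (unit_box :: (real^'d) set) = 1"
proof -
  have "(\<Prod>b\<in>Basis. (1 - (0::real^'d)) \<bullet> b) = 1"
    by (rule prod.neutral) (auto simp: Basis_vec_def inner_axis)
  then show ?thesis by (subst emeasure_lborel_box) (auto simp: Basis_vec_def inner_axis)
qed

text \<open>Fubini along direction \<open>i\<close> without splitting off a coordinate: for
  \<open>y\<close> in the box, the parameters \<open>s\<close> for which
  \<open>y - s *\<^sub>R axis i 1\<close> stays in the box form an interval of length one, so each
  value \<open>k y\<close> is counted with weight one.\<close>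

lemma nn_integral_unit_box_lines:
  fixes k :: "real^'d \<Rightarrow> ennreal" and i :: 'd
  assumes [measurable]: "k \<in> borel_measurable borel" and k0: "\<And>x. x \<notin> unit_box \<Longrightarrow> k x = 0"
  shows "(\<integral>\<^sup>+x. (\<integral>\<^sup>+s. k (x + s *\<^sub>R axis i 1) \<partial>lborel) * indicator unit_box x \<partial>lborel) = (\<integral>\<^sup>+x. k x \<partial>lborel)"
proof -
  let ?e = "axis i (1::real) :: real^'d"
  have [measurable]: "(unit_box :: (real^'d) set) \<in> sets borel" by simp
  have "(\<integral>\<^sup>+x. (\<integral>\<^sup>+s. k (x + s *\<^sub>R ?e) \<partial>lborel) * indicator unit_box x \<partial>lborel)
      = (\<integral>\<^sup>+x. (\<integral>\<^sup>+s. k (x + s *\<^sub>R ?e) * indicator unit_box x \<partial>lborel) \<partial>lborel)"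
    by (intro nn_integral_cong nn_integral_multc[symmetric]) measurable
  also have "\<dots> = (\<integral>\<^sup>+s. (\<integral>\<^sup>+x. k (x + s *\<^sub>R ?e) * indicator unit_box x \<partial>lborel) \<partial>lborel)"
    by (rule lborel_pair.Fubini'[symmetric]) measurable
  also have "\<dots> = (\<integral>\<^sup>+s. (\<integral>\<^sup>+y. k y * indicator unit_box (y - s *\<^sub>R ?e) \<partial>lborel) \<partial>lborel)"
  proof (rule nn_integral_cong)
    fix s :: real
    have "(\<integral>\<^sup>+y. k y * indicator unit_box (y - s *\<^sub>R ?e) \<partial>lborel)
        = (\<integral>\<^sup>+y. k y * indicator unit_box (y - s *\<^sub>R ?e) \<partial>distr lborel borel ((+) (s *\<^sub>R ?e)))"
      by (simp add: lborel_distr_plus)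
    also have "\<dots> = (\<integral>\<^sup>+x. k (s *\<^sub>R ?e + x) * indicator unit_box (s *\<^sub>R ?e + x - s *\<^sub>R ?e) \<partial>lborel)"
      by (rule nn_integral_distr) measurable
    finally show "(\<integral>\<^sup>+x. k (x + s *\<^sub>R ?e) * indicator unit_box x \<partial>lborel)
        = (\<integral>\<^sup>+y. k y * indicator unit_box (y - s *\<^sub>R ?e) \<partial>lborel)" by (simp add: add.commute)
  qed
  also have "\<dots> = (\<integral>\<^sup>+y. (\<integral>\<^sup>+s. k y * indicator unit_box (y - s *\<^sub>R ?e) \<partial>lborel) \<partial>lborel)"
    by (rule lborel_pair.Fubini') measurable
  also have "\<dots> = (\<integral>\<^sup>+y. k y \<partial>lborel)"
  proof (rule nn_integral_cong)
    fix y :: "real^'d"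
    show "(\<integral>\<^sup>+s. k y * indicator unit_box (y - s *\<^sub>R ?e) \<partial>lborel) = k y"
    proof (cases "y \<in> unit_box")
      case True
      then have "indicator unit_box (y - s *\<^sub>R ?e) = (indicator {y $ i - 1<..<y $ i} s :: ennreal)" for s
        by (auto simp: mem_unit_box axis_def split: split_indicator)
      then show ?thesis by (simp add: nn_integral_cmult_indicator)
    qed (simp add: k0)
  qed
  finally show ?thesis .
qed

lemma enn2real_eqD:
  assumes "enn2real a = enn2real b" "a < \<infinity>" "b < \<infinity>" shows "a = b"
  using assms by (cases a; cases b) auto

text \<open>The line formula is available for nonnegative functions only, so it is applied to the
  positive and negative parts of \<open>h\<close>, whose line integrals agree on almost every line.
  Applied to the absolute value it gives integrability on those lines.\<close>

lemma integral_eq_zero_unit_box_lines: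
  fixes h :: "real^'d \<Rightarrow> real" and i :: 'd
  assumes [measurable]: "h \<in> borel_measurable borel" and h: "integrable lborel h" and h0: "\<And>x. x \<notin> unit_box \<Longrightarrow> h x = 0"
    and lines: "AE x in lborel. x \<in> unit_box \<longrightarrow> ((\<lambda>s. h (x + s *\<^sub>R axis i 1)) has_integral 0) UNIV"
  shows "(\<integral>x. h x \<partial>lborel) = 0"
proof -
  have [measurable]: "(unit_box :: (real^'d) set) \<in> sets borel" by simp
  have "(\<integral>\<^sup>+x. (\<integral>\<^sup>+s. ennreal (norm (h (x + s *\<^sub>R axis i 1))) \<partial>lborel) * indicator unit_box x \<partial>lborel)
      = (\<integral>\<^sup>+x. ennreal (norm (h x)) \<partial>lborel)"
    by (rule nn_integral_unit_box_lines) (auto simp: h0)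
  also have "\<dots> < \<infinity>" using h by (simp add: integrable_iff_bounded)
  finally have "AE x in lborel. (\<integral>\<^sup>+s. ennreal (norm (h (x + s *\<^sub>R axis i 1))) \<partial>lborel) * indicator unit_box x \<noteq> \<infinity>"
    by (intro nn_integral_PInf_AE) (auto simp: less_top)
  with lines have ae: "AE x in lborel. (\<integral>\<^sup>+s. ennreal (h (x + s *\<^sub>R axis i 1)) \<partial>lborel) * indicator unit_box x
       = (\<integral>\<^sup>+s. ennreal (- h (x + s *\<^sub>R axis i 1)) \<partial>lborel) * indicator unit_box x"
  proof eventually_elim
    case (elim x)
    show ?case
    proof (cases "x \<in> unit_box")
      case True
      have int: "integrable lborel (\<lambda>s. h (x + s *\<^sub>R axis i 1))"
        using elim(2) True by (intro integrableI_bounded) (auto simp: less_top)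
      have "(\<integral>s. h (x + s *\<^sub>R axis i 1) \<partial>lborel) = 0"
        using has_integral_unique[OF has_integral_integral_real[OF int]] elim(1) True by blast
      moreover have "(\<integral>\<^sup>+s. ennreal (h (x + s *\<^sub>R axis i 1)) \<partial>lborel) \<noteq> \<infinity>"
        "(\<integral>\<^sup>+s. ennreal (- h (x + s *\<^sub>R axis i 1)) \<partial>lborel) \<noteq> \<infinity>"
        using int unfolding real_integrable_def by auto
      ultimately have "(\<integral>\<^sup>+s. ennreal (h (x + s *\<^sub>R axis i 1)) \<partial>lborel) = (\<integral>\<^sup>+s. ennreal (- h (x + s *\<^sub>R axis i 1)) \<partial>lborel)"
        unfolding real_lebesgue_integral_def[OF int]
        by (intro enn2real_eqD) (auto simp: less_top)
      then show ?thesis by simp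
    qed simp
  qed
  have "(\<integral>\<^sup>+x. ennreal (h x) \<partial>lborel) = (\<integral>\<^sup>+x. (\<integral>\<^sup>+s. ennreal (h (x + s *\<^sub>R axis i 1)) \<partial>lborel) * indicator unit_box x \<partial>lborel)"
    by (rule nn_integral_unit_box_lines[symmetric]) (auto simp: h0)
  also have "\<dots> = (\<integral>\<^sup>+x. (\<integral>\<^sup>+s. ennreal (- h (x + s *\<^sub>R axis i 1)) \<partial>lborel) * indicator unit_box x \<partial>lborel)"
    by (rule nn_integral_cong_AE[OF ae])
  also have "\<dots> = (\<integral>\<^sup>+x. ennreal (- h x) \<partial>lborel)"
    by (rule nn_integral_unit_box_lines) (auto simp: h0)
  finally show ?thesis by (simp add: real_lebesgue_integral_def[OF h])
qed

section \<open>Test functions and integration by parts along lines\<close>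

lemma smooth_fun_differentiable: "smooth_fun \<phi> \<Longrightarrow> \<phi> differentiable (at x)"
  by (erule smooth_fun.cases) (simp add: differentiable_on_def)

lemma smooth_fun_partial: "smooth_fun \<phi> \<Longrightarrow> smooth_fun (partial k \<phi>)"
  by (erule smooth_fun.cases) simp

lemma smooth_fun_continuous: "smooth_fun \<phi> \<Longrightarrow> continuous_on S \<phi>"
  by (intro continuous_at_imp_continuous_on ballI differentiable_imp_continuous_within smooth_fun_differentiable)

lemma smooth_fun_line_derivative:
  assumes "smooth_fun \<phi>"
  shows "((\<lambda>s. \<phi> (x + s *\<^sub>R axis k 1)) has_real_derivative partial k \<phi> (x + s *\<^sub>R axis k 1)) (at s)"
proof -
  let ?e = "axis k (1::real)"
  let ?L = "frechet_derivative \<phi> (at (x + s *\<^sub>R ?e))"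
  have d: "(\<phi> has_derivative ?L) (at (x + s *\<^sub>R ?e))"
    using smooth_fun_differentiable[OF assms] by (simp add: frechet_derivative_works)
  have "((\<lambda>s. \<phi> (x + s *\<^sub>R ?e)) has_derivative (\<lambda>h. ?L (h *\<^sub>R ?e))) (at s)"
    by (rule has_derivative_compose[of "\<lambda>s. x + s *\<^sub>R ?e" "\<lambda>h. h *\<^sub>R ?e" s UNIV \<phi> ?L])
       (auto intro!: derivative_eq_intros d)
  also have "(\<lambda>h. ?L (h *\<^sub>R ?e)) = (\<lambda>h. partial k \<phi> (x + s *\<^sub>R ?e) * h)"
    by (rule ext) (simp add: partial_def linear_cmul[OF has_derivative_linear[OF d]] mult.commute)
  finally show ?thesis by (simp add: has_field_derivative_def)
qed

lemma test_fun_support: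
  assumes "test_fun U \<phi>" "x \<notin> U"
  shows "\<phi> x = 0" "partial k \<phi> x = 0"
proof -
  let ?K = "closure {x. \<phi> x \<noteq> 0}"
  have z: "\<phi> y = 0" if "y \<in> - ?K" for y
  proof -
    have "y \<notin> {x. \<phi> x \<noteq> 0}" using that closure_subset[of "{x. \<phi> x \<noteq> 0}"] by blast
    then show ?thesis by simp
  qed
  have x: "x \<in> - ?K" using assms unfolding test_fun_def by (metis ComplI subsetD)
  then show "\<phi> x = 0" by (rule z)
  have "((\<lambda>_. 0) has_derivative (\<lambda>_. 0)) (at x)" by (rule has_derivative_const)
  then have "(\<phi> has_derivative (\<lambda>_. 0)) (at x)"
    by (rule has_derivative_transform_within_open[OF _ open_Compl[OF closed_closure] x]) (rule z[symmetric])
  from frechet_derivative_at[OF this] have "frechet_derivative \<phi> (at x) = (\<lambda>_. 0)" by (rule sym)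
  then show "partial k \<phi> x = 0" by (simp add: partial_def)
qed

lemma smooth_fun_bounded_box:
  fixes \<phi> :: "real^'d \<Rightarrow> real"
  assumes "smooth_fun \<phi>"
  obtains M where "\<And>x. x \<in> unit_box \<Longrightarrow> \<bar>\<phi> x\<bar> \<le> M"
proof -
  have "bounded (\<phi> ` cbox 0 1)"
    by (intro compact_imp_bounded compact_continuous_image smooth_fun_continuous[OF assms] compact_cbox)
  then obtain M where "\<And>x. x \<in> cbox 0 1 \<Longrightarrow> norm (\<phi> x) \<le> M"
    unfolding bounded_iff by auto
  then show ?thesis using that[of M] box_subset_cbox[of "0::real^'d" 1] by auto
qed

lemma integral_lebesgue_on_unit_box:
  fixes f :: "real^'d \<Rightarrow> real"
  assumes "f \<in> borel_measurable borel"
  shows "integral\<^sup>L (lebesgue_on unit_box) f = (\<integral>x. indicator unit_box x * f x \<partial>lborel)"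
  using assms by (simp add: integral_restrict_space integral_completion)

text \<open>On almost every line, \<open>f x * partial k \<phi> x + D x * \<phi> x\<close> is the
  derivative of the product of \<open>f\<close> and \<open>\<phi>\<close>, which vanishes off the
  box, so its line integral is 0. The exceptional lines form a null set and do not affect the
  integral over the box.\<close>

lemma unit_box_weak_derivative:
  fixes f D :: "real^'d \<Rightarrow> real"
  assumes [measurable]: "f \<in> borel_measurable borel" "D \<in> borel_measurable borel"
    and B: "\<And>x. \<bar>f x\<bar> \<le> B" and D: "integrable lborel (\<lambda>x. indicator unit_box x * D x)"
    and lines: "AE x in lborel. x \<in> unit_box \<longrightarrow>
       (\<forall>s. ((\<lambda>s. f (x + s *\<^sub>R axis k 1)) has_real_derivative D (x + s *\<^sub>R axis k 1)) (at s))"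
    and \<phi>: "test_fun unit_box \<phi>"
  shows "integral\<^sup>L (lebesgue_on unit_box) (\<lambda>x. f x * partial k \<phi> x) = - integral\<^sup>L (lebesgue_on unit_box) (\<lambda>x. D x * \<phi> x)"
proof -
  have [measurable]: "(unit_box :: (real^'d) set) \<in> sets borel" by simp
  have sm: "smooth_fun \<phi>" using \<phi> by (simp add: test_fun_def)
  note sp = smooth_fun_partial[OF sm, of k]
  have [measurable]: "\<phi> \<in> borel_measurable borel" "partial k \<phi> \<in> borel_measurable borel"
    by (intro borel_measurable_continuous_onI smooth_fun_continuous sm sp)+
  note supp = test_fun_support[OF \<phi>]
  obtain M where M: "\<And>x. x \<in> unit_box \<Longrightarrow> \<bar>\<phi> x\<bar> \<le> M" using smooth_fun_bounded_box[OF sm] by blast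
  obtain M' where M': "\<And>x. x \<in> unit_box \<Longrightarrow> \<bar>partial k \<phi> x\<bar> \<le> M'" using smooth_fun_bounded_box[OF sp] by blast
  have B0: "0 \<le> B" using B[of 0] by linarith
  have i1: "integrable lborel (\<lambda>x. indicator unit_box x * (f x * partial k \<phi> x))"
  proof (rule Bochner_Integration.integrable_bound[of _ "\<lambda>x. indicator unit_box x * (B * M')"])
    show "integrable lborel (\<lambda>x::real^'d. indicator unit_box x * (B * M'))"
      by (intro integrable_mult_left) (simp add: integrable_indicator_iff emeasure_unit_box)
    show "AE x in lborel. norm (indicator unit_box x * (f x * partial k \<phi> x)) \<le> norm (indicator unit_box x * (B * M'))"
    proof (rule AE_I2)
      fix x
      have "\<bar>f x * partial k \<phi> x\<bar> \<le> \<bar>B * M'\<bar>" if "x \<in> unit_box"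
      proof -
        have "\<bar>f x * partial k \<phi> x\<bar> \<le> B * M'"
          using mult_mono[OF B[of x] M'[OF that] B0] by (simp add: abs_mult)
        then show ?thesis by linarith
      qed
      then show "norm (indicator unit_box x * (f x * partial k \<phi> x)) \<le> norm (indicator unit_box x * (B * M'))"
        by (auto split: split_indicator)
    qed
  qed measurable
  have i2: "integrable lborel (\<lambda>x. indicator unit_box x * (D x * \<phi> x))"
  proof (rule Bochner_Integration.integrable_bound[OF integrable_mult_left[OF D, of M]])
    show "AE x in lborel. norm (indicator unit_box x * (D x * \<phi> x)) \<le> norm (indicator unit_box x * D x * M)"
    proof (rule AE_I2)
      fix x
      show "norm (indicator unit_box x * (D x * \<phi> x)) \<le> norm (indicator unit_box x * D x * M)"
        using M[of x] by (auto simp: abs_mult split: split_indicator intro!: mult_left_mono)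
    qed
  qed measurable
  define h where "h x = f x * partial k \<phi> x + D x * \<phi> x" for x
  have h_eq: "h x = indicator unit_box x * (f x * partial k \<phi> x) + indicator unit_box x * (D x * \<phi> x)" for x
    using supp[of x] by (auto simp: h_def split: split_indicator)
  have "(\<integral>x. h x \<partial>lborel) = 0"
  proof (rule integral_eq_zero_unit_box_lines[where i = k])
    show "h \<in> borel_measurable borel" unfolding h_def by measurable
    show "integrable lborel h" unfolding h_eq[abs_def] by (intro Bochner_Integration.integrable_add i1 i2)
    show "h x = 0" if "x \<notin> unit_box" for x using supp[OF that] by (simp add: h_def)
    show "AE x in lborel. x \<in> unit_box \<longrightarrow> ((\<lambda>s. h (x + s *\<^sub>R axis k 1)) has_integral 0) UNIV"
      using lines
    proof (rule eventually_mono, intro impI)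
      fix x assume der: "x \<in> unit_box \<longrightarrow>
         (\<forall>s. ((\<lambda>s. f (x + s *\<^sub>R axis k 1)) has_real_derivative D (x + s *\<^sub>R axis k 1)) (at s))"
        and x: "x \<in> unit_box"
      let ?F = "\<lambda>s. f (x + s *\<^sub>R axis k 1) * \<phi> (x + s *\<^sub>R axis k 1)"
      \<comment> \<open>The box has width one and \<open>x $ k\<close> lies strictly between 0 and
        1, so the line has left the box at parameters -1 and 1: the boundary terms vanish.\<close>
      have out: "x + s *\<^sub>R axis k 1 \<notin> unit_box" if "s \<notin> {-1<..<1}" for s
      proof -
        have "0 < x $ k" "x $ k < 1" using x by (auto simp: mem_unit_box)
        then have "\<not> (0 < (x + s *\<^sub>R axis k 1) $ k \<and> (x + s *\<^sub>R axis k 1) $ k < 1)" using that by auto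
        then show ?thesis unfolding mem_unit_box by blast
      qed
      have "((\<lambda>s. h (x + s *\<^sub>R axis k 1)) has_integral (?F 1 - ?F (-1))) {-1..1}"
      proof (rule fundamental_theorem_of_calculus)
        fix s :: real
        have "(?F has_real_derivative h (x + s *\<^sub>R axis k 1)) (at s)"
          using DERIV_mult[OF der[rule_format, OF x, of s] smooth_fun_line_derivative[OF sm, of x k s]]
          by (simp add: h_def algebra_simps)
        then show "(?F has_vector_derivative h (x + s *\<^sub>R axis k 1)) (at s within {-1..1})"
          unfolding has_real_derivative_iff_has_vector_derivative by (rule has_vector_derivative_at_within)
      qed simp
      moreover have "?F 1 - ?F (-1) = 0"
        using supp(1)[OF out[of 1]] supp(1)[OF out[of "-1"]] by simp
      ultimately have "((\<lambda>s. h (x + s *\<^sub>R axis k 1)) has_integral 0) {-1..1}" by simp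
      then show "((\<lambda>s. h (x + s *\<^sub>R axis k 1)) has_integral 0) UNIV"
      proof (rule has_integral_on_superset)
        fix s :: real assume "s \<notin> {-1..1}"
        then show "h (x + s *\<^sub>R axis k 1) = 0" using supp[OF out[of s]] by (auto simp: h_def)
      qed simp
    qed
  qed
  then have "(\<integral>x. indicator unit_box x * (f x * partial k \<phi> x) \<partial>lborel) + (\<integral>x. indicator unit_box x * (D x * \<phi> x) \<partial>lborel) = 0"
    unfolding h_eq[abs_def] using i1 i2 by simp
  then show ?thesis by (simp add: integral_lebesgue_on_unit_box)
qed

lemma Lp_locI:
  fixes f :: "real^'d \<Rightarrow> real"
  assumes f [measurable]: "f \<in> borel_measurable borel"
    and int: "integrable lborel (\<lambda>x. indicator unit_box x * \<bar>f x\<bar> powr p)"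
  shows "Lp_loc p unit_box f"
  unfolding Lp_loc_def
proof (intro conjI allI impI)
  show "f \<in> borel_measurable (lebesgue_on unit_box)"
    by (intro measurable_restrict_space1 measurable_completion) simp
  fix K :: "(real^'d) set" assume K: "compact K \<and> K \<subseteq> unit_box"
  then have [measurable]: "K \<in> sets borel" by (intro borel_compact) auto
  have "integrable lborel (\<lambda>x. indicator K x * \<bar>f x\<bar> powr p)"
    by (rule Bochner_Integration.integrable_bound[OF int]) (use K in \<open>auto split: split_indicator\<close>)
  then show "integrable (lebesgue_on K) (\<lambda>x. \<bar>f x\<bar> powr p)"
    by (simp add: integrable_restrict_space integrable_completion)
qed

text \<open>Classical derivatives on almost every line suffice, with integrability over the whole
  box instead of over compact subsets. Integrability of \<open>D k\<close> itself comes from its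
  \<open>p\<close>-th power, as the absolute value is at most one plus that power and the box has
  measure one.\<close>

lemma W1p_locI:
  fixes f :: "real^'d \<Rightarrow> real"
  assumes p: "1 \<le> p" and f [measurable]: "f \<in> borel_measurable borel" and B: "\<And>x. \<bar>f x\<bar> \<le> B"
    and D [measurable]: "\<And>k. D k \<in> borel_measurable borel"
    and int: "\<And>k. integrable lborel (\<lambda>x. indicator unit_box x * \<bar>D k x\<bar> powr p)"
    and lines: "\<And>k. AE x in lborel. x \<in> unit_box \<longrightarrow>
       (\<forall>s. ((\<lambda>s. f (x + s *\<^sub>R axis k 1)) has_real_derivative D k (x + s *\<^sub>R axis k 1)) (at s))"
  shows "W1p_loc p unit_box f"
  unfolding W1p_loc_def
proof (intro conjI allI exI impI)
  have ind: "integrable lborel (\<lambda>x::real^'d. indicator unit_box x * c)" for c :: real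
    by (intro integrable_mult_left) (simp add: integrable_indicator_iff emeasure_unit_box)
  show "Lp_loc p unit_box f"
  proof (rule Lp_locI[OF f])
    show "integrable lborel (\<lambda>x. indicator unit_box x * \<bar>f x\<bar> powr p)"
      by (rule Bochner_Integration.integrable_bound[OF ind[of "B powr p"]])
         (use p B in \<open>auto split: split_indicator intro!: powr_mono2\<close>)
  qed
  fix k
  show "Lp_loc p unit_box (D k)" by (rule Lp_locI[OF D int])
  fix \<phi> :: "real^'d \<Rightarrow> real" assume \<phi>: "test_fun unit_box \<phi>"
  have "integrable lborel (\<lambda>x. indicator unit_box x * D k x)"
  proof (rule Bochner_Integration.integrable_bound[OF Bochner_Integration.integrable_add[OF ind[of 1] int[of k]]])
    show "AE x in lborel. norm (indicator unit_box x * D k x) \<le>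
      norm (indicator unit_box x * 1 + indicator unit_box x * \<bar>D k x\<bar> powr p)"
    proof (rule AE_I2)
      fix x
      have "\<bar>D k x\<bar> \<le> 1 + \<bar>D k x\<bar> powr p"
      proof (cases "\<bar>D k x\<bar> \<le> 1")
        case False
        then have "\<bar>D k x\<bar> powr 1 \<le> \<bar>D k x\<bar> powr p" using p by (intro powr_mono) auto
        then show ?thesis using False by simp
      qed (simp add: add_increasing2)
      then show "norm (indicator unit_box x * D k x) \<le>
        norm (indicator unit_box x * 1 + indicator unit_box x * \<bar>D k x\<bar> powr p)"
        by (auto split: split_indicator)
    qed
  qed measurable
  then show "integral\<^sup>L (lebesgue_on unit_box) (\<lambda>x. f x * partial k \<phi> x) = - integral\<^sup>L (lebesgue_on unit_box) (\<lambda>x. D k x * \<phi> x)"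
    by (rule unit_box_weak_derivative[OF f D B _ lines \<phi>])
qed

section \<open>Tubes around a dense family of lines\<close>

text \<open>Covers two cases: a single index in \<open>J\<close> gives a slab, of measure linear in
  \<open>\<rho>\<close>; all indices but \<open>a\<close> give a box around a tube, of measure of
  order d - 1 in \<open>\<rho>\<close>.\<close>

lemma emeasure_slab_le:
  fixes y :: "real^'d" and J :: "'d set"
  assumes \<rho>: "0 \<le> \<rho>"
  shows "emeasure lborel {x \<in> unit_box. \<forall>m\<in>J. \<bar>x $ m - y $ m\<bar> < \<rho>} \<le> ennreal ((2 * \<rho>) ^ card J)"
proof -
  define l :: "real^'d" where "l = (\<chi> m. if m \<in> J then y $ m - \<rho> else 0)"
  define u :: "real^'d" where "u = (\<chi> m. if m \<in> J then y $ m + \<rho> else 1)"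
  have lu: "l \<bullet> b \<le> u \<bullet> b" if "b \<in> Basis" for b
    using that \<rho> by (auto simp: Basis_vec_def inner_axis l_def u_def)
  have "emeasure lborel {x \<in> unit_box. \<forall>m\<in>J. \<bar>x $ m - y $ m\<bar> < \<rho>} \<le> emeasure lborel (cbox l u)"
  proof (rule emeasure_mono)
    show "{x \<in> unit_box. \<forall>m\<in>J. \<bar>x $ m - y $ m\<bar> < \<rho>} \<subseteq> cbox l u"
    proof
      fix x assume x: "x \<in> {x \<in> unit_box. \<forall>m\<in>J. \<bar>x $ m - y $ m\<bar> < \<rho>}"
      have "l $ m \<le> x $ m \<and> x $ m \<le> u $ m" for m
      proof (cases "m \<in> J")
        case True
        then have "\<bar>x $ m - y $ m\<bar> < \<rho>" using x by blast
        then show ?thesis using True by (auto simp: l_def u_def)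
      next
        case False
        then show ?thesis using x by (auto simp: l_def u_def mem_unit_box less_imp_le)
      qed
      then show "x \<in> cbox l u" by (simp add: mem_box_cart)
    qed
  qed simp
  also have "\<dots> = ennreal (\<Prod>b\<in>Basis. (u - l) \<bullet> b)" by (rule emeasure_lborel_cbox[OF lu])
  also have "(\<Prod>b\<in>Basis. (u - l) \<bullet> b) = (\<Prod>m\<in>UNIV. (u - l) $ m)"
  proof -
    have B: "(Basis :: (real^'d) set) = (\<lambda>m. axis m 1) ` UNIV" by (auto simp: Basis_vec_def)
    have "inj (\<lambda>m::'d. axis m (1::real))" by (auto simp: inj_on_def axis_eq_axis)
    then show ?thesis unfolding B by (simp add: prod.reindex inner_axis)
  qed
  also have "\<dots> = (\<Prod>m\<in>UNIV. if m \<in> J then 2 * \<rho> else 1)"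
    by (rule prod.cong) (auto simp: l_def u_def)
  also have "\<dots> = (2 * \<rho>) ^ card J" by (simp add: prod.If_cases)
  finally show ?thesis .
qed

text \<open>Squaring removes the kink of the positive part. Both the bumps and the profile use this
  truncation and are therefore differentiable along lines that meet finitely many tubes.\<close>

lemma max_zero_square_derivative: "((\<lambda>t::real. (max 0 t)\<^sup>2) has_real_derivative 2 * max 0 t) (at t)"
proof (cases "t = 0")
  case False
  show ?thesis
  proof (cases "t > 0")
    case True
    have "((\<lambda>t::real. t\<^sup>2) has_real_derivative 2 * t) (at t)" by (auto intro!: derivative_eq_intros)
    then have "((\<lambda>t::real. (max 0 t)\<^sup>2) has_real_derivative 2 * t) (at t)"
      by (rule DERIV_cong_ev[OF refl _ refl, THEN iffD1, rotated])
         (use True in \<open>auto simp: eventually_nhds intro!: exI[of _ "{0<..}"]\<close>)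
    then show ?thesis using True by simp
  next
    case neg: False
    then have t: "t < 0" using False by simp
    have "((\<lambda>t::real. 0) has_real_derivative 0) (at t)" by simp
    then have "((\<lambda>t::real. (max 0 t)\<^sup>2) has_real_derivative 0) (at t)"
      by (rule DERIV_cong_ev[OF refl _ refl, THEN iffD1, rotated])
         (use t in \<open>auto simp: eventually_nhds intro!: exI[of _ "{..<0}"]\<close>)
    then show ?thesis using t by simp
  qed
next
  case True
  have "((\<lambda>h::real. (max 0 h)\<^sup>2 / h) \<longlongrightarrow> 0) (at 0)"
  proof (rule tendsto_0_le[of "\<lambda>h::real. h" _ _ 1])
    show "eventually (\<lambda>h::real. norm ((max 0 h)\<^sup>2 / h) \<le> norm h * 1) (at 0)"
      by (rule always_eventually) (auto simp: max_def power2_eq_square)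
  qed (rule tendsto_ident_at)
  then show ?thesis using True by (simp add: DERIV_def)
qed

text \<open>A slab of half-width \<open>2 * radius k\<close> has measure at most
  \<open>4 * radius k\<close> in the box; the factor 1/16 makes these bounds add up to 1/2.\<close>

definition radius :: "nat \<Rightarrow> real" where "radius k = (1/2) ^ k / 16"

lemma radius_pos: "0 < radius k" by (simp add: radius_def)

lemma radius_sums: "radius sums (1/8)"
  using sums_divide[OF geometric_sums[of "1/2::real"], of 16] by (simp add: radius_def[abs_def])

lemma sum_inverse_radius_le: "(\<Sum>k\<le>n. 1 / radius k) \<le> 2 / radius n"
proof (induction n)
  case (Suc n)
  then have "(\<Sum>k\<le>Suc n. 1 / radius k) \<le> 2 / radius n + 1 / radius (Suc n)" by simp
  also have "\<dots> = 2 / radius (Suc n)" by (simp add: radius_def power_divide field_simps)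
  finally show ?case .
qed (simp add: radius_def)

context
  fixes a :: "'d::finite" and c :: "nat \<Rightarrow> real^'d"
begin

text \<open>Squared distance from \<open>x\<close> to the line through \<open>y\<close> in direction
  \<open>a\<close>.\<close>

definition axial_dist2 :: "real^'d \<Rightarrow> real^'d \<Rightarrow> real" where
  "axial_dist2 y x = (\<Sum>m\<in>UNIV - {a}. (x $ m - y $ m)\<^sup>2)"

text \<open>At least 1 in the tube of radius \<open>radius k\<close> around the line through
  \<open>c k\<close>, and 0 outside the tube wider by the factor sqrt 2.\<close>

definition bump :: "nat \<Rightarrow> real^'d \<Rightarrow> real" where
  "bump k x = (max 0 (2 - axial_dist2 (c k) x / (radius k)\<^sup>2))\<^sup>2"

text \<open>The partial derivative of \<open>bump k\<close> in direction \<open>j\<close>, by the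
  chain rule; it vanishes for \<open>j = a\<close> because the tubes run in that direction.\<close>

definition dbump :: "'d \<Rightarrow> nat \<Rightarrow> real^'d \<Rightarrow> real" where
  "dbump j k x = 2 * max 0 (2 - axial_dist2 (c k) x / (radius k)\<^sup>2) *
     (- ((if j = a then 0 else 2 * (x $ j - c k $ j)) / (radius k)\<^sup>2))"

text \<open>The positive part of one minus the sum of all bumps. Taking the infimum over partial
  sums makes it meaningful where the series diverges, with value 0.\<close>

definition cutoff :: "real^'d \<Rightarrow> real" where
  "cutoff x = (INF n. max 0 (1 - (\<Sum>k<n. bump k x)))"

text \<open>The value is 3/4 where \<open>cutoff\<close> is 0 and 1/4 where it is 1. Only the square
  of \<open>cutoff\<close> enters, which avoids the kink of its positive part.\<close>

definition profile :: "real^'d \<Rightarrow> real" where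
  "profile x = 3/4 - (cutoff x)\<^sup>2 / 2"

text \<open>The chain rule for \<open>profile\<close>, the two minus signs cancelling. The series is
  evaluated only at points where finitely many of its terms are nonzero.\<close>

definition dprofile :: "'d \<Rightarrow> real^'d \<Rightarrow> real" where
  "dprofile j x = cutoff x * (\<Sum>k. dbump j k x)"

section \<open>Elementary properties of the bumps and the profile\<close>

lemma bump_nonneg: "0 \<le> bump k x" by (simp add: bump_def)

lemma axial_dist2_measurable [measurable]: "axial_dist2 y \<in> borel_measurable borel"
  unfolding axial_dist2_def[abs_def] by measurable

lemma bump_measurable [measurable]: "bump k \<in> borel_measurable borel"
  unfolding bump_def[abs_def] by measurable

lemma dbump_measurable [measurable]: "dbump j k \<in> borel_measurable borel"
  unfolding dbump_def[abs_def] by measurable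

lemma cutoff_bdd_below: "bdd_below (range (\<lambda>n::nat. max 0 (1 - (\<Sum>k<n. bump k x))))"
  by (rule bdd_belowI[of _ 0]) auto

lemma cutoff_measurable [measurable]: "cutoff \<in> borel_measurable borel"
  unfolding cutoff_def[abs_def]
  by (rule borel_measurable_cINF) (auto intro: cutoff_bdd_below)

lemma profile_measurable [measurable]: "profile \<in> borel_measurable borel"
  unfolding profile_def[abs_def] by measurable

lemma dprofile_measurable [measurable]: "dprofile j \<in> borel_measurable borel"
  unfolding dprofile_def[abs_def] by measurable

lemma cutoff_nonneg: "0 \<le> cutoff x"
  unfolding cutoff_def by (rule cINF_greatest) auto

lemma cutoff_le: "cutoff x \<le> max 0 (1 - (\<Sum>k<n. bump k x))"
  unfolding cutoff_def by (rule cINF_lower[OF cutoff_bdd_below]) simp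

lemma cutoff_le_1: "cutoff x \<le> 1"
  using cutoff_le[of x 0] by simp

lemma profile_bounds: "1/4 \<le> profile x" "profile x \<le> 3/4"
proof -
  have "(cutoff x)\<^sup>2 \<le> 1" using cutoff_nonneg cutoff_le_1 by (simp add: power_le_one)
  then show "1/4 \<le> profile x" by (simp add: profile_def)
qed (simp add: profile_def)

lemma cutoff_finite:
  assumes "\<And>k. k \<ge> n \<Longrightarrow> bump k x = 0"
  shows "cutoff x = max 0 (1 - (\<Sum>k<n. bump k x))"
proof (rule antisym[OF cutoff_le])
  show "max 0 (1 - (\<Sum>k<n. bump k x)) \<le> cutoff x"
    unfolding cutoff_def
  proof (rule cINF_greatest)
    fix m :: nat
    have "(\<Sum>k<m. bump k x) \<le> (\<Sum>k<max m n. bump k x)"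
      by (rule sum_mono2) (auto simp: bump_nonneg)
    also have "\<dots> = (\<Sum>k<n. bump k x)"
      by (rule sum.mono_neutral_right) (auto simp: assms)
    finally show "max 0 (1 - (\<Sum>k<n. bump k x)) \<le> max 0 (1 - (\<Sum>k<m. bump k x))" by auto
  qed simp
qed

lemma square_le_axial_dist2: "m \<noteq> a \<Longrightarrow> (x $ m - y $ m)\<^sup>2 \<le> axial_dist2 y x"
  unfolding axial_dist2_def by (rule member_le_sum) auto

lemma bump_eq_0:
  assumes "2 * (radius k)\<^sup>2 \<le> axial_dist2 (c k) x"
  shows "bump k x = 0" "dbump j k x = 0"
proof -
  have "2 \<le> axial_dist2 (c k) x / (radius k)\<^sup>2" using assms radius_pos[of k] by (simp add: le_divide_eq)
  then show "bump k x = 0" "dbump j k x = 0" by (simp_all add: bump_def dbump_def)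
qed

lemma axial_dist2_far:
  assumes "m \<noteq> a" "2 * radius k \<le> \<bar>x $ m - c k $ m\<bar>"
  shows "2 * (radius k)\<^sup>2 \<le> axial_dist2 (c k) x"
proof -
  have "(2 * radius k)\<^sup>2 \<le> \<bar>x $ m - c k $ m\<bar>\<^sup>2"
    using assms(2) radius_pos[of k] by (intro power_mono) auto
  also have "\<dots> \<le> axial_dist2 (c k) x" using square_le_axial_dist2[OF assms(1)] by simp
  finally show ?thesis by (simp add: power_mult_distrib) (use zero_le_power2[of "radius k"] in linarith)
qed

lemma abs_dbump_le: "\<bar>dbump j k x\<bar> \<le> 16 / radius k"
proof (cases "2 * (radius k)\<^sup>2 \<le> axial_dist2 (c k) x")
  case True
  then show ?thesis using radius_pos[of k] by (simp add: bump_eq_0)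
next
  case False
  let ?r = "radius k"
  have r: "0 < ?r" by (rule radius_pos)
  show ?thesis
  proof (cases "j = a")
    case ja: False
    have near: "\<bar>x $ j - c k $ j\<bar> \<le> 2 * ?r"
    proof (rule ccontr)
      assume "\<not> ?thesis"
      then show False using axial_dist2_far[OF ja, of k x] False by simp
    qed
    have q0: "0 \<le> axial_dist2 (c k) x" unfolding axial_dist2_def by (rule sum_nonneg) auto
    define M where "M = max 0 (2 - axial_dist2 (c k) x / ?r\<^sup>2)"
    have M: "0 \<le> M" "M \<le> 2" using q0 r by (auto simp: M_def)
    have "\<bar>dbump j k x\<bar> = 2 * M * (2 * \<bar>x $ j - c k $ j\<bar> / ?r\<^sup>2)"
      using ja M by (simp add: dbump_def M_def[symmetric] abs_mult del: right_diff_distrib_numeral)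
    also have "\<dots> \<le> 2 * 2 * (2 * (2 * ?r) / ?r\<^sup>2)"
      using M near r by (intro mult_mono divide_right_mono) auto
    also have "\<dots> = 16 / ?r" using r by (simp add: power2_eq_square)
    finally show ?thesis .
  qed (use r in \<open>simp add: dbump_def\<close>)
qed

lemma bump_line_derivative:
  "((\<lambda>s. bump k (x + s *\<^sub>R axis j 1)) has_real_derivative dbump j k (x + s *\<^sub>R axis j 1)) (at s)"
proof -
  let ?x = "\<lambda>s. x + s *\<^sub>R axis j (1::real)"
  have "((\<lambda>s. axial_dist2 (c k) (?x s)) has_real_derivative
      (\<Sum>m\<in>UNIV - {a}. 2 * (?x s $ m - c k $ m) * axis j 1 $ m)) (at s)"
    unfolding axial_dist2_def by (rule DERIV_sum) (auto intro!: derivative_eq_intros)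
  also have "(\<Sum>m\<in>UNIV - {a}. 2 * (?x s $ m - c k $ m) * axis j 1 $ m) =
      (\<Sum>m\<in>UNIV - {a}. if m = j then 2 * (?x s $ j - c k $ j) else 0)"
    by (rule sum.cong) (auto simp: axis_def)
  also have "\<dots> = (if j = a then 0 else 2 * (?x s $ j - c k $ j))"
    by (subst sum.delta) auto
  finally have "((\<lambda>s. axial_dist2 (c k) (?x s)) has_real_derivative
      (if j = a then 0 else 2 * (?x s $ j - c k $ j))) (at s)" .
  from DERIV_diff[OF DERIV_const DERIV_cdivide[OF this, of "(radius k)\<^sup>2"], of 2]
  have q: "((\<lambda>s. 2 - axial_dist2 (c k) (?x s) / (radius k)\<^sup>2) has_real_derivative
      - ((if j = a then 0 else 2 * (?x s $ j - c k $ j)) / (radius k)\<^sup>2)) (at s)"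
    by simp
  show ?thesis
    unfolding bump_def dbump_def
    by (rule DERIV_chain2[OF max_zero_square_derivative q])
qed

text \<open>Coordinate \<open>i\<close> is constant along lines in direction \<open>j\<close> and is
  one of the transversal coordinates of the tubes. A line that meets tube \<open>k\<close> therefore
  lies entirely in a slab in coordinate \<open>i\<close>. The slabs have summable measure, and
  Borel-Cantelli leaves finitely many of them for almost every line.\<close>

lemma AE_lines_meet_finitely_many_tubes:
  assumes "i \<noteq> a" "i \<noteq> j"
  shows "AE x in lborel. x \<in> unit_box \<longrightarrow>
    (\<exists>n. \<forall>k\<ge>n. \<forall>s. bump k (x + s *\<^sub>R axis j 1) = 0 \<and> dbump j k (x + s *\<^sub>R axis j 1) = 0)"
proof -
  define A where "A k = {x \<in> unit_box. \<forall>m\<in>{i}. \<bar>x $ m - c k $ m\<bar> < 2 * radius k}" for k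
  have le: "emeasure lborel (A k) \<le> ennreal (4 * radius k)" for k
    using emeasure_slab_le[of "2 * radius k" "{i}" "c k"] radius_pos[of k] by (simp add: A_def)
  have fin: "emeasure lborel (A k) < \<infinity>" for k using le[of k] by (auto intro: le_less_trans)
  have meas: "A k \<in> sets lborel" for k unfolding A_def by measurable
  have "measure lborel (A k) \<le> 4 * radius k" for k
    using le[of k] radius_pos[of k] by (simp add: measure_def enn2real_leI)
  then have "summable (\<lambda>k. measure lborel (A k))"
    by (intro summable_comparison_test'[OF summable_mult[OF sums_summable[OF radius_sums], of 4]]) simp
  then have "AE x in lborel. eventually (\<lambda>k. x \<in> space lborel - A k) sequentially"
    by (rule borel_cantelli_AE1[OF meas fin])
  then show ?thesis
  proof eventually_elim
    case (elim x)
    show ?case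
    proof
      assume x: "x \<in> unit_box"
      from elim obtain n where n: "\<And>k. k \<ge> n \<Longrightarrow> x \<notin> A k" by (auto simp: eventually_sequentially)
      have "bump k (x + s *\<^sub>R axis j 1) = 0 \<and> dbump j k (x + s *\<^sub>R axis j 1) = 0" if "k \<ge> n" for k s
      proof -
        have "2 * radius k \<le> \<bar>x $ i - c k $ i\<bar>" using n[OF that] x by (auto simp: A_def)
        then have "2 * radius k \<le> \<bar>(x + s *\<^sub>R axis j 1) $ i - c k $ i\<bar>" using assms(2) by (simp add: axis_def)
        from bump_eq_0[OF axial_dist2_far[OF assms(1) this]] show ?thesis by blast
      qed
      then show "\<exists>n. \<forall>k\<ge>n. \<forall>s. bump k (x + s *\<^sub>R axis j 1) = 0 \<and> dbump j k (x + s *\<^sub>R axis j 1) = 0"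
        by blast
    qed
  qed
qed

lemma profile_line_derivative:
  assumes n: "\<And>k s. k \<ge> n \<Longrightarrow> bump k (x + s *\<^sub>R axis j 1) = 0 \<and> dbump j k (x + s *\<^sub>R axis j 1) = 0"
  shows "((\<lambda>s. profile (x + s *\<^sub>R axis j 1)) has_real_derivative dprofile j (x + s *\<^sub>R axis j 1)) (at s)"
proof -
  let ?x = "\<lambda>s. x + s *\<^sub>R axis j (1::real)"
  have cut: "cutoff (?x s) = max 0 (1 - (\<Sum>k<n. bump k (?x s)))" for s
    using n by (intro cutoff_finite) auto
  have prof: "profile (?x s) = 3/4 - (max 0 (1 - (\<Sum>k<n. bump k (?x s))))\<^sup>2 / 2" for s
    by (simp add: profile_def cut)
  have sm: "(\<Sum>k. dbump j k (?x s)) = (\<Sum>k<n. dbump j k (?x s))"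
    by (rule suminf_finite) (use n in auto)
  have "((\<lambda>s. \<Sum>k<n. bump k (?x s)) has_real_derivative (\<Sum>k<n. dbump j k (?x s))) (at s)"
    by (rule DERIV_sum) (rule bump_line_derivative)
  from DERIV_diff[OF DERIV_const this, of 1]
  have S: "((\<lambda>s. 1 - (\<Sum>k<n. bump k (?x s))) has_real_derivative - (\<Sum>k<n. dbump j k (?x s))) (at s)"
    by simp
  have "((\<lambda>s. 3/4 - (max 0 (1 - (\<Sum>k<n. bump k (?x s))))\<^sup>2 / 2) has_real_derivative
     0 - (2 * max 0 (1 - (\<Sum>k<n. bump k (?x s))) * - (\<Sum>k<n. dbump j k (?x s))) / 2) (at s)"
    by (intro DERIV_diff DERIV_const DERIV_cdivide DERIV_chain2[OF max_zero_square_derivative S])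
  also have "0 - (2 * max 0 (1 - (\<Sum>k<n. bump k (?x s))) * - (\<Sum>k<n. dbump j k (?x s))) / 2 = dprofile j (?x s)"
    by (simp add: dprofile_def cut sm)
  finally show ?thesis unfolding prof .
qed

text \<open>Where finitely many tubes are active, the geometric growth of 1 / radius lets the thinnest active
  tube dominate the derivative.\<close>

lemma abs_dprofile_powr_le:
  assumes p: "1 \<le> p" and K: "0 \<le> K"
    and n: "\<And>k. k \<ge> n \<Longrightarrow> dbump j k x = 0"
  shows "ennreal ((K * \<bar>dprofile j x\<bar>) powr p) \<le>
    (\<Sum>k. ennreal ((K * 32 / radius k) powr p) * indicator {x. axial_dist2 (c k) x < 2 * (radius k)\<^sup>2} x)"
proof -
  have sm: "(\<Sum>k. dbump j k x) = (\<Sum>k<n. dbump j k x)"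
    by (rule suminf_finite) (use n in auto)
  show ?thesis
  proof (cases "\<exists>k<n. dbump j k x \<noteq> 0")
    case False
    then have "dprofile j x = 0" by (simp add: dprofile_def sm)
    then show ?thesis by simp
  next
    case True
    define N where "N = Max {k. k < n \<and> dbump j k x \<noteq> 0}"
    have "N \<in> {k. k < n \<and> dbump j k x \<noteq> 0}" unfolding N_def by (rule Max_in) (use True in auto)
    then have N: "N < n" "dbump j N x \<noteq> 0" by auto
    have big: "dbump j k x = 0" if "N < k" for k
    proof (rule ccontr)
      assume "dbump j k x \<noteq> 0"
      then have "k \<in> {k. k < n \<and> dbump j k x \<noteq> 0}" using n[of k] not_less by auto
      then have "k \<le> N" unfolding N_def by (intro Max_ge) auto
      with that show False by simp
    qed
    have act: "axial_dist2 (c N) x < 2 * (radius N)\<^sup>2" using bump_eq_0(2)[of N x j] N(2) by force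
    have "\<bar>dprofile j x\<bar> = cutoff x * \<bar>\<Sum>k<n. dbump j k x\<bar>"
      using cutoff_nonneg[of x] by (simp add: dprofile_def sm abs_mult)
    also have "\<dots> \<le> 1 * \<bar>\<Sum>k<n. dbump j k x\<bar>" by (rule mult_right_mono[OF cutoff_le_1]) simp
    also have "(\<Sum>k<n. dbump j k x) = (\<Sum>k\<le>N. dbump j k x)"
      by (rule sum.mono_neutral_right) (use N big in \<open>auto simp: not_le\<close>)
    also have "1 * \<bar>\<Sum>k\<le>N. dbump j k x\<bar> \<le> (\<Sum>k\<le>N. 16 * (1 / radius k))"
      using abs_dbump_le by (auto intro!: order_trans[OF sum_abs] sum_mono)
    also have "\<dots> = 16 * (\<Sum>k\<le>N. 1 / radius k)" by (simp add: sum_distrib_left)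
    also have "\<dots> \<le> 16 * (2 / radius N)" by (rule mult_left_mono[OF sum_inverse_radius_le]) simp
    finally have "K * \<bar>dprofile j x\<bar> \<le> K * 32 / radius N"
      using K by (metis mult.commute mult_left_mono mult_numeral_1 times_divide_eq_right numeral_times_numeral semiring_norm(12) semiring_norm(13) )
    then have "(K * \<bar>dprofile j x\<bar>) powr p \<le> (K * 32 / radius N) powr p"
      using p K by (intro powr_mono2) auto
    then have "ennreal ((K * \<bar>dprofile j x\<bar>) powr p) \<le>
       ennreal ((K * 32 / radius N) powr p) * indicator {x. axial_dist2 (c N) x < 2 * (radius N)\<^sup>2} x"
      using act by (simp add: ennreal_leI)
    also have "\<dots> = (\<Sum>k\<in>{N}. ennreal ((K * 32 / radius k) powr p) * indicator {x. axial_dist2 (c k) x < 2 * (radius k)\<^sup>2} x)"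
      by (subst sum.insert) simp_all
    also have "\<dots> \<le> (\<Sum>k. ennreal ((K * 32 / radius k) powr p) * indicator {x. axial_dist2 (c k) x < 2 * (radius k)\<^sup>2} x)"
      by (rule sum_le_suminf) auto
    finally show ?thesis .
  qed
qed

lemma emeasure_tube_le:
  "emeasure lborel {x \<in> unit_box. axial_dist2 (c k) x < 2 * (radius k)\<^sup>2} \<le> ennreal ((4 * radius k) ^ (CARD('d) - 1))"
proof -
  have "emeasure lborel {x \<in> unit_box. axial_dist2 (c k) x < 2 * (radius k)\<^sup>2} \<le>
      emeasure lborel {x \<in> unit_box. \<forall>m\<in>UNIV - {a}. \<bar>x $ m - c k $ m\<bar> < 2 * radius k}"
  proof (rule emeasure_mono)
    show "{x \<in> unit_box. axial_dist2 (c k) x < 2 * (radius k)\<^sup>2} \<subseteq>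
       {x \<in> unit_box. \<forall>m\<in>UNIV - {a}. \<bar>x $ m - c k $ m\<bar> < 2 * radius k}"
      using axial_dist2_far[of _ k] by (auto simp: not_le[symmetric])
    show "{x \<in> unit_box. \<forall>m\<in>UNIV - {a}. \<bar>x $ m - c k $ m\<bar> < 2 * radius k} \<in> sets lborel" by measurable
  qed
  also have "\<dots> \<le> ennreal ((2 * (2 * radius k)) ^ card (UNIV - {a}))"
    by (rule emeasure_slab_le) (use radius_pos[of k] in simp)
  finally show ?thesis by (simp add: card_Diff_singleton)
qed

text \<open>The gradient is of order 1 / \<open>radius k\<close> on a set of measure of order
  \<open>radius k\<close> to the power d - 1, so the \<open>p\<close>-energy of a tube scales with
  exponent \<open>\<delta>\<close> = d - 1 - p. Positivity of \<open>\<delta>\<close> makes the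
  series geometric with ratio below one.\<close>

lemma summable_tube_energy:
  assumes p: "p < real CARD('d) - 1" and K: "0 \<le> K"
  shows "summable (\<lambda>k. (K * 32 / radius k) powr p * (4 * radius k) ^ (CARD('d) - 1))"
proof -
  define \<delta> where "\<delta> = real (CARD('d) - 1) - p"
  have \<delta>: "\<delta> > 0" using p by (simp add: \<delta>_def of_nat_diff)
  have eq: "(K * 32 / radius k) powr p * (4 * radius k) ^ (CARD('d) - 1) =
     ((K * 32) powr p * 4 ^ (CARD('d) - 1) * (1/16) powr \<delta>) * ((1/2) powr \<delta>) ^ k" for k
  proof -
    have r: "0 < radius k" by (rule radius_pos)
    have "(K * 32 / radius k) powr p * (4 * radius k) ^ (CARD('d) - 1)
       = (K * 32) powr p * 4 ^ (CARD('d) - 1) * (radius k ^ (CARD('d) - 1) / radius k powr p)"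
      using K r by (simp add: powr_divide power_mult_distrib)
    also have "radius k ^ (CARD('d) - 1) / radius k powr p = radius k powr \<delta>"
      unfolding \<delta>_def powr_diff powr_realpow[OF r] ..
    also have "radius k powr \<delta> = ((1/2)^k) powr \<delta> * (1/16) powr \<delta>"
      by (simp add: radius_def powr_mult[symmetric])
    also have "((1/2::real)^k) powr \<delta> = ((1/2) powr \<delta>) ^ k"
      by (simp add: powr_realpow[symmetric] powr_powr mult.commute)
    finally show ?thesis by (simp add: mult.assoc mult.commute)
  qed
  have "(1/2::real) powr \<delta> < 1" using gr_one_powr[of 2 \<delta>] \<delta> by (simp add: powr_divide)
  then have "summable (\<lambda>k. ((1/2::real) powr \<delta>) ^ k)" by (intro summable_geometric) simp
  then show ?thesis unfolding eq by (rule summable_mult)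
qed

text \<open>Stated for a function \<open>F\<close> of the profile because every entry of the metric
  has this form. The derivative is controlled by the sum of the tube energies, with \<open>K\<close>
  absorbing the derivative of \<open>F\<close>.\<close>

lemma W1p_loc_profile:
  fixes F F' :: "real \<Rightarrow> real"
  assumes d: "CARD('d) \<ge> 3" and p: "1 \<le> p" "p < real CARD('d) - 1"
    and [measurable]: "F \<in> borel_measurable borel" "F' \<in> borel_measurable borel"
    and F: "\<And>t. t \<in> {1/4..3/4} \<Longrightarrow> (F has_real_derivative F' t) (at t)"
    and B: "\<And>t. t \<in> {1/4..3/4} \<Longrightarrow> \<bar>F t\<bar> \<le> B" and B': "\<And>t. t \<in> {1/4..3/4} \<Longrightarrow> \<bar>F' t\<bar> \<le> K"
  shows "W1p_loc p unit_box (\<lambda>x. F (profile x))"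
proof (rule W1p_locI[where D = "\<lambda>j x. F' (profile x) * dprofile j x" and B = B])
  have prof: "profile x \<in> {1/4..3/4}" for x using profile_bounds[of x] by simp
  have K: "0 \<le> K" using B'[of "1/2"] by force
  show "\<bar>F (profile x)\<bar> \<le> B" for x by (rule B[OF prof])
  fix j :: 'd
  \<comment> \<open>At least three coordinates leave an index different from both the tube direction
    and the direction of differentiation.\<close>
  have "card {a, j} < CARD('d)" using d card_insert_le_m1[of 2 "{j}" a] by (simp add: card_insert_if)
  have "{a, j} \<noteq> UNIV"
  proof
    assume "{a, j} = UNIV"
    then have "card {a, j} = CARD('d)" by (rule arg_cong)
    with \<open>card {a, j} < CARD('d)\<close> show False by simp
  qed
  then obtain i where i: "i \<noteq> a" "i \<noteq> j" by blast
  note ae = AE_lines_meet_finitely_many_tubes[OF i]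
  from ae show "AE x in lborel. x \<in> unit_box \<longrightarrow>
     (\<forall>s. ((\<lambda>s. F (profile (x + s *\<^sub>R axis j 1))) has_real_derivative
        F' (profile (x + s *\<^sub>R axis j 1)) * dprofile j (x + s *\<^sub>R axis j 1)) (at s))"
  proof eventually_elim
    case (elim x)
    show ?case
    proof (intro impI allI)
      fix s assume "x \<in> unit_box"
      then obtain n where n: "\<And>k s. k \<ge> n \<Longrightarrow> bump k (x + s *\<^sub>R axis j 1) = 0 \<and> dbump j k (x + s *\<^sub>R axis j 1) = 0"
        using elim by blast
      have 1: "((\<lambda>s. profile (x + s *\<^sub>R axis j 1)) has_real_derivative dprofile j (x + s *\<^sub>R axis j 1)) (at s)"
        by (rule profile_line_derivative[of n]) (rule n)
      have 2: "(F has_real_derivative F' (profile (x + s *\<^sub>R axis j 1))) (at (profile (x + s *\<^sub>R axis j 1)))"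
        by (rule F[OF prof])
      show "((\<lambda>s. F (profile (x + s *\<^sub>R axis j 1))) has_real_derivative
        F' (profile (x + s *\<^sub>R axis j 1)) * dprofile j (x + s *\<^sub>R axis j 1)) (at s)"
        by (rule DERIV_chain2[where f = F and g = "\<lambda>s. profile (x + s *\<^sub>R axis j 1)" and x = s, OF 2 1])
    qed
  qed
  show "integrable lborel (\<lambda>x. indicator unit_box x * \<bar>F' (profile x) * dprofile j x\<bar> powr p)"
  proof (rule integrableI_nonneg)
    let ?T = "\<lambda>k. {x. axial_dist2 (c k) x < 2 * (radius k)\<^sup>2}"
    let ?f = "\<lambda>k x. ennreal ((K * 32 / radius k) powr p) * indicator {x \<in> unit_box. axial_dist2 (c k) x < 2 * (radius k)\<^sup>2} x"
    have "(\<integral>\<^sup>+x. ennreal (indicator unit_box x * \<bar>F' (profile x) * dprofile j x\<bar> powr p) \<partial>lborel)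
       \<le> (\<integral>\<^sup>+x. (\<Sum>k. ?f k x) \<partial>lborel)"
    proof (rule nn_integral_mono_AE)
      from ae show "AE x in lborel. ennreal (indicator unit_box x * \<bar>F' (profile x) * dprofile j x\<bar> powr p) \<le> (\<Sum>k. ?f k x)"
      proof eventually_elim
        case (elim x)
        show ?case
        proof (cases "x \<in> unit_box")
          case True
          then obtain n where n: "\<And>k s. k \<ge> n \<Longrightarrow> bump k (x + s *\<^sub>R axis j 1) = 0 \<and> dbump j k (x + s *\<^sub>R axis j 1) = 0"
            using elim by blast
          have n0: "dbump j k x = 0" if "k \<ge> n" for k using n[OF that, of 0] by simp
          have "\<bar>F' (profile x) * dprofile j x\<bar> \<le> K * \<bar>dprofile j x\<bar>"
            using B'[OF prof] by (simp add: abs_mult mult_right_mono)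
          then have "\<bar>F' (profile x) * dprofile j x\<bar> powr p \<le> (K * \<bar>dprofile j x\<bar>) powr p"
            using p by (intro powr_mono2) auto
          then have "ennreal (indicator unit_box x * \<bar>F' (profile x) * dprofile j x\<bar> powr p) \<le> ennreal ((K * \<bar>dprofile j x\<bar>) powr p)"
            using True by (simp add: ennreal_leI)
          also have "\<dots> \<le> (\<Sum>k. ennreal ((K * 32 / radius k) powr p) * indicator (?T k) x)"
            by (rule abs_dprofile_powr_le[OF p(1) K n0])
          also have "\<dots> = (\<Sum>k. ?f k x)"
            using True by (intro arg_cong[where f = suminf] ext) (auto split: split_indicator)
          finally show ?thesis .
        qed simp
      qed
    qed
    also have "\<dots> = (\<Sum>k. \<integral>\<^sup>+x. ?f k x \<partial>lborel)" by (rule nn_integral_suminf) measurable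
    also have "\<dots> \<le> (\<Sum>k. ennreal ((K * 32 / radius k) powr p * (4 * radius k) ^ (CARD('d) - 1)))"
    proof (rule suminf_le[OF _ summableI summableI])
      fix k
      have "(\<integral>\<^sup>+x. ?f k x \<partial>lborel) = ennreal ((K * 32 / radius k) powr p) *
          emeasure lborel {x \<in> unit_box. axial_dist2 (c k) x < 2 * (radius k)\<^sup>2}"
        by (rule nn_integral_cmult_indicator) measurable
      also have "\<dots> \<le> ennreal ((K * 32 / radius k) powr p) * ennreal ((4 * radius k) ^ (CARD('d) - 1))"
        by (rule mult_left_mono[OF emeasure_tube_le]) simp
      finally show "(\<integral>\<^sup>+x. ?f k x \<partial>lborel) \<le> ennreal ((K * 32 / radius k) powr p * (4 * radius k) ^ (CARD('d) - 1))"
        using radius_pos[of k] by (simp add: ennreal_mult)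
    qed
    also have "\<dots> < \<infinity>"
    proof -
      have "(\<Sum>k. ennreal ((K * 32 / radius k) powr p * (4 * radius k) ^ (CARD('d) - 1))) \<noteq> top"
        by (rule ennreal_suminf_neq_top[OF summable_tube_energy[OF p(2) K]])
           (use radius_pos in \<open>simp add: less_imp_le\<close>)
      then show ?thesis by (simp only: less_top infinity_ennreal_def)
    qed
    finally show "(\<integral>\<^sup>+x. ennreal (indicator unit_box x * \<bar>F' (profile x) * dprofile j x\<bar> powr p) \<partial>lborel) < \<infinity>" .
  qed (auto intro!: AE_I2)
qed (use p in auto)

end

section \<open>The highway metric\<close>

definition diag_mat :: "('d \<Rightarrow> real) \<Rightarrow> real^'d^'d" where
  "diag_mat \<delta> = (\<chi> i j. if i = j then \<delta> i else 0)"

lemma diag_mat_mult: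
  fixes \<delta> \<epsilon> :: "'d::finite \<Rightarrow> real"
  shows "diag_mat \<delta> ** diag_mat \<epsilon> = diag_mat (\<lambda>i. \<delta> i * \<epsilon> i)"
proof -
  have "(\<Sum>k\<in>UNIV. (if i = k then \<delta> i else 0) * (if k = j then \<epsilon> k else 0)) =
      (\<Sum>k\<in>UNIV. if k = i then (if i = j then \<delta> i * \<epsilon> i else 0) else 0)" for i j
    by (rule sum.cong) auto
  then show ?thesis by (simp add: diag_mat_def matrix_matrix_mult_def vec_eq_iff)
qed

lemma matrix_inv_diag_mat:
  fixes \<delta> :: "'d::finite \<Rightarrow> real"
  assumes "\<And>i. \<delta> i \<noteq> 0"
  shows "matrix_inv (diag_mat \<delta>) = diag_mat (\<lambda>i. 1 / \<delta> i)"
proof -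
  let ?A = "diag_mat \<delta>" and ?B = "diag_mat (\<lambda>i. 1 / \<delta> i)"
  have one: "diag_mat (\<lambda>i::'d. 1) = mat 1" by (simp add: diag_mat_def mat_def)
  have AB: "?A ** ?B = mat 1" "?B ** ?A = mat 1" using assms by (simp_all add: diag_mat_mult one)
  have "?A ** matrix_inv ?A = mat 1 \<and> matrix_inv ?A ** ?A = mat 1"
    unfolding matrix_inv_def by (rule someI[of _ ?B]) (use AB in blast)
  then have "matrix_inv ?A = ?B ** (?A ** matrix_inv ?A) "
    using AB by (metis matrix_mul_assoc matrix_mul_lid)
  then show ?thesis
    using AB \<open>?A ** matrix_inv ?A = mat 1 \<and> matrix_inv ?A ** ?A = mat 1\<close> by (metis matrix_mul_rid)
qed

lemma diag_mat_mult_vec: "(diag_mat \<delta> *v D) $ i = \<delta> i * D $ i"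
proof -
  have "(\<Sum>j\<in>UNIV. (if i = j then \<delta> i else 0) * D $ j) = (\<Sum>j\<in>UNIV. if j = i then \<delta> i * D $ i else 0)"
    by (rule sum.cong) auto
  then show ?thesis by (simp add: diag_mat_def matrix_vector_mult_def)
qed

lemma diag_mat_quadratic: "(diag_mat \<delta> *v D) \<bullet> D = (\<Sum>i\<in>UNIV. \<delta> i * (D $ i)\<^sup>2)"
  by (simp add: inner_vec_def diag_mat_mult_vec power2_eq_square mult.assoc)

lemma det_diag_mat: "det (diag_mat \<delta>) = prod \<delta> UNIV"
  by (subst det_diagonal) (simp_all add: diag_mat_def)

lemma transpose_diag_mat: "transpose (diag_mat \<delta>) = diag_mat \<delta>"
  by (auto simp: transpose_def diag_mat_def vec_eq_iff)

lemma abs_component_le_of_quadratic: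
  assumes pos: "\<And>i. 0 < \<delta> i" and Q: "(matrix_inv (diag_mat \<delta>) *v D) \<bullet> D \<le> 1"
  shows "\<bar>D $ i\<bar> \<le> sqrt (\<delta> i)"
proof -
  have nz: "\<And>i. \<delta> i \<noteq> 0" using pos by (metis less_irrefl)
  have "1 / \<delta> i * (D $ i)\<^sup>2 \<le> (\<Sum>i\<in>UNIV. 1 / \<delta> i * (D $ i)\<^sup>2)"
    by (rule member_le_sum) (use pos in \<open>auto simp: less_imp_le\<close>)
  also have "\<dots> \<le> 1" using Q by (simp add: matrix_inv_diag_mat[OF nz] diag_mat_quadratic)
  finally have "(D $ i)\<^sup>2 \<le> \<delta> i" using pos[of i] by (simp add: divide_le_eq)
  then have "sqrt ((D $ i)\<^sup>2) \<le> sqrt (\<delta> i)" by (rule real_sqrt_le_mono)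
  then show ?thesis by simp
qed

text \<open>The points of \<open>H\<close> with a ball that \<open>H\<close> does not charge are
  covered by the countably many basic open sets that meet \<open>H\<close> in a null set. Hence
  almost every point of \<open>H\<close> satisfies the condition \<open>pos\<close> of
  \<open>dist_g_line_le\<close>, even if \<open>H\<close> has empty interior.\<close>

lemma positive_measure_points:
  fixes H :: "'a::euclidean_space set"
  assumes [measurable]: "H \<in> sets borel"
  defines "S \<equiv> {x \<in> H. \<forall>r>0. emeasure lborel (ball x r \<inter> H) > 0}"
  shows "S \<in> sets borel" "emeasure lborel (H - S) = 0"
proof -
  obtain B :: "'a set set" where B: "countable B" "topological_basis B"
    using ex_countable_basis by blast
  define B0 where "B0 = {b \<in> B. emeasure lborel (b \<inter> H) = 0}"
  have B0: "countable B0" using B(1) by (simp add: B0_def)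
  have B0_open: "open b" if "b \<in> B0" for b
    using that B(2) by (auto simp: B0_def topological_basis_open)
  have eq: "H - S = H \<inter> \<Union>B0"
  proof (intro equalityI subsetI)
    fix x assume "x \<in> H - S"
    then obtain r where x: "x \<in> H" and r: "r > 0" "emeasure lborel (ball x r \<inter> H) = 0"
      by (auto simp: S_def zero_less_iff_neq_zero)
    obtain b where b: "b \<in> B" "x \<in> b" "b \<subseteq> ball x r"
      using topological_basisE[OF B(2) open_ball, of x x r] r(1) by auto
    have "emeasure lborel (b \<inter> H) \<le> emeasure lborel (ball x r \<inter> H)"
      using b by (intro emeasure_mono) auto
    then have "b \<in> B0" using b r by (simp add: B0_def)
    then show "x \<in> H \<inter> \<Union>B0" using x b by blast
  next
    fix x assume "x \<in> H \<inter> \<Union>B0"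
    then obtain b where x: "x \<in> H" and b: "b \<in> B0" "x \<in> b" by blast
    obtain r where r: "r > 0" "ball x r \<subseteq> b" using B0_open[OF b(1)] b(2) openE by blast
    have "b \<inter> H \<in> sets lborel" using B0_open[OF b(1)] by simp
    then have "emeasure lborel (ball x r \<inter> H) \<le> emeasure lborel (b \<inter> H)"
      using r by (intro emeasure_mono) auto
    then have "emeasure lborel (ball x r \<inter> H) = 0" using b(1) by (simp add: B0_def)
    then show "x \<in> H - S" using x r(1) by (auto simp: S_def)
  qed
  have "open (\<Union>B0)" using B0_open by blast
  then have HS: "H - S \<in> sets borel" unfolding eq by simp
  have "S = H - (H - S)" by (auto simp: S_def)
  then show "S \<in> sets borel" using HS assms(1) by (metis sets.Diff)
  have "H - S = (\<Union>b\<in>B0. b \<inter> H)" unfolding eq by blast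
  moreover have "(\<Union>b\<in>B0. b \<inter> H) \<in> null_sets lborel"
  proof (rule null_sets_UN'[OF B0])
    fix b assume b: "b \<in> B0"
    have "b \<inter> H \<in> sets lborel" using B0_open[OF b] by simp
    then show "b \<inter> H \<in> null_sets lborel" using b by (simp add: B0_def null_sets_def)
  qed
  ultimately show "emeasure lborel (H - S) = 0" by auto
qed

text \<open>Makes the set of such points inherit the translation invariance of \<open>H\<close>, as
  the plans moving along lines demand.\<close>

lemma positive_measure_translate:
  fixes H :: "'a::euclidean_space set"
  assumes H [measurable]: "H \<in> sets borel" and inv: "\<And>y. y \<in> H \<Longrightarrow> y + v \<in> H"
    and pos: "emeasure lborel (ball x r \<inter> H) > 0"
  shows "emeasure lborel (ball (x + v) r \<inter> H) > 0"
proof -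
  have "emeasure lborel (ball x r \<inter> H) \<le> emeasure lborel {y. v + y \<in> ball (x + v) r \<inter> H}"
  proof (rule emeasure_mono)
    show "ball x r \<inter> H \<subseteq> {y. v + y \<in> ball (x + v) r \<inter> H}"
      using inv by (auto simp: dist_norm add.commute)
    have "(\<lambda>y. v + y) -` (ball (x + v) r \<inter> H) \<inter> space lborel \<in> sets lborel"
      by (rule measurable_sets[of _ lborel borel]) auto
    then show "{y. v + y \<in> ball (x + v) r \<inter> H} \<in> sets lborel" by (simp add: vimage_def)
  qed
  also have "\<dots> = emeasure (distr lborel borel ((+) v)) (ball (x + v) r \<inter> H)"
    by (subst emeasure_distr) (auto simp: vimage_def)
  also have "\<dots> = emeasure lborel (ball (x + v) r \<inter> H)" by (simp add: lborel_distr_plus)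
  finally show ?thesis using pos by simp
qed

lemma profile_core:
  assumes "axial_dist2 a (c k) x < (radius k)\<^sup>2"
  shows "profile a c x = 3/4"
proof -
  have "axial_dist2 a (c k) x / (radius k)\<^sup>2 < 1" using assms radius_pos[of k] by (simp add: divide_less_eq)
  then have "1\<^sup>2 \<le> (max 0 (2 - axial_dist2 a (c k) x / (radius k)\<^sup>2))\<^sup>2" by (intro power_mono) auto
  then have "1 \<le> bump a c k x" by (simp add: bump_def)
  also have "\<dots> \<le> (\<Sum>k<Suc k. bump a c k x)" by (rule member_le_sum) (auto simp: bump_nonneg)
  finally have "cutoff a c x \<le> 0" using cutoff_le[of a c x "Suc k"] by simp
  then have "cutoff a c x = 0" using cutoff_nonneg[of a c x] by simp
  then show ?thesis by (simp add: profile_def)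
qed

lemma profile_off_tubes:
  assumes "m \<noteq> a" "\<And>k. 2 * radius k \<le> \<bar>x $ m - c k $ m\<bar>"
  shows "profile a c x = 1/4"
proof -
  have "bump a c k x = 0" for k
    by (rule bump_eq_0(1)) (rule axial_dist2_far[OF assms])
  then have "cutoff a c x = 1" using cutoff_finite[of 0 a c x] by simp
  then show ?thesis by (simp add: profile_def)
qed

text \<open>In the metric diag (weight a b e (profile x)), the first two weights are arranged so that every covector
  with entries \<plusminus>1 in the directions a and b has norm one; the third weight makes the determinant one.\<close>

definition weight :: "'d \<Rightarrow> 'd \<Rightarrow> 'd \<Rightarrow> real \<Rightarrow> 'd \<Rightarrow> real" where
  "weight a b e t i = (if i = a then 1 / t else if i = b then 1 / (1 - t) else if i = e then t * (1 - t) else 1)"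

lemma product_lower_bound:
  assumes "t \<in> {1/4..3/4::real}" shows "3/16 \<le> t * (1 - t)"
proof -
  have "0 \<le> (t - 1/4) * (3/4 - t)" using assms by (intro mult_nonneg_nonneg) auto
  also have "\<dots> = t * (1 - t) - 3/16" by (simp add: field_simps)
  finally show ?thesis by simp
qed

lemma weight_bounds:
  assumes t: "t \<in> {1/4..3/4}"
  shows "0 < weight a b e t i" "\<bar>weight a b e t i\<bar> \<le> 16" "\<bar>1 / weight a b e t i\<bar> \<le> 16"
proof -
  note lo = product_lower_bound[OF t]
  have hi: "t * (1 - t) \<le> 1 * 1" using t by (intro mult_mono) auto
  have "1 / (t * (1 - t)) \<le> 16" using lo by (simp add: divide_le_eq)
  moreover have "1 / t \<le> 4" "1 / (1 - t) \<le> 4" using t by (auto simp: divide_le_eq)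
  ultimately show "0 < weight a b e t i" "\<bar>weight a b e t i\<bar> \<le> 16" "\<bar>1 / weight a b e t i\<bar> \<le> 16"
    using t lo hi by (auto simp: weight_def)
qed

lemma prod_weight:
  fixes a b e :: "'d::finite"
  assumes "a \<noteq> b" "a \<noteq> e" "b \<noteq> e" "t \<in> {1/4..3/4}"
  shows "prod (weight a b e t) UNIV = 1"
proof -
  have "prod (weight a b e t) UNIV = prod (weight a b e t) {a, b, e}"
    by (rule prod.mono_neutral_right) (auto simp: weight_def)
  also have "\<dots> = 1 / t * (1 / (1 - t) * (t * (1 - t)))"
    using assms(1-3) by (simp add: weight_def)
  also have "\<dots> = 1" using assms(4) by auto
  finally show ?thesis .
qed

lemma weight_inverse_sum:
  fixes a b e :: "'d::finite" and v :: "real^'d"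
  assumes "a \<noteq> b" and v: "(v $ a)\<^sup>2 = 1" "(v $ b)\<^sup>2 = 1" "\<And>m. m \<noteq> a \<Longrightarrow> m \<noteq> b \<Longrightarrow> v $ m = 0"
  shows "(\<Sum>i\<in>UNIV. 1 / weight a b e t i * (v $ i)\<^sup>2) = 1"
proof -
  have "(\<Sum>i\<in>UNIV. 1 / weight a b e t i * (v $ i)\<^sup>2) = (\<Sum>i\<in>{a, b}. 1 / weight a b e t i * (v $ i)\<^sup>2)"
    by (rule sum.mono_neutral_right) (auto simp: v)
  also have "\<dots> = 1" using assms(1) by (simp add: weight_def v)
  finally show ?thesis .
qed

definition highway_metric :: "'d \<Rightarrow> 'd \<Rightarrow> 'd \<Rightarrow> (nat \<Rightarrow> real^'d) \<Rightarrow> real^'d \<Rightarrow> real^'d^'d" where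
  "highway_metric a b e c x = diag_mat (weight a b e (profile a c x))"

context
  fixes a b e :: "'d::finite" and c :: "nat \<Rightarrow> real^'d" and g :: "real^'d \<Rightarrow> real^'d^'d"
  assumes abe: "a \<noteq> b" "a \<noteq> e" "b \<noteq> e"
  defines "g \<equiv> highway_metric a b e c"
begin

section \<open>Regularity of the highway metric\<close>

lemma profile_in: "profile a c x \<in> {1/4..3/4}"
  using profile_bounds[of a c x] by simp

lemma weight_pos: "0 < weight a b e (profile a c x) i"
  by (rule weight_bounds(1)[OF profile_in])

lemma weight_nonzero: "weight a b e (profile a c x) i \<noteq> 0"
  using weight_pos[of x i] by simp

lemma g_entry: "g x $ i $ j = (if i = j then weight a b e (profile a c x) i else 0)"
  by (simp add: g_def highway_metric_def diag_mat_def)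

lemma g_inv: "matrix_inv (g x) = diag_mat (\<lambda>i. 1 / weight a b e (profile a c x) i)"
  unfolding g_def highway_metric_def by (rule matrix_inv_diag_mat[OF weight_nonzero])

lemma weight_measurable [measurable]: "(\<lambda>t. weight a b e t i) \<in> borel_measurable borel"
  unfolding weight_def by measurable

lemma riem_metric_g: "riem_metric U g"
  unfolding riem_metric_def
proof (intro conjI allI ballI impI)
  fix i j
  show "(\<lambda>x. g x $ i $ j) \<in> borel_measurable borel"
    unfolding g_entry by (cases "i = j") simp_all
next
  fix x
  show "transpose (g x) = g x" by (simp add: g_def highway_metric_def transpose_diag_mat)
  fix v :: "real^'d" assume "v \<noteq> 0"
  then obtain i where i: "v $ i \<noteq> 0" by (auto simp: vec_eq_iff)
  have "0 < (\<Sum>i\<in>UNIV. weight a b e (profile a c x) i * (v $ i)\<^sup>2)"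
    by (rule sum_pos2[of _ i]) (use i weight_pos in \<open>auto simp: less_imp_le\<close>)
  then show "0 < v \<bullet> (g x *v v)"
    by (simp add: inner_commute[of v] g_def highway_metric_def diag_mat_quadratic)
qed

lemma Linf_loc_metric_g: "Linf_loc_metric U g"
  unfolding Linf_loc_metric_def
proof (intro allI impI exI AE_I2)
  fix x i j
  show "\<bar>g x $ i $ j\<bar> \<le> 16 \<and> \<bar>matrix_inv (g x) $ i $ j\<bar> \<le> 16"
    using weight_bounds(2,3)[OF profile_in, of a b e x i]
    by (cases "i = j") (simp_all add: g_entry g_inv diag_mat_def)
qed

lemma W1p_loc_metric_g:
  assumes d: "CARD('d) \<ge> 3" and p: "1 \<le> p" "p < real CARD('d) - 1"
  shows "W1p_loc_metric p unit_box g"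
  unfolding W1p_loc_metric_def
proof (intro allI)
  fix i j
  define F where "F t = (if i = j then weight a b e t i else 0)" for t
  define F' where "F' t = (if i = j then (if i = a then - 1 / t\<^sup>2 else if i = b then 1 / (1 - t)\<^sup>2
     else if i = e then 1 - 2 * t else 0) else 0)" for t :: real
  have [measurable]: "F \<in> borel_measurable borel" unfolding F_def[abs_def] by (cases "i = j") simp_all
  have [measurable]: "F' \<in> borel_measurable borel" unfolding F'_def[abs_def] by measurable
  have "W1p_loc p unit_box (\<lambda>x. F (profile a c x))"
  proof (rule W1p_loc_profile[OF d p])
    fix t :: real assume t: "t \<in> {1/4..3/4}"
    then have t01: "t \<noteq> 0" "1 - t \<noteq> 0" by auto
    have "((\<lambda>t. 1 / t) has_real_derivative - 1 / t\<^sup>2) (at t)"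
      using t01 by (auto intro!: derivative_eq_intros simp: power2_eq_square)
    moreover have "((\<lambda>t. 1 / (1 - t)) has_real_derivative 1 / (1 - t)\<^sup>2) (at t)"
      using t01 by (auto intro!: derivative_eq_intros simp: power2_eq_square)
    moreover have "((\<lambda>t. t * (1 - t)) has_real_derivative 1 - 2 * t) (at t)"
      by (auto intro!: derivative_eq_intros)
    ultimately show "(F has_real_derivative F' t) (at t)"
      using abe by (auto simp: F_def[abs_def] F'_def weight_def)
    show "\<bar>F t\<bar> \<le> 16" using weight_bounds(2)[OF t, of a b e i] by (cases "i = j") (simp_all add: F_def)
    have "(1/4)\<^sup>2 \<le> t\<^sup>2" "(1/4)\<^sup>2 \<le> (1 - t)\<^sup>2" using t by (intro power_mono; simp)+
    then have "1 / t\<^sup>2 \<le> 16" "1 / (1 - t)\<^sup>2 \<le> 16" using t01 by (auto simp: divide_le_eq power2_eq_square)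
    then show "\<bar>F' t\<bar> \<le> 16" using t by (auto simp: F'_def)
  qed measurable
  then show "W1p_loc p unit_box (\<lambda>x. g x $ i $ j)" by (simp add: g_entry F_def)
qed

section \<open>Volume and Cheeger energies of the highway metric\<close>

lemma vol_g_g: "vol_g unit_box g = lebesgue_on unit_box"
proof -
  have "det (g x) = 1" for x
    unfolding g_def highway_metric_def det_diag_mat by (rule prod_weight[OF abe profile_in])
  then show ?thesis by (simp add: vol_g_def density_1)
qed

text \<open>Both \<open>v\<close> and its negative satisfy the hypotheses, so the two linear
  functions are admissible and the oscillation of \<open>v \<bullet> x\<close> is bounded by
  \<open>dist_g\<close>. The constant 1 is then a weak upper gradient, and the box has volume
  one.\<close>

lemma cheeger_diagonal_le:
  assumes v: "(v $ a)\<^sup>2 = 1" "(v $ b)\<^sup>2 = 1" "\<And>m. m \<noteq> a \<Longrightarrow> m \<noteq> b \<Longrightarrow> v $ m = 0"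
  shows "cheeger unit_box g (\<lambda>x. v \<bullet> x) \<le> 1 / 2"
proof -
  have adm: "(\<lambda>x. v \<bullet> x) \<in> adm_fun unit_box g"
    if v: "(v $ a)\<^sup>2 = 1" "(v $ b)\<^sup>2 = 1" "\<And>m. m \<noteq> a \<Longrightarrow> m \<noteq> b \<Longrightarrow> v $ m = 0" for v
    unfolding adm_fun_def
  proof (intro CollectI conjI ballI AE_I2)
    fix x :: "real^'d"
    have "(norm v)-lipschitz_on (ball x 1 \<inter> unit_box) (\<lambda>x. v \<bullet> x)"
    proof (rule lipschitz_onI)
      fix y z :: "real^'d"
      show "dist (v \<bullet> y) (v \<bullet> z) \<le> norm v * dist y z"
        using Cauchy_Schwarz_ineq2[of v "y - z"] by (simp add: dist_norm inner_diff_right)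
    qed simp
    then show "\<exists>r>0. \<exists>C. C-lipschitz_on (ball x r \<inter> unit_box) (\<lambda>x. v \<bullet> x)"
      by (intro exI[of _ 1]) auto
    have "((\<lambda>x. v \<bullet> x) has_derivative (\<lambda>h. v \<bullet> h)) (at x)"
      by (auto intro!: derivative_eq_intros)
    moreover have "(matrix_inv (g x) *v v) \<bullet> v \<le> 1"
      unfolding g_inv diag_mat_quadratic using weight_inverse_sum[OF abe(1) v, of e] by simp
    ultimately show "\<exists>D. ((\<lambda>x. v \<bullet> x) has_derivative (\<lambda>h. D \<bullet> h)) (at x) \<and> (matrix_inv (g x) *v D) \<bullet> D \<le> 1"
      by blast
  qed
  have d: "ereal \<bar>v \<bullet> x - v \<bullet> y\<bar> \<le> dist_g unit_box g x y" for x y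
  proof -
    have "ereal (v \<bullet> x - v \<bullet> y) \<le> dist_g unit_box g x y"
      unfolding dist_g_def by (rule SUP_upper2[OF adm[OF v]]) simp_all
    moreover have "(\<lambda>x. (- v) \<bullet> x) \<in> adm_fun unit_box g" by (rule adm) (use v in auto)
    then have "ereal ((- v) \<bullet> x - (- v) \<bullet> y) \<le> dist_g unit_box g x y"
      unfolding dist_g_def by (rule SUP_upper2) simp
    ultimately show ?thesis by (cases "v \<bullet> x \<le> v \<bullet> y") (auto simp: abs_if)
  qed
  have "cheeger unit_box g (\<lambda>x. v \<bullet> x) \<le> emeasure (vol_g unit_box g) (space (vol_g unit_box g)) / 2"
    by (rule cheeger_le_volume[OF _ d]) (intro continuous_intros)
  also have "\<dots> = 1 / 2"
    by (simp add: vol_g_g space_restrict_space emeasure_restrict_space emeasure_unit_box)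
  finally show ?thesis .
qed

text \<open>\<open>H\<close> is where the metric is fast in direction \<open>i\<close>;
  \<open>S\<close> is where the resulting bound on distances holds, and it only has to be
  approximated by \<open>H\<close> in measure. Weight 4/3 allows speed sqrt (4/3), and half of its
  inverse square is 3/8.\<close>

lemma cheeger_coordinate_ge_of_speed:
  assumes H: "H \<in> sets borel" "\<And>x s. x \<in> H \<Longrightarrow> x + s *\<^sub>R axis i 1 \<in> H"
    and w: "\<And>x. x \<in> H \<Longrightarrow> weight a b e (profile a c x) i = 4/3"
    and S: "S \<in> sets borel" "\<And>x s. x \<in> S \<Longrightarrow> x + s *\<^sub>R axis i 1 \<in> S"
    and pos: "\<And>x r. x \<in> S \<Longrightarrow> 0 < r \<Longrightarrow> emeasure lborel (ball x r \<inter> H) > 0"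
  shows "ennreal (3/8 * measure lborel (S \<inter> unit_box)) \<le> cheeger unit_box g (\<lambda>x. x $ i)"
proof -
  have bd: "\<bar>D $ i\<bar> \<le> sqrt (4/3)" if "x \<in> H" "x \<in> unit_box" "(matrix_inv (g x) *v D) \<bullet> D \<le> 1" for x D
    using abs_component_le_of_quadratic[OF weight_pos that(3)[unfolded g_def highway_metric_def], of i] w[OF that(1)]
    by simp
  have dist: "dist_g unit_box g (x + s *\<^sub>R axis i 1) (x + t *\<^sub>R axis i 1) \<le> ereal (sqrt (4/3) * \<bar>t - s\<bar>)"
    if "x \<in> S" "x + s *\<^sub>R axis i 1 \<in> unit_box" "x + t *\<^sub>R axis i 1 \<in> unit_box" for x s t
    by (rule dist_g_line_le[OF open_box convex_box(2) H bd pos[OF that(1)] that(2,3)])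
  have "ennreal (measure lborel (S \<inter> unit_box) / (sqrt (4/3))\<^sup>2 / 2) \<le> cheeger unit_box g (\<lambda>x. x $ i)"
    by (rule cheeger_coordinate_ge[OF open_box convex_box(2) _ S vol_g_g dist]) (simp_all add: emeasure_unit_box)
  then show ?thesis by (simp add: mult.commute)
qed

text \<open>The cores of the tubes form an open dense set, invariant in direction \<open>a\<close>,
  so every ball meets it in positive measure, however small its volume. The distance bound therefore
  holds on the whole box.\<close>

lemma cheeger_highway_direction_ge:
  assumes dense: "\<And>X. open X \<Longrightarrow> X \<noteq> {} \<Longrightarrow> \<exists>k. c k \<in> X"
  shows "ennreal (3/8) \<le> cheeger unit_box g (\<lambda>x. x $ a)"
proof -
  define H where "H = (\<Union>k. {x. axial_dist2 a (c k) x < (radius k)\<^sup>2})"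
  have H_open: "open H" unfolding H_def axial_dist2_def
    by (intro open_UN ballI open_Collect_less continuous_intros)
  \<comment> \<open>\<open>UNIV\<close> plays the part of \<open>S\<close>.\<close>
  have "ennreal (3/8 * measure lborel (UNIV \<inter> unit_box :: (real^'d) set)) \<le> cheeger unit_box g (\<lambda>x. x $ a)"
  proof (rule cheeger_coordinate_ge_of_speed)
    show "H \<in> sets borel" using H_open by simp
    show "x + s *\<^sub>R axis a 1 \<in> H" if "x \<in> H" for x s
    proof -
      have "axial_dist2 a y (x + s *\<^sub>R axis a 1) = axial_dist2 a y x" for y
        unfolding axial_dist2_def by (rule sum.cong) (auto simp: axis_def)
      then show ?thesis using that by (simp add: H_def)
    qed
    show "weight a b e (profile a c x) a = 4/3" if x: "x \<in> H" for x
    proof -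
      obtain k where "axial_dist2 a (c k) x < (radius k)\<^sup>2" using x by (auto simp: H_def)
      note * = profile_core[of a c k x, OF this]
      show ?thesis by (simp add: weight_def *)
    qed
    fix x :: "real^'d" and r :: real assume r: "0 < r"
    obtain k where k: "c k \<in> ball x r" using dense[of "ball x r"] r by auto
    have "c k \<in> H" unfolding H_def axial_dist2_def
      by (rule UN_I[of k]) (use radius_pos[of k] in simp_all)
    then have "\<not> negligible (ball x r \<inter> H)"
      using k H_open by (intro open_not_negligible) auto
    moreover have "ball x r \<inter> H \<in> sets lborel" using H_open by simp
    ultimately show "emeasure lborel (ball x r \<inter> H) > 0"
      unfolding negligible_iff_null_sets zero_less_iff_neq_zero
      using null_sets_completionI by blast
  qed simp_all
  then show ?thesis by (simp add: measure_def emeasure_unit_box)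
qed

text \<open>Off the slabs in coordinate \<open>e\<close> no tube is met, so the profile is 1/4 and
  the weight in direction \<open>b\<close> is 4/3. The coordinate \<open>e\<close> is transversal to
  the tubes and unaffected by motion in direction \<open>b\<close>.\<close>

lemma cheeger_transversal_direction_ge: "ennreal (3/16) \<le> cheeger unit_box g (\<lambda>x. x $ b)"
proof -
  define H where "H = {x :: real^'d. \<forall>k. 2 * radius k \<le> \<bar>x $ e - c k $ e\<bar>}"
  have H: "H \<in> sets borel" unfolding H_def by measurable
  have H_inv: "x + s *\<^sub>R axis b 1 \<in> H" if "x \<in> H" for x s
    using that abe(3) by (simp add: H_def axis_def)
  define S where "S = {x \<in> H. \<forall>r>0. emeasure lborel (ball x r \<inter> H) > 0}"
  have S: "S \<in> sets borel" and HS: "emeasure lborel (H - S) = 0"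
    unfolding S_def by (rule positive_measure_points[OF H])+
  note [measurable] = H S
  let ?T = "\<lambda>k. {x \<in> unit_box. \<forall>m\<in>{e}. \<bar>x $ m - c k $ m\<bar> < 2 * radius k}"
  have T: "emeasure lborel (?T k) \<le> ennreal (4 * radius k)" for k
    using emeasure_slab_le[of "2 * radius k" "{e}" "c k"] radius_pos[of k] by simp
  have "emeasure lborel (\<Union>k. ?T k) \<le> (\<Sum>k. emeasure lborel (?T k))"
    by (rule emeasure_subadditive_countably) auto
  also have "\<dots> \<le> (\<Sum>k. ennreal (4 * radius k))"
    by (rule suminf_le[OF T summableI summableI])
  also have "\<dots> = ennreal (1/2)"
    using sums_mult[OF radius_sums, of 4] radius_pos
    by (subst suminf_ennreal_eq[of _ "1/2"]) (auto simp: less_imp_le)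
  finally have T2: "emeasure lborel (\<Union>k. ?T k) \<le> ennreal (1/2)" .
  \<comment> \<open>Up to the null set \<open>H - S\<close>, a point of the box lies in
    \<open>S\<close> or in a slab; the slabs take at most 1/2, which leaves measure at least 1/2 for
    \<open>S\<close>.\<close>
  have "unit_box \<subseteq> (S \<inter> unit_box) \<union> ((H - S) \<union> (\<Union>k. ?T k))"
    by (auto simp: H_def not_le)
  then have "emeasure lborel (unit_box :: (real^'d) set) \<le> emeasure lborel ((S \<inter> unit_box) \<union> ((H - S) \<union> (\<Union>k. ?T k)))"
    by (intro emeasure_mono) measurable
  also have "\<dots> \<le> emeasure lborel (S \<inter> unit_box) + emeasure lborel ((H - S) \<union> (\<Union>k. ?T k))"
    by (rule emeasure_subadditive) measurable
  also have "\<dots> \<le> emeasure lborel (S \<inter> unit_box) + (emeasure lborel (H - S) + emeasure lborel (\<Union>k. ?T k))"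
    by (intro add_left_mono emeasure_subadditive) measurable
  also have "\<dots> \<le> emeasure lborel (S \<inter> unit_box) + ennreal (1/2)"
    using T2 HS by (intro add_left_mono) simp
  finally have "1 \<le> emeasure lborel (S \<inter> unit_box) + ennreal (1/2)" by (simp add: emeasure_unit_box)
  moreover have "emeasure lborel (S \<inter> unit_box) \<le> emeasure lborel (unit_box :: (real^'d) set)"
    by (rule emeasure_mono) auto
  then have "emeasure lborel (S \<inter> unit_box) = ennreal (measure lborel (S \<inter> unit_box))"
    unfolding emeasure_unit_box by (intro emeasure_eq_ennreal_measure) (auto simp: top_unique)
  ultimately have "ennreal 1 \<le> ennreal (measure lborel (S \<inter> unit_box) + 1/2)" by simp
  then have half: "1/2 \<le> measure lborel (S \<inter> unit_box)" by (subst (asm) ennreal_le_iff) auto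
  have "ennreal (3/16) \<le> ennreal (3/8 * measure lborel (S \<inter> unit_box))"
    using half by (intro ennreal_leI) simp
  also have "\<dots> \<le> cheeger unit_box g (\<lambda>x. x $ b)"
  proof (rule cheeger_coordinate_ge_of_speed[OF H H_inv _ S])
    show "weight a b e (profile a c x) b = 4/3" if "x \<in> H" for x
    proof -
      have "profile a c x = 1/4" by (rule profile_off_tubes[of e]) (use that abe in \<open>auto simp: H_def\<close>)
      note * = this
      show ?thesis using abe(1) by (simp add: weight_def *)
    qed
    show "x + s *\<^sub>R axis b 1 \<in> S" if "x \<in> S" for x s
      using that H_inv positive_measure_translate[OF H H_inv] by (simp add: S_def)
    show "emeasure lborel (ball x r \<inter> H) > 0" if "x \<in> S" "0 < r" for x r
      using that by (simp add: S_def)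
  qed
  finally show ?thesis .
qed

lemma not_inf_hilbertian_g:
  assumes dense: "\<And>X. open X \<Longrightarrow> X \<noteq> {} \<Longrightarrow> \<exists>k. c k \<in> X"
  shows "\<not> inf_hilbertian unit_box g"
proof
  assume "inf_hilbertian unit_box g"
  then have par: "cheeger unit_box g (\<lambda>x. x $ a + x $ b) + cheeger unit_box g (\<lambda>x. x $ a - x $ b) =
      2 * cheeger unit_box g (\<lambda>x. x $ a) + 2 * cheeger unit_box g (\<lambda>x. x $ b)"
    unfolding inf_hilbertian_def by simp
  have "cheeger unit_box g (\<lambda>x. (axis a 1 + axis b 1) \<bullet> x) \<le> 1/2"
    "cheeger unit_box g (\<lambda>x. (axis a 1 - axis b 1) \<bullet> x) \<le> 1/2"
    by (rule cheeger_diagonal_le; use abe in \<open>simp add: axis_def\<close>)+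
  moreover have "(1/2 :: ennreal) = ennreal (1/2)"
  proof -
    have "ennreal 1 / ennreal 2 = ennreal (1/2)" by (rule divide_ennreal) auto
    then show ?thesis by (simp only: ennreal_1 ennreal_numeral)
  qed
  ultimately have up: "cheeger unit_box g (\<lambda>x. x $ a + x $ b) \<le> ennreal (1/2)"
    "cheeger unit_box g (\<lambda>x. x $ a - x $ b) \<le> ennreal (1/2)"
    by (simp_all only: inner_add_left inner_diff_left inner_axis' inner_real_def mult_1)
  \<comment> \<open>The lower bounds give 9/8 for the right-hand side of the parallelogram identity,
    while the diagonals give at most 1 for the left-hand side.\<close>
  have "ennreal (9/8) = 2 * ennreal (3/8) + 2 * ennreal (3/16)"
    by (simp flip: ennreal_numeral ennreal_mult ennreal_plus)
  also have "\<dots> \<le> 2 * cheeger unit_box g (\<lambda>x. x $ a) + 2 * cheeger unit_box g (\<lambda>x. x $ b)"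
    by (intro add_mono mult_left_mono cheeger_highway_direction_ge[OF dense] cheeger_transversal_direction_ge) auto
  also have "\<dots> \<le> ennreal (1/2) + ennreal (1/2)"
    unfolding par[symmetric] by (rule add_mono[OF up])
  also have "\<dots> = ennreal (1/2 + 1/2)" by (rule ennreal_plus[symmetric]) auto
  finally show False by (subst (asm) ennreal_le_iff) auto
qed

end

theorem theorem2:
  fixes p :: real
  assumes "CARD('d::finite) \<ge> 3" and "1 \<le> p" and "p < real CARD('d) - 1"
  shows "\<exists>(U :: (real^'d) set) g. open U \<and> U \<noteq> {} \<and> riem_metric U g \<and>
           Linf_loc_metric U g \<and> W1p_loc_metric p U g \<and> \<not> inf_hilbertian U g"
proof -
  obtain A :: "'d set" where "card A = 3" using obtain_subset_with_card_n[OF assms(1)] by metis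
  then obtain a b e :: 'd where abe: "a \<noteq> b" "a \<noteq> e" "b \<noteq> e"
    by (auto simp: card_Suc_eq numeral_3_eq_3)
  \<comment> \<open>The enumerated dense set provides the centres \<open>c k\<close> of the
    tubes.\<close>
  obtain Q :: "(real^'d) set" where Q: "countable Q" "\<And>X. open X \<Longrightarrow> X \<noteq> {} \<Longrightarrow> \<exists>q\<in>Q. q \<in> X"
    using countable_dense_exists by blast
  have "Q \<noteq> {}" using Q(2)[of UNIV] by auto
  then have range: "range (from_nat_into Q) = Q" by (rule range_from_nat_into[OF _ Q(1)])
  have dense: "\<exists>k. from_nat_into Q k \<in> X" if "open X" "X \<noteq> {}" for X
    using Q(2)[OF that] range by (metis rangeE)
  let ?g = "highway_metric a b e (from_nat_into Q)"
  have "(unit_box :: (real^'d) set) \<noteq> {}" using emeasure_unit_box[where 'd = 'd] by auto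
  moreover note riem_metric_g[OF abe] Linf_loc_metric_g[OF abe] W1p_loc_metric_g[OF abe assms]
    not_inf_hilbertian_g[OF abe dense]
  ultimately show ?thesis using open_box by blast
qed

end
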